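(* Let $\gamma>1$ and $K\in\mathbb{R}$, and consider the two-sided sonic configuration $(\Omega^\pm,\varphi^\pm,\Gamma_{\rm sonic})$ described in the context. Let $Q=(\xi_*,f(\xi_* ))\in\Gamma_{\rm sonic}$, let $\psi^Q$ be as defined in the context, and let $$\mathbf n_Q=\frac{(f'(\xi_* ),-1)}{\sqrt{1+(f'(\xi_* ))^2}},\qquad \boldsymbol\tau_Q=\frac{(1,f'(\xi_* ))}{\sqrt{1+(f'(\xi_* ))^2}}$$ be the unit normal and unit tangential vectors to $\Gamma_{\rm sonic}$ at $Q$. Suppose that $\partial^\perp c(Q)=0$. If there exist a constant $a_1\in(0,\frac1{\gamma+1})$ and a sufficiently small constant $\varepsilon>0$ such that either $$\psi^Q(Q+t\mathbf n_Q)<a_1\Big(\frac{\mathbf n_Q\cdot(U,V)(Q)}{c(Q)}\Big)^2t^2\quad\text{for all } t\in(0,\varepsilon),\text{ or for all } t\in(-\varepsilon,0),$$ or $$\psi^Q(Q+s\boldsymbol\tau_Q)<a_1\Big(\frac{\boldsymbol\tau_Q\cdot(U,V)(Q)}{c(Q)}\Big)^2s^2\quad\text{for all } s\in(0,\varepsilon),\text{ or for all } s\in(-\varepsilon,0),$$ then the sonic point $Q$ is exceptional.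
   Context: Equation. Fix $\gamma>1$ and $K\in\mathbb{R}$. In coordinates $(\xi,\eta)\in\mathbb{R}^2$, with $D=(\partial_\xi,\partial_\eta)$, self-similar potential flow is $\mathrm{div}(\rho D\varphi)+2\rho=0$ with $\rho=(K-\varphi-\frac12|D\varphi|^2)^{1/(\gamma-1)}$. The sonic speed $c\ge 0$ is given by $c^2=(\gamma-1)(K-\varphi-\frac12|D\varphi|^2)$. The pseudo-velocity is $(U,V)=D\varphi$ and the velocity is $(u,v)=(U,V)+(\xi,\eta)$. Equivalently, $(c^2-U^2)u_\xi-UV(u_\eta+v_\xi)+(c^2-V^2)v_\eta=0$, $u_\eta=v_\xi$, and $\frac{c^2}{\gamma-1}+\frac{U^2+V^2}{2}+\varphi=K$. The solution is (pseudo-)supersonic where $|D\varphi|>c$, (pseudo-)subsonic where $|D\varphi|<c$, and a point is (pseudo-)sonic if $|D\varphi|=c$. Configuration. $\Omega^-$ and $\Omega^+$ are the supersonic and subsonic regions, lying on the two sides of the curve formed by all sonic points; $\Gamma_{\rm sonic}$ denotes the relative interior of that curve. $\varphi^-\in C^2(\overline{\Omega^-})$ is a supersonic solution in $\Omega^-$, $\varphi^+\in C^2(\Omega^+\cup\Gamma_{\rm sonic})$ is a subsonic solution in $\Omega^+$, and $\varphi^+=\varphi^-$, $D\varphi^+=D\varphi^-$ on $\Gamma_{\rm sonic}$. Write $\varphi=\varphi^\pm$ on the respective sides. For each $Q\in\Gamma_{\rm sonic}$, in suitable (rotated) coordinates $(\xi,\eta)$ (the equations are invariant under rotation) there is $r>0$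 such that $\Gamma_{\rm sonic}\cap B_r(Q)=\{\eta=f(\xi)\}\cap B_r(Q)$ with $f\in C^{1,1}((l_1,l_2))$, $l_1<l_2$. Notation. $\partial^\perp=V\partial_\xi-U\partial_\eta$; derivatives of $c$ at points of $\Gamma_{\rm sonic}$ are one-sided. A point $(\xi,f(\xi))\in\Gamma_{\rm sonic}$ is exceptional if $(U,V)(\xi,f(\xi))$ is normal to $\Gamma_{\rm sonic}$ there, i.e. $U+f'(\xi)V=0$. Definition of $\psi^Q$. For $Q=(\xi_*,\eta_* )\in\Gamma_{\rm sonic}$, $\eta_*=f(\xi_* )$, put $(u_2^Q,v_2^Q)=D\varphi(Q)+(\xi_*,\eta_* )$, $$\varphi_2^Q(\xi,\eta)=-\tfrac12\big((\xi^2+\eta^2)-(\xi_*^2+\eta_*^2)\big)+u_2^Q(\xi-\xi_* )+v_2^Q(\eta-\eta_* )+\varphi(Q),$$ and $\psi^Q=\varphi-\varphi_2^Q$ (with $\varphi=\varphi^\pm$ on the respective sides of $\Gamma_{\rm sonic}$). *)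

theory Defs
  imports "HOL-Analysis.Analysis"
begin

type_synonym plane = "real \<times> real"

definition rot :: "real \<Rightarrow> plane \<Rightarrow> plane" where
  "rot \<theta> x = (cos \<theta> * fst x - sin \<theta> * snd x, sin \<theta> * fst x + cos \<theta> * snd x)"

definition grad :: "(plane \<Rightarrow> real) \<Rightarrow> plane \<Rightarrow> plane" where
  "grad \<phi> x = (frechet_derivative \<phi> (at x) (1, 0), frechet_derivative \<phi> (at x) (0, 1))"

text \<open>
  \<open>\<phi> \<in> C\<^sup>2(A)\<close> for an open set \<open>\<Omega>\<close> together with part of its boundary,
  \<open>\<Omega> \<subseteq> A \<subseteq> closure \<Omega>\<close>: the function is twice continuously differentiable in \<open>\<Omega>\<close>, and it and its
  derivatives up to order two extend continuously to \<open>A\<close>.  The values of \<open>\<phi>\<close> on \<open>A - \<Omega>\<close> are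
  the continuous extension of those in \<open>\<Omega>\<close>.
\<close>
definition C2_upto :: "plane set \<Rightarrow> plane set \<Rightarrow> (plane \<Rightarrow> real) \<Rightarrow> bool" where
  "C2_upto \<Omega> A \<phi> \<longleftrightarrow>
     continuous_on A \<phi> \<and>
     (\<forall>x\<in>\<Omega>. \<phi> differentiable (at x)) \<and>
     (\<exists>G. continuous_on A G \<and> (\<forall>x\<in>\<Omega>. G x = grad \<phi> x)) \<and>
     (\<exists>H :: plane \<Rightarrow> plane \<Rightarrow>\<^sub>L plane. continuous_on A H \<and>
        (\<forall>x\<in>\<Omega>. (grad \<phi> has_derivative blinfun_apply (H x)) (at x)))"

text \<open>
  The pseudo-velocity \<open>(U, V) = D\<phi>\<close>, computed from the side \<open>\<Omega>\<close>.  For \<open>\<phi> \<in> C\<^sup>2(A)\<close> as above this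
  is \<open>grad \<phi> x\<close> if \<open>x \<in> \<Omega>\<close>, and the continuous extension of \<open>grad \<phi>\<close> if \<open>x \<in> A - \<Omega>\<close>.
\<close>
definition pseudo_velocity :: "plane set \<Rightarrow> (plane \<Rightarrow> real) \<Rightarrow> plane \<Rightarrow> plane" where
  "pseudo_velocity \<Omega> \<phi> x = Lim (at x within \<Omega>) (grad \<phi>)"

definition bernoulli :: "real \<Rightarrow> plane set \<Rightarrow> (plane \<Rightarrow> real) \<Rightarrow> plane \<Rightarrow> real" where
  "bernoulli K \<Omega> \<phi> x = K - \<phi> x - 1/2 * (norm (pseudo_velocity \<Omega> \<phi> x))\<^sup>2"

definition density :: "real \<Rightarrow> real \<Rightarrow> plane set \<Rightarrow> (plane \<Rightarrow> real) \<Rightarrow> plane \<Rightarrow> real" where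
  "density \<gamma> K \<Omega> \<phi> x = bernoulli K \<Omega> \<phi> x powr (1 / (\<gamma> - 1))"

definition sonic_speed :: "real \<Rightarrow> real \<Rightarrow> plane set \<Rightarrow> (plane \<Rightarrow> real) \<Rightarrow> plane \<Rightarrow> real" where
  "sonic_speed \<gamma> K \<Omega> \<phi> x = sqrt ((\<gamma> - 1) * bernoulli K \<Omega> \<phi> x)"

text \<open>
  The equation \<open>div(\<rho> D\<phi>) + 2\<rho> = 0\<close> in \<open>\<Omega>\<close>, in the classical sense.  Nonnegativity of the
  Bernoulli expression is what makes \<open>\<rho>\<close> and \<open>c\<close> well defined.
\<close>
definition potential_flow :: "real \<Rightarrow> real \<Rightarrow> plane set \<Rightarrow> (plane \<Rightarrow> real) \<Rightarrow> bool" where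
  "potential_flow \<gamma> K \<Omega> \<phi> \<longleftrightarrow>
     (\<forall>\<xi> \<eta>. (\<xi>, \<eta>) \<in> \<Omega> \<longrightarrow>
        bernoulli K \<Omega> \<phi> (\<xi>, \<eta>) \<ge> 0 \<and>
        (\<exists>p q.
          ((\<lambda>s. density \<gamma> K \<Omega> \<phi> (s, \<eta>) * fst (pseudo_velocity \<Omega> \<phi> (s, \<eta>)))
             has_real_derivative p) (at \<xi>) \<and>
          ((\<lambda>s. density \<gamma> K \<Omega> \<phi> (\<xi>, s) * snd (pseudo_velocity \<Omega> \<phi> (\<xi>, s)))
             has_real_derivative q) (at \<eta>) \<and>
          p + q + 2 * density \<gamma> K \<Omega> \<phi> (\<xi>, \<eta>) = 0))"

text \<open>
  A curve, with or without end points, is a connected one-dimensional manifold with (possibly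
  empty) boundary; closed and unbounded curves are included.  Its relative interior is its
  interior as a manifold, i.e. the curve without its end points.
\<close>
definition is_curve :: "plane set \<Rightarrow> bool" where
  "is_curve S \<longleftrightarrow> connected S \<and>
     (\<forall>x\<in>S. \<exists>N. open N \<and> x \<in> N \<and>
        ((S \<inter> N) homeomorphic {0<..<1::real} \<or> (S \<inter> N) homeomorphic {0..<1::real}))"

definition curve_interior :: "plane set \<Rightarrow> plane set" where
  "curve_interior S =
     {x \<in> S. \<exists>N. open N \<and> x \<in> N \<and> (S \<inter> N) homeomorphic {0<..<1::real}}"

text \<open>
  The sonic points.  They are read off from \<open>\<phi>\<^sup>-\<close>, which is \<open>C\<^sup>2\<close> up to the whole boundary of
  \<open>\<Omega>\<^sup>-\<close>; at end points of the sonic curve \<open>\<phi>\<^sup>+\<close> need not be \<open>C\<^sup>1\<close>.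
\<close>
definition sonic_points :: "real \<Rightarrow> real \<Rightarrow> plane set \<Rightarrow> plane set \<Rightarrow> (plane \<Rightarrow> real) \<Rightarrow> plane set" where
  "sonic_points \<gamma> K \<Omega>m \<Omega>p \<phi>m =
     {x \<in> closure \<Omega>m \<inter> closure \<Omega>p. norm (pseudo_velocity \<Omega>m \<phi>m x) = sonic_speed \<gamma> K \<Omega>m \<phi>m x}"

text \<open>\<open>f \<in> C\<^sup>1\<^sup>,\<^sup>1((l1, l2))\<close>\<close>
definition C11 :: "real \<Rightarrow> real \<Rightarrow> (real \<Rightarrow> real) \<Rightarrow> bool" where
  "C11 l1 l2 f \<longleftrightarrow>
     (\<forall>\<xi>\<in>{l1<..<l2}. f field_differentiable (at \<xi>)) \<and>
     (\<exists>L. L-lipschitz_on {l1<..<l2} (deriv f))"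

text \<open>
  In the coordinates rotated by \<open>\<theta>\<close> (a point with rotated coordinates \<open>(\<xi>, \<eta>)\<close> is
  \<open>rot \<theta> (\<xi>, \<eta>)\<close>), the curve \<open>\<Gamma>\<close> is near \<open>Q\<close> the graph of \<open>f\<close>, and the two regions are
  the two sides of that graph (in either order).
\<close>
definition graph_at ::
  "plane set \<Rightarrow> plane set \<Rightarrow> plane set \<Rightarrow> plane \<Rightarrow> real \<Rightarrow> (real \<Rightarrow> real) \<Rightarrow> real \<Rightarrow> real \<Rightarrow> real \<Rightarrow> bool" where
  "graph_at \<Omega>m \<Omega>p \<Gamma> Q \<theta> f l1 l2 r \<longleftrightarrow>
     0 < r \<and> l1 < l2 \<and> C11 l1 l2 f \<and>
     Q \<in> rot \<theta> ` {(\<xi>, f \<xi>) |\<xi>. l1 < \<xi> \<and> \<xi> < l2} \<and>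
     \<Gamma> \<inter> ball Q r = rot \<theta> ` {(\<xi>, f \<xi>) |\<xi>. l1 < \<xi> \<and> \<xi> < l2} \<inter> ball Q r \<and>
     (\<exists>\<Omega>1 \<Omega>2. (\<Omega>1, \<Omega>2) \<in> {(\<Omega>m, \<Omega>p), (\<Omega>p, \<Omega>m)} \<and>
        rot \<theta> ` {(\<xi>, \<eta>) |\<xi> \<eta>. l1 < \<xi> \<and> \<xi> < l2 \<and> \<eta> < f \<xi>} \<inter> ball Q r \<subseteq> \<Omega>1 \<and>
        rot \<theta> ` {(\<xi>, \<eta>) |\<xi> \<eta>. l1 < \<xi> \<and> \<xi> < l2 \<and> \<eta> > f \<xi>} \<inter> ball Q r \<subseteq> \<Omega>2)"

definition sonic_configuration ::
  "real \<Rightarrow> real \<Rightarrow> plane set \<Rightarrow> plane set \<Rightarrow> (plane \<Rightarrow> real) \<Rightarrow> (plane \<Rightarrow> real) \<Rightarrow> plane set \<Rightarrow> bool" where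
  "sonic_configuration \<gamma> K \<Omega>m \<Omega>p \<phi>m \<phi>p \<Gamma> \<longleftrightarrow>
     open \<Omega>m \<and> open \<Omega>p \<and> \<Omega>m \<inter> \<Omega>p = {} \<and>
     is_curve (sonic_points \<gamma> K \<Omega>m \<Omega>p \<phi>m) \<and>
     \<Gamma> = curve_interior (sonic_points \<gamma> K \<Omega>m \<Omega>p \<phi>m) \<and>
     C2_upto \<Omega>m (closure \<Omega>m) \<phi>m \<and> potential_flow \<gamma> K \<Omega>m \<phi>m \<and>
     (\<forall>x\<in>\<Omega>m. norm (pseudo_velocity \<Omega>m \<phi>m x) > sonic_speed \<gamma> K \<Omega>m \<phi>m x) \<and>
     C2_upto \<Omega>p (\<Omega>p \<union> \<Gamma>) \<phi>p \<and> potential_flow \<gamma> K \<Omega>p \<phi>p \<and>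
     (\<forall>x\<in>\<Omega>p. norm (pseudo_velocity \<Omega>p \<phi>p x) < sonic_speed \<gamma> K \<Omega>p \<phi>p x) \<and>
     (\<forall>x\<in>\<Gamma>. \<phi>p x = \<phi>m x \<and> pseudo_velocity \<Omega>p \<phi>p x = pseudo_velocity \<Omega>m \<phi>m x) \<and>
     (\<forall>Q\<in>\<Gamma>. \<exists>\<theta> f l1 l2 r. graph_at \<Omega>m \<Omega>p \<Gamma> Q \<theta> f l1 l2 r)"

text \<open>
  \<open>\<partial>\<^sup>\<bottom> c (Q) = d\<close> with \<open>\<partial>\<^sup>\<bottom> = V \<partial>\<^sub>\<xi> - U \<partial>\<^sub>\<eta>\<close>, where the derivative of \<open>c\<close> at \<open>Q \<in> \<Gamma>\<close> is the
  one-sided derivative from \<open>\<Omega>\<close>.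
\<close>
definition has_perp_derivative_c ::
  "real \<Rightarrow> real \<Rightarrow> plane set \<Rightarrow> (plane \<Rightarrow> real) \<Rightarrow> plane \<Rightarrow> real \<Rightarrow> bool" where
  "has_perp_derivative_c \<gamma> K \<Omega> \<phi> Q d \<longleftrightarrow>
     (\<exists>D. (sonic_speed \<gamma> K \<Omega> \<phi> has_derivative D) (at Q within \<Omega>) \<and>
          D (snd (pseudo_velocity \<Omega> \<phi> Q), - fst (pseudo_velocity \<Omega> \<phi> Q)) = d)"

text \<open>On \<open>\<Gamma>\<close> the two potentials agree, so it does not matter which one is used there.\<close>
definition two_sided :: "plane set \<Rightarrow> (plane \<Rightarrow> real) \<Rightarrow> (plane \<Rightarrow> real) \<Rightarrow> plane \<Rightarrow> real" where
  "two_sided \<Omega>p \<phi>m \<phi>p x = (if x \<in> \<Omega>p then \<phi>p x else \<phi>m x)"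

text \<open>
  \<open>phi2 \<phi> W Q\<close> and \<open>psi \<phi> W Q\<close> are \<open>\<phi>\<^sub>2\<^sup>Q\<close> and \<open>\<psi>\<^sup>Q\<close>, where \<open>W = D\<phi>(Q)\<close>, so that
  \<open>W + Q = (u\<^sub>2\<^sup>Q, v\<^sub>2\<^sup>Q)\<close>.
\<close>
definition phi2 :: "(plane \<Rightarrow> real) \<Rightarrow> plane \<Rightarrow> plane \<Rightarrow> plane \<Rightarrow> real" where
  "phi2 \<phi> W Q x = - 1/2 * ((norm x)\<^sup>2 - (norm Q)\<^sup>2) + (W + Q) \<bullet> (x - Q) + \<phi> Q"

definition psi :: "(plane \<Rightarrow> real) \<Rightarrow> plane \<Rightarrow> plane \<Rightarrow> plane \<Rightarrow> real" where
  "psi \<phi> W Q x = \<phi> x - phi2 \<phi> W Q x"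

text \<open>Unit normal and tangent to \<open>{\<eta> = f(\<xi>)}\<close>, given in the unrotated coordinates.\<close>
definition unit_normal :: "real \<Rightarrow> (real \<Rightarrow> real) \<Rightarrow> real \<Rightarrow> plane" where
  "unit_normal \<theta> f \<xi> = (1 / sqrt (1 + (deriv f \<xi>)\<^sup>2)) *\<^sub>R rot \<theta> (deriv f \<xi>, -1)"

definition unit_tangent :: "real \<Rightarrow> (real \<Rightarrow> real) \<Rightarrow> real \<Rightarrow> plane" where
  "unit_tangent \<theta> f \<xi> = (1 / sqrt (1 + (deriv f \<xi>)\<^sup>2)) *\<^sub>R rot \<theta> (1, deriv f \<xi>)"

text \<open>
  In the rotated coordinates the pseudo-velocity \<open>W\<close> has components
  \<open>(U, V) = rot (- \<theta>) W\<close>; the point over \<open>\<xi>\<close> is exceptional if \<open>U + f'(\<xi>) V = 0\<close>.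
\<close>
definition exceptional :: "real \<Rightarrow> (real \<Rightarrow> real) \<Rightarrow> real \<Rightarrow> plane \<Rightarrow> bool" where
  "exceptional \<theta> f \<xi> W \<longleftrightarrow> fst (rot (- \<theta>) W) + deriv f \<xi> * snd (rot (- \<theta>) W) = 0"

end

theory Submission
  imports Defs
begin

text \<open>
  Suppose \<open>Q\<close> is not exceptional, and write \<open>W = D\<phi>(Q)\<close>, \<open>q = \<bar>W\<bar>\<^sup>2 = c\<^sup>2 > 0\<close>.  The equation at the sonic
  point, the vanishing of \<open>\<partial>\<^sup>\<bottom> c\<close> and the vanishing of \<open>c\<^sup>2 - \<bar>D\<phi>\<bar>\<^sup>2\<close> along the curve then
  determine \<open>D\<^sup>2\<phi>(Q)\<close> completely: it is \<open>- (\<gamma> - 1) / (\<gamma> + 1)\<close> in the direction of \<open>W\<close> and \<open>- 1\<close> across.  Since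
  \<open>D\<phi>\<close> is continuous across the curve and \<open>W\<close> is not normal to it, this holds on the subsonic side
  whichever side \<open>\<partial>\<^sup>\<bottom> c\<close> is taken from.  Consequently \<open>c\<^sup>2 - \<bar>D\<phi>\<bar>\<^sup>2\<close>, which is positive in \<open>\<Omega>\<^sup>+\<close>,
  vanishes at \<open>Q\<close> together with its gradient, and this contradicts the Hopf lemma, applied to
  \<open>Z(x) = (\<gamma> - 1) (K - \<phi>) - (\<gamma> + 1) W \<cdot> D\<phi> + (\<gamma> + 1) q / 2 - \<gamma> / (2 q) (W\<^sup>\<bottom> \<cdot> (x - Q))\<^sup>2\<close>.
  Near \<open>Q\<close>, inside a disk touching the curve, \<open>Z \<ge> c\<^sup>2 - \<bar>D\<phi>\<bar>\<^sup>2\<close>; and the linear operator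
  \<open>(c\<^sup>2 I - D\<phi> \<otimes> D\<phi>) : D\<^sup>2\<close> maps \<open>Z\<close> to \<open>- q\<close> up to a small error.  The operator degenerates at \<open>Q\<close>, but
  the strictly negative right-hand side makes the barrier argument work nevertheless.  As \<open>D\<phi>\<close> is
  only \<open>C\<^sup>1\<close>, the maximum principle is applied with \<open>W \<cdot> D\<phi>\<close> replaced by a symmetric difference quotient
  of \<open>\<phi>\<close> and the operator by its average over the two points involved.
\<close>

section \<open>Gradients and second derivatives\<close>

text \<open>The one-dimensional mean value theorem along the segment. Differentiability is asked for
  on the open segment only, so an end may lie on the boundary of the flow region.\<close>

lemma gradient_mvt:
  fixes g :: "'a::real_inner \<Rightarrow> real"
  assumes "x \<noteq> y" and "continuous_on (closed_segment x y) g"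
    and "\<And>z. z \<in> open_segment x y \<Longrightarrow> GDERIV g z :> p z"
  obtains z where "z \<in> open_segment x y" "g y - g x = p z \<bullet> (y - x)"
proof -
  define l where "l t = x + t *\<^sub>R (y - x)" for t
  have cl: "l t \<in> closed_segment x y" if "0 \<le> t" "t \<le> 1" for t
    using that unfolding closed_segment_def l_def by (auto simp: algebra_simps intro!: exI[of _ t])
  have op: "l t \<in> open_segment x y" if "0 < t" "t < 1" for t
    using that assms(1) unfolding in_segment l_def by (auto simp: algebra_simps intro!: exI[of _ t])
  obtain t where t: "0 < t" "t < 1" "g (l 1) - g (l 0) = (1 - 0) *\<^sub>R (y - x) \<bullet> p (l t)"
  proof (rule mvt[of 0 1 "\<lambda>t. g (l t)" "\<lambda>t h. h *\<^sub>R (y - x) \<bullet> p (l t)"])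
    show "continuous_on {0..1} (\<lambda>t. g (l t))"
      by (rule continuous_on_compose2[OF assms(2)]) (auto simp: l_def cl[unfolded l_def] intro!: continuous_intros)
    fix t :: real assume "0 < t" "t < 1"
    then have "(g has_derivative (\<lambda>u. u \<bullet> p (l t))) (at (l t))"
      using assms(3) op unfolding gderiv_def by blast
    moreover have "(l has_derivative (\<lambda>h. h *\<^sub>R (y - x))) (at t)"
      unfolding l_def by (auto intro!: derivative_eq_intros)
    ultimately show "((\<lambda>t. g (l t)) has_derivative (\<lambda>h. h *\<^sub>R (y - x) \<bullet> p (l t))) (at t)"
      using has_derivative_compose by blast
  qed auto
  show thesis
    using that[OF op[OF t(1,2)]] t(3) by (simp add: l_def inner_commute)
qed

text \<open>Were \<open>m\<close> negative, \<open>g'\<close>, which vanishes at the minimum, would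
  be negative just to the right of it, and \<open>g\<close> would drop below
  \<open>g 0\<close>.\<close>

lemma second_derivative_nonneg_at_min:
  fixes g g' :: "real \<Rightarrow> real"
  assumes "0 < d"
    and min: "\<And>t. \<bar>t\<bar> < d \<Longrightarrow> g 0 \<le> g t"
    and g: "\<And>t. \<bar>t\<bar> < d \<Longrightarrow> (g has_real_derivative g' t) (at t)"
    and g': "(g' has_real_derivative m) (at 0)"
  shows "0 \<le> m"
proof (rule ccontr)
  assume "\<not> 0 \<le> m"
  have "g' 0 = 0"
    by (rule DERIV_local_min[OF g[of 0] \<open>0 < d\<close>]) (use min \<open>0 < d\<close> in auto)
  then obtain e where e: "e > 0" "\<And>h. 0 < h \<Longrightarrow> h < e \<Longrightarrow> g' h < 0"
    using DERIV_neg_dec_right[OF g'] \<open>\<not> 0 \<le> m\<close> by fastforce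
  define t where "t = min d e / 2"
  have t: "0 < t" "t < d" "t < e" using \<open>0 < d\<close> e by (auto simp: t_def)
  obtain z where z: "0 < z" "z < t" "g t - g 0 = (t - 0) * g' z"
    using MVT2[of 0 t g g'] g t by force
  have "g' z < 0" using e z t by auto
  then have "t * g' z < 0" using t by (simp add: mult_pos_neg)
  then have "g t < g 0" using z by simp
  then show False using min[of t] t by auto
qed

text \<open>Restriction to the line through \<open>x\<close> in direction \<open>d\<close> reduces
  this to one variable; the gradient \<open>P\<close> is differentiated only at \<open>x\<close>
  itself.\<close>

lemma gradient_second_derivative_nonneg_at_min:
  fixes F :: "'a::real_inner \<Rightarrow> real"
  assumes "open S" "x \<in> S" and min: "\<And>y. y \<in> S \<Longrightarrow> F x \<le> F y"
    and F: "\<And>y. y \<in> S \<Longrightarrow> GDERIV F y :> P y"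
    and P: "(P has_derivative B) (at x)"
  shows "0 \<le> d \<bullet> B d"
proof -
  define l where "l t = x + t *\<^sub>R d" for t
  have l: "(l has_derivative (\<lambda>h. h *\<^sub>R d)) (at t)" for t
    unfolding l_def by (auto intro!: derivative_eq_intros)
  have "open (l -` S)"
    by (rule open_vimage[OF assms(1)]) (auto simp: l_def intro!: continuous_intros)
  moreover have "0 \<in> l -` S" using \<open>x \<in> S\<close> by (simp add: l_def)
  ultimately obtain e where "e > 0" "ball 0 e \<subseteq> l -` S" by (meson openE)
  then have e: "e > 0" "\<And>t. \<bar>t\<bar> < e \<Longrightarrow> l t \<in> S" by auto
  show ?thesis
  proof (rule second_derivative_nonneg_at_min[OF e(1), where g = "\<lambda>t. F (l t)" and g' = "\<lambda>t. d \<bullet> P (l t)"])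
    fix t :: real assume t: "\<bar>t\<bar> < e"
    show "F (l 0) \<le> F (l t)" using min e(2)[OF t] by (simp add: l_def)
    have "(F has_derivative (\<lambda>h. h \<bullet> P (l t))) (at (l t))"
      using F[OF e(2)[OF t]] by (simp add: gderiv_def)
    from has_derivative_compose[OF l this]
    show "((\<lambda>t. F (l t)) has_real_derivative d \<bullet> P (l t)) (at t)"
      by (simp add: has_field_derivative_def mult.commute[of _ "d \<bullet> _"])
  next
    have "linear B" using P by (simp add: has_derivative_linear)
    have "(P has_derivative B) (at (l 0))" using P by (simp add: l_def)
    from has_derivative_compose[OF l this]
    have "((\<lambda>t. d \<bullet> P (l t)) has_derivative (\<lambda>h. d \<bullet> B (h *\<^sub>R d))) (at 0)"
      by (rule has_derivative_inner_right)
    then show "((\<lambda>t. d \<bullet> P (l t)) has_real_derivative d \<bullet> B d) (at 0)"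
      using linear_scale[OF \<open>linear B\<close>]
      by (simp add: has_field_derivative_def mult.commute[of _ "d \<bullet> _"])
  qed
qed

text \<open>Both sides arise as limits of the same second difference quotient.\<close>
lemma gradient_derivative_symmetric:
  fixes \<phi> :: "'a::real_inner \<Rightarrow> real" and H :: "'a \<Rightarrow> 'a \<Rightarrow>\<^sub>L 'a"
  assumes "open S" "x \<in> S"
    and \<phi>: "\<And>y. y \<in> S \<Longrightarrow> GDERIV \<phi> y :> v y"
    and v: "\<And>y. y \<in> S \<Longrightarrow> (v has_derivative H y) (at y)"
    and H: "continuous_on S H"
  shows "a \<bullet> H x b = b \<bullet> H x a"
proof -
  obtain e where e: "e > 0" "ball x e \<subseteq> S" using assms(1,2) openE by blast
  \<comment> \<open>Two applications of the mean value theorem, first in direction \<open>a\<close>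
    and then in direction \<open>b\<close>. The point found depends on the order, but tends to
    \<open>x\<close> with \<open>t\<close> either way.\<close>
  have mixed: "\<exists>z. dist z x \<le> t * (norm a + norm b) \<and>
      \<phi> (x + t *\<^sub>R a + t *\<^sub>R b) - \<phi> (x + t *\<^sub>R a) - \<phi> (x + t *\<^sub>R b) + \<phi> x = t\<^sup>2 * (a \<bullet> H z b)"
    if t: "0 < t" "t * (norm a + norm b) < e" for t a b
  proof -
    have bd: "norm (s *\<^sub>R a + r *\<^sub>R b) \<le> t * (norm a + norm b)" if "0 \<le> s" "s \<le> t" "0 \<le> r" "r \<le> t" for s r
    proof -
      have "norm (s *\<^sub>R a + r *\<^sub>R b) \<le> s * norm a + r * norm b"
        using norm_triangle_ineq[of "s *\<^sub>R a" "r *\<^sub>R b"] that by simp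
      also have "\<dots> \<le> t * norm a + t * norm b" using that by (intro add_mono mult_right_mono) auto
      finally show ?thesis by (simp add: algebra_simps)
    qed
    have inS: "x + s *\<^sub>R a + r *\<^sub>R b \<in> S" if "0 \<le> s" "s \<le> t" "0 \<le> r" "r \<le> t" for s r
    proof -
      have "dist x (x + (s *\<^sub>R a + r *\<^sub>R b)) < e"
        using bd[OF that] t unfolding dist_norm by (metis add_diff_cancel_left' norm_minus_commute order_le_less_trans)
      then have "x + s *\<^sub>R a + r *\<^sub>R b \<in> ball x e" by (simp add: add.assoc)
      then show ?thesis using e by blast
    qed
    define g where "g s = \<phi> (x + s *\<^sub>R a + t *\<^sub>R b) - \<phi> (x + s *\<^sub>R a)" for s
    define g' where "g' s = a \<bullet> (v (x + s *\<^sub>R a + t *\<^sub>R b) - v (x + s *\<^sub>R a))" for s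
    have along: "((\<lambda>s. \<phi> (w + s *\<^sub>R a)) has_real_derivative a \<bullet> v (w + s *\<^sub>R a)) (at s)"
      if "w + s *\<^sub>R a \<in> S" for s w
    proof -
      have "((\<lambda>s. w + s *\<^sub>R a) has_derivative (\<lambda>h. h *\<^sub>R a)) (at s)"
        by (auto intro!: derivative_eq_intros)
      from has_derivative_compose[OF this \<phi>[OF that, unfolded gderiv_def]]
      show ?thesis by (simp add: has_field_derivative_def mult.commute[of _ "a \<bullet> _"])
    qed
    have "(g has_real_derivative g' s) (at s)" if "0 \<le> s" "s \<le> t" for s
      unfolding g_def g'_def inner_diff_right
      using along[of "x + t *\<^sub>R b" s] along[of x s] inS[of s t] inS[of s 0] that t
      by (intro DERIV_diff) (auto simp: ac_simps)
    then obtain s where s: "0 < s" "s < t" "g t - g 0 = (t - 0) * g' s"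
      using MVT2[of 0 t g g'] t by blast
    define k where "k r = a \<bullet> v (x + s *\<^sub>R a + r *\<^sub>R b)" for r
    have "(k has_real_derivative a \<bullet> H (x + s *\<^sub>R a + r *\<^sub>R b) b) (at r)" if "0 \<le> r" "r \<le> t" for r
    proof -
      have "((\<lambda>r. x + s *\<^sub>R a + r *\<^sub>R b) has_derivative (\<lambda>h. h *\<^sub>R b)) (at r)"
        by (auto intro!: derivative_eq_intros)
      from has_derivative_compose[OF this v[OF inS]] that s
      have "((\<lambda>r. v (x + s *\<^sub>R a + r *\<^sub>R b)) has_derivative (\<lambda>h. H (x + s *\<^sub>R a + r *\<^sub>R b) (h *\<^sub>R b))) (at r)"
        by simp
      then have "(k has_derivative (\<lambda>h. a \<bullet> H (x + s *\<^sub>R a + r *\<^sub>R b) (h *\<^sub>R b))) (at r)"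
        unfolding k_def by (rule has_derivative_inner_right)
      then show ?thesis by (simp add: has_field_derivative_def blinfun.scaleR_right mult.commute[of _ "a \<bullet> _"])
    qed
    then obtain r where r: "0 < r" "r < t" "k t - k 0 = (t - 0) * (a \<bullet> H (x + s *\<^sub>R a + r *\<^sub>R b) b)"
      using MVT2[of 0 t k "\<lambda>r. a \<bullet> H (x + s *\<^sub>R a + r *\<^sub>R b) b"] t by blast
    have "dist (x + s *\<^sub>R a + r *\<^sub>R b) x \<le> t * (norm a + norm b)"
      using bd[of s r] s r by (simp add: dist_norm add.assoc)
    moreover have "\<phi> (x + t *\<^sub>R a + t *\<^sub>R b) - \<phi> (x + t *\<^sub>R a) - \<phi> (x + t *\<^sub>R b) + \<phi> x
        = t\<^sup>2 * (a \<bullet> H (x + s *\<^sub>R a + r *\<^sub>R b) b)"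
      using s(3) r(3) by (simp add: g_def g'_def k_def inner_diff_right power2_eq_square)
    ultimately show ?thesis by blast
  qed
  define N where "N = norm a + norm b"
  have N: "N \<ge> 0" by (simp add: N_def)
  \<comment> \<open>The \<open>+ 1\<close> covers vanishing directions and makes
    \<open>t n * N\<close> strictly smaller than \<open>e\<close>.\<close>
  define t where "t n = e / (N + 1) * inverse (real (Suc n))" for n
  have t0: "t n > 0" for n using e(1) N by (simp add: t_def)
  have tN: "t n * N < e" for n
  proof -
    have "inverse (real (Suc n)) \<le> 1" by (simp add: inverse_eq_divide)
    then have "t n \<le> e / (N + 1)"
      unfolding t_def using e(1) N by (intro mult_left_le) auto
    then have "t n * N \<le> e / (N + 1) * N" using N by (rule mult_right_mono)
    also have "\<dots> < e" using e(1) N by (simp add: field_simps)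
    finally show ?thesis .
  qed
  define \<Delta> where "\<Delta> n = \<phi> (x + t n *\<^sub>R a + t n *\<^sub>R b) - \<phi> (x + t n *\<^sub>R a) - \<phi> (x + t n *\<^sub>R b) + \<phi> x" for n
  have "\<forall>n. \<exists>z. dist z x \<le> t n * N \<and> \<Delta> n = (t n)\<^sup>2 * (a \<bullet> H z b)"
  proof
    fix n show "\<exists>z. dist z x \<le> t n * N \<and> \<Delta> n = (t n)\<^sup>2 * (a \<bullet> H z b)"
      using mixed[of "t n" a b] t0 tN unfolding N_def \<Delta>_def by blast
  qed
  from choice[OF this] obtain y where y: "\<And>n. dist (y n) x \<le> t n * N" "\<And>n. \<Delta> n = (t n)\<^sup>2 * (a \<bullet> H (y n) b)"
    by blast
  have "\<forall>n. \<exists>z. dist z x \<le> t n * N \<and> \<Delta> n = (t n)\<^sup>2 * (b \<bullet> H z a)"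
  proof
    fix n
    have "\<Delta> n = \<phi> (x + t n *\<^sub>R b + t n *\<^sub>R a) - \<phi> (x + t n *\<^sub>R b) - \<phi> (x + t n *\<^sub>R a) + \<phi> x"
      by (simp add: \<Delta>_def ac_simps)
    then show "\<exists>z. dist z x \<le> t n * N \<and> \<Delta> n = (t n)\<^sup>2 * (b \<bullet> H z a)"
      using mixed[of "t n" b a] t0 tN[unfolded N_def] unfolding N_def by (simp add: add.commute[of "norm b"])
  qed
  from choice[OF this] obtain z where z: "\<And>n. dist (z n) x \<le> t n * N" "\<And>n. \<Delta> n = (t n)\<^sup>2 * (b \<bullet> H (z n) a)"
    by blast
  have eq: "a \<bullet> H (y n) b = b \<bullet> H (z n) a" for n
    using y(2)[of n] z(2)[of n] t0[of n] by simp
  have "(\<lambda>n. e / (N + 1) * inverse (real (Suc n)) * N) \<longlonglongrightarrow> e / (N + 1) * 0 * N"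
    by (intro tendsto_intros LIMSEQ_inverse_real_of_nat)
  then have t_lim: "(\<lambda>n. t n * N) \<longlonglongrightarrow> 0" by (simp add: t_def)
  have lim: "w \<longlonglongrightarrow> x" if "\<And>n. dist (w n) x \<le> t n * N" for w
  proof (rule tendstoI)
    fix d :: real assume "d > 0"
    show "\<forall>\<^sub>F n in sequentially. dist (w n) x < d"
      by (rule eventually_mono[OF order_tendstoD(2)[OF t_lim \<open>d > 0\<close>]]) (rule le_less_trans[OF that])
  qed
  have "isCont H x" using H assms(1,2) continuous_on_eq_continuous_at by blast
  then have H_lim: "(\<lambda>n. a \<bullet> H (w n) b) \<longlonglongrightarrow> a \<bullet> H x b" if "w \<longlonglongrightarrow> x" for w a b
    by (intro tendsto_inner tendsto_const blinfun.tendsto isCont_tendsto_compose[OF _ that])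
  have "(\<lambda>n. a \<bullet> H (y n) b) \<longlonglongrightarrow> b \<bullet> H x a"
    unfolding eq by (rule H_lim[OF lim[OF z(1)]])
  then show ?thesis using H_lim[OF lim[OF y(1)]] LIMSEQ_unique by blast
qed

section \<open>One-sided smooth flows\<close>

definition trace2 :: "(plane \<Rightarrow> plane) \<Rightarrow> real" where
  "trace2 B = (1, 0) \<bullet> B (1, 0) + (0, 1) \<bullet> B (0, 1)"

text \<open>For \<open>w = (U, V)\<close> this is \<open>(V, - U)\<close>, so that differentiation
  in direction \<open>perp w\<close> is the operator
  \<open>\<partial>\<^sup>\<bottom>\<close>.\<close>

definition perp :: "plane \<Rightarrow> plane" where
  "perp w = (snd w, - fst w)"

lemma inner_perp [simp]: "w \<bullet> perp w = 0" "perp w \<bullet> w = 0" "perp w \<bullet> perp w = w \<bullet> w"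
  by (simp_all add: perp_def inner_prod_def)

lemma perp_expansion: "(w \<bullet> w) *\<^sub>R x = (x \<bullet> w) *\<^sub>R w + (x \<bullet> perp w) *\<^sub>R perp w"
  by (cases x; cases w) (simp add: perp_def algebra_simps)

text \<open>\<open>w\<close> and \<open>perp w\<close> are orthogonal and of equal length. The
  factor \<open>w \<bullet> w\<close> replaces a normalisation, so nothing has to be divided
  by.\<close>

lemma perp_parseval: "(w \<bullet> w) * (x \<bullet> y) = (x \<bullet> w) * (y \<bullet> w) + (x \<bullet> perp w) * (y \<bullet> perp w)"
  by (cases x; cases y; cases w) (simp add: perp_def algebra_simps)

lemma linear_plane: "linear B \<Longrightarrow> B (a, b) = a *\<^sub>R B (1, 0) + b *\<^sub>R (B (0, 1) :: plane)"
  using linear_add[of B "(a, 0)" "(0, b)"] linear_scale[of B a "(1, 0)"] linear_scale[of B b "(0, 1)"]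
  by simp

lemma trace2_perp:
  assumes "linear B"
  shows "(w \<bullet> w) * trace2 B = w \<bullet> B w + perp w \<bullet> B (perp w)"
proof -
  obtain a b where w: "w = (a, b)" by (cases w)
  obtain p q r s where B: "B (1, 0) = (p, q)" "B (0, 1) = (r, s)" by (metis surj_pair)
  show ?thesis
    unfolding w perp_def fst_conv snd_conv linear_plane[OF assms, of a b] linear_plane[OF assms, of b "- a"] trace2_def B
    by (simp add: algebra_simps)
qed

text \<open>The squared sonic speed without the root, hence differentiable together with
  \<open>\<phi>\<close> and \<open>v\<close>, whatever its sign.\<close>

definition csq :: "real \<Rightarrow> real \<Rightarrow> (plane \<Rightarrow> real) \<Rightarrow> (plane \<Rightarrow> plane) \<Rightarrow> plane \<Rightarrow> real" where
  "csq \<gamma> K \<phi> v x = (\<gamma> - 1) * (K - \<phi> x - (v x \<bullet> v x) / 2)"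

text \<open>One side of the configuration. \<open>v\<close> and \<open>H\<close> extend gradient and
  Hessian continuously from \<open>\<Omega>\<close> to \<open>A\<close>, which may contain boundary
  points. \<open>flow\<close> is the equation in non-divergence form, stated where the squared sonic
  speed is positive: there the density can be differentiated and its power divided out.\<close>

locale flow_side =
  fixes \<gamma> K :: real and \<Omega> A :: "plane set" and \<phi> :: "plane \<Rightarrow> real"
    and v :: "plane \<Rightarrow> plane" and H :: "plane \<Rightarrow> plane \<Rightarrow>\<^sub>L plane"
  assumes gamma: "1 < \<gamma>" and open_\<Omega>: "open \<Omega>" and \<Omega>_A: "\<Omega> \<subseteq> A" and A_closure: "A \<subseteq> closure \<Omega>"
    and cont_\<phi>: "continuous_on A \<phi>" and cont_v: "continuous_on A v" and cont_H: "continuous_on A H"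
    and grad_\<phi>: "\<And>x. x \<in> \<Omega> \<Longrightarrow> GDERIV \<phi> x :> v x"
    and deriv_v: "\<And>x. x \<in> \<Omega> \<Longrightarrow> (v has_derivative H x) (at x)"
    and flow: "\<And>x. x \<in> \<Omega> \<Longrightarrow> 0 < csq \<gamma> K \<phi> v x \<Longrightarrow>
      csq \<gamma> K \<phi> v x * (trace2 (H x) + 2) = v x \<bullet> v x + v x \<bullet> H x (v x)"
begin

abbreviation "c2 \<equiv> csq \<gamma> K \<phi> v"
abbreviation "c2_grad x \<equiv> - ((\<gamma> - 1) *\<^sub>R (v x + H x (v x)))"

lemma cont_c2: "continuous_on A c2"
  unfolding csq_def by (auto intro!: continuous_intros cont_\<phi> cont_v)

text \<open>Positivity of \<open>c2\<close> at \<open>x\<close> persists along a sequence from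
  \<open>\<Omega>\<close> converging to \<open>x\<close>, so an identity valid in
  \<open>\<Omega>\<close> where \<open>c2\<close> is positive passes to the limit.\<close>

lemma eq_0_on_boundary:
  assumes "continuous_on A E" "x \<in> A" "0 < c2 x"
    and "\<And>y. y \<in> \<Omega> \<Longrightarrow> 0 < c2 y \<Longrightarrow> E y = (0::real)"
  shows "E x = 0"
proof -
  obtain y where y: "\<And>n. y n \<in> \<Omega>" "y \<longlonglongrightarrow> x"
    using A_closure assms(2) by (metis closure_sequential subsetD)
  have lim: "(\<lambda>n. g (y n)) \<longlonglongrightarrow> g x" if "continuous_on A g" for g :: "plane \<Rightarrow> real"
    by (rule continuous_on_tendsto_compose[OF that y(2) assms(2)]) (use y(1) \<Omega>_A in \<open>auto intro: always_eventually\<close>)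
  from order_tendstoD(1)[OF lim[OF cont_c2] assms(3)]
  have "\<forall>\<^sub>F n in sequentially. E (y n) = 0"
    by (rule eventually_mono) (use assms(4) y(1) in auto)
  then have "(\<lambda>n. E (y n)) \<longlonglongrightarrow> 0"
    by (rule tendsto_eventually)
  then show ?thesis using lim[OF assms(1)] LIMSEQ_unique by blast
qed

lemma H_sym_interior: "x \<in> \<Omega> \<Longrightarrow> a \<bullet> H x b = b \<bullet> H x a"
  by (rule gradient_derivative_symmetric[OF open_\<Omega> _ grad_\<phi> deriv_v continuous_on_subset[OF cont_H \<Omega>_A]])

lemma H_sym:
  assumes "x \<in> A"
  shows "a \<bullet> H x b = b \<bullet> H x a"
proof -
  obtain y where y: "\<And>n. y n \<in> \<Omega>" "y \<longlonglongrightarrow> x"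
    using A_closure assms by (metis closure_sequential subsetD)
  have "(\<lambda>n. H (y n)) \<longlonglongrightarrow> H x"
    by (rule continuous_on_tendsto_compose[OF cont_H y(2) assms]) (use y(1) \<Omega>_A in \<open>auto intro: always_eventually\<close>)
  then have lim: "(\<lambda>n. a \<bullet> H (y n) b) \<longlonglongrightarrow> a \<bullet> H x b" for a b
    by (intro tendsto_inner tendsto_const blinfun.tendsto)
  have "(\<lambda>n. a \<bullet> H (y n) b) \<longlonglongrightarrow> b \<bullet> H x a"
    unfolding H_sym_interior[OF y(1), where a = a and b = b] by (rule lim)
  then show ?thesis using lim LIMSEQ_unique by blast
qed

text \<open>Symmetry of the Hessian moves \<open>w\<close> to the other side of the inner product,
  which turns the derivative into a gradient.\<close>

lemma grad_inner_v:
  assumes "x \<in> \<Omega>"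
  shows "GDERIV (\<lambda>x. w \<bullet> v x) x :> H x w"
  unfolding gderiv_def
  using has_derivative_inner_right[OF deriv_v[OF assms], of w] H_sym_interior[OF assms, of w] by simp

lemma grad_v_squared:
  assumes "x \<in> \<Omega>"
  shows "GDERIV (\<lambda>x. v x \<bullet> v x) x :> 2 *\<^sub>R H x (v x)"
  unfolding gderiv_def
  using has_derivative_inner[OF deriv_v[OF assms] deriv_v[OF assms]] H_sym_interior[OF assms, of "v x"]
  by (simp add: inner_commute)

lemma grad_c2:
  assumes "x \<in> \<Omega>"
  shows "GDERIV c2 x :> c2_grad x"
proof -
  have "GDERIV (\<lambda>x. (\<gamma> - 1) * (K - \<phi> x - (1/2) * (v x \<bullet> v x))) x :> c2_grad x"
    by (rule GDERIV_subst[OF GDERIV_mult[OF GDERIV_const GDERIV_diff[OF GDERIV_diff[OF GDERIV_const grad_\<phi>[OF assms]]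
        GDERIV_mult[OF GDERIV_const grad_v_squared[OF assms]]]]]) (simp add: algebra_simps)
  moreover have "c2 = (\<lambda>x. (\<gamma> - 1) * (K - \<phi> x - (1/2) * (v x \<bullet> v x)))"
    by (simp add: csq_def fun_eq_iff)
  ultimately show ?thesis by simp
qed

lemma cont_c2_grad: "continuous_on A (\<lambda>x. c2_grad x)"
  by (intro continuous_intros cont_H cont_v)

lemma flow_A:
  assumes "x \<in> A" "0 < c2 x"
  shows "c2 x * (trace2 (H x) + 2) = v x \<bullet> v x + v x \<bullet> H x (v x)"
proof -
  have "c2 x * (trace2 (H x) + 2) - (v x \<bullet> v x + v x \<bullet> H x (v x)) = 0"
  proof (rule eq_0_on_boundary[OF _ assms])
    show "continuous_on A (\<lambda>x. c2 x * (trace2 (H x) + 2) - (v x \<bullet> v x + v x \<bullet> H x (v x)))"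
      unfolding trace2_def by (intro continuous_intros cont_c2 cont_H cont_v)
  qed (simp add: flow)
  then show ?thesis by simp
qed

text \<open>At a sonic point the equation only sees the second derivative across the flow direction.\<close>
lemma sonic_perp:
  assumes "x \<in> A" "0 < c2 x" "v x \<bullet> v x = c2 x"
  shows "perp (v x) \<bullet> H x (perp (v x)) = - c2 x"
  using flow_A[OF assms(1,2)] trace2_perp[of "H x" "v x"] assms(3)
  by (simp add: algebra_simps bounded_linear.linear[OF blinfun.bounded_linear_right])

end

text \<open>With density \<open>\<beta> powr \<alpha>\<close>, the product rule expands the
  divergence, and \<open>\<beta> powr (\<alpha> - 1)\<close> is a common factor. Dividing it out
  gives the non-divergence form.\<close>

lemma flow_side_exists:
  assumes "1 < \<gamma>" "open \<Omega>" "\<Omega> \<subseteq> A" "A \<subseteq> closure \<Omega>" "C2_upto \<Omega> A \<phi>" "potential_flow \<gamma> K \<Omega> \<phi>"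
  obtains v H where "flow_side \<gamma> K \<Omega> A \<phi> v H" "\<And>x. x \<in> A \<Longrightarrow> pseudo_velocity \<Omega> \<phi> x = v x"
proof -
  note C2 = assms(5)[unfolded C2_upto_def]
  from C2 obtain v where v_ext: "continuous_on A v" "\<forall>x\<in>\<Omega>. v x = grad \<phi> x"
    by (elim conjE exE)
  from C2 obtain H :: "plane \<Rightarrow> plane \<Rightarrow>\<^sub>L plane" where
    H_ext: "continuous_on A H" "\<forall>x\<in>\<Omega>. (grad \<phi> has_derivative H x) (at x)"
    by (elim conjE exE)
  have cont: "continuous_on A \<phi>" "continuous_on A v" "continuous_on A H"
    by (rule C2[THEN conjunct1] v_ext(1) H_ext(1))+
  have dphi: "\<phi> differentiable (at x)" if "x \<in> \<Omega>" for x
    by (rule bspec[OF C2[THEN conjunct2, THEN conjunct1] that])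
  have v: "v x = grad \<phi> x" if "x \<in> \<Omega>" for x
    by (rule bspec[OF v_ext(2) that])
  have H: "(grad \<phi> has_derivative H x) (at x)" if "x \<in> \<Omega>" for x
    by (rule bspec[OF H_ext(2) that])
  \<comment> \<open>The limit is taken within \<open>\<Omega>\<close>, where
    \<open>grad \<phi>\<close> and \<open>v\<close> agree, so it is found from the continuity of
    \<open>v\<close> on \<open>A\<close>.\<close>
  have pv: "pseudo_velocity \<Omega> \<phi> x = v x" if "x \<in> A" for x
    unfolding pseudo_velocity_def
  proof (rule tendsto_Lim)
    show "\<not> trivial_limit (at x within \<Omega>)"
    proof (cases "x \<in> \<Omega>")
      case True
      then show ?thesis by (simp add: at_within_open[OF _ assms(2)])
    next
      case False
      then show ?thesis using that assms(4) by (auto simp: closure_def trivial_limit_within)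
    qed
    have "(v \<longlongrightarrow> v x) (at x within \<Omega>)"
      using cont(2) that assms(3) unfolding continuous_on_def by (blast intro: tendsto_within_subset)
    then show "(grad \<phi> \<longlongrightarrow> v x) (at x within \<Omega>)"
      by (rule Lim_transform_eventually) (simp add: eventually_at_filter v)
  qed
  have grad: "GDERIV \<phi> x :> v x" if "x \<in> \<Omega>" for x
  proof -
    have D: "(\<phi> has_derivative frechet_derivative \<phi> (at x)) (at x)"
      using dphi[OF that] frechet_derivative_works by blast
    have "frechet_derivative \<phi> (at x) h = h \<bullet> v x" for h
    proof -
      let ?D = "frechet_derivative \<phi> (at x)"
      have "linear ?D" by (rule has_derivative_linear[OF D])
      then have "?D (fst h *\<^sub>R (1, 0) + snd h *\<^sub>R (0, 1)) = fst h * ?D (1, 0) + snd h * ?D (0, 1)"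
        by (simp only: linear_add linear_scale real_scaleR_def)
      then show ?thesis by (simp add: v[OF that] grad_def inner_prod_def)
    qed
    then show ?thesis using D unfolding gderiv_def by presburger
  qed
  have dv: "(v has_derivative H x) (at x)" if "x \<in> \<Omega>" for x
    by (rule has_derivative_transform_within_open[OF H[OF that] assms(2) that]) (simp add: v)
  have "csq \<gamma> K \<phi> v x * (trace2 (H x) + 2) = v x \<bullet> v x + v x \<bullet> H x (v x)"
    if x: "x \<in> \<Omega>" and pos: "0 < csq \<gamma> K \<phi> v x" for x
  proof -
    define \<beta> where "\<beta> y = K - \<phi> y - 1/2 * (v y \<bullet> v y)" for y
    define \<alpha> where "\<alpha> = 1 / (\<gamma> - 1)"
    have \<beta>: "bernoulli K \<Omega> \<phi> y = \<beta> y" if "y \<in> \<Omega>" for y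
      using that assms(3) pv[of y] by (auto simp: bernoulli_def \<beta>_def power2_norm_eq_inner)
    have dens: "density \<gamma> K \<Omega> \<phi> y = \<beta> y powr \<alpha>" if "y \<in> \<Omega>" for y
      by (simp add: density_def \<beta>[OF that] \<alpha>_def)
    have \<beta>_pos: "\<beta> x > 0"
      using pos assms(1) by (simp add: csq_def \<beta>_def zero_less_mult_iff)
    have d\<beta>: "(\<beta> has_derivative (\<lambda>u. - (u \<bullet> v x) - v x \<bullet> H x u)) (at x)"
      unfolding \<beta>_def
      by (rule derivative_eq_intros grad[OF x, unfolded gderiv_def] dv[OF x] refl)+
        (simp add: fun_eq_iff inner_commute)
    \<comment> \<open>Computed for a general direction \<open>e\<close>, to be used for both
      coordinate directions.\<close>
    have part: "((\<lambda>s. \<beta> (x + s *\<^sub>R e) powr \<alpha> * (e \<bullet> v (x + s *\<^sub>R e))) has_real_derivative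
        (\<alpha> * \<beta> x powr (\<alpha> - 1) * (- (e \<bullet> v x) - v x \<bullet> H x e)) * (e \<bullet> v x) + (e \<bullet> H x e) * \<beta> x powr \<alpha>) (at 0)" for e
    proof -
      have l: "((\<lambda>s. x + s *\<^sub>R e) has_derivative (\<lambda>h. h *\<^sub>R e)) (at 0)"
        by (auto intro!: derivative_eq_intros)
      have 1: "((\<lambda>s. \<beta> (x + s *\<^sub>R e)) has_real_derivative (- (e \<bullet> v x) - v x \<bullet> H x e)) (at 0)"
        unfolding has_field_derivative_def
        by (rule has_derivative_eq_rhs[OF has_derivative_compose[OF l]])
          (use d\<beta> in \<open>auto simp: blinfun.scaleR_right algebra_simps\<close>)
      have 2: "((\<lambda>s. e \<bullet> v (x + s *\<^sub>R e)) has_real_derivative (e \<bullet> H x e)) (at 0)"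
        using has_derivative_inner_right[OF has_derivative_compose[OF l, of v], of "H x" e] dv[OF x]
        by (simp add: has_field_derivative_def blinfun.scaleR_right mult.commute[of _ "e \<bullet> _"])
      show ?thesis
        using DERIV_mult[OF DERIV_fun_powr[OF 1, of \<alpha>] 2] \<beta>_pos by simp
    qed
    obtain \<xi> \<eta> where \<xi>\<eta>: "x = (\<xi>, \<eta>)" by (cases x)
    from assms(6) x obtain p q where
      p: "((\<lambda>s. density \<gamma> K \<Omega> \<phi> (s, \<eta>) * fst (pseudo_velocity \<Omega> \<phi> (s, \<eta>))) has_real_derivative p) (at \<xi>)"
      and q: "((\<lambda>s. density \<gamma> K \<Omega> \<phi> (\<xi>, s) * snd (pseudo_velocity \<Omega> \<phi> (\<xi>, s))) has_real_derivative q) (at \<eta>)"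
      and pq: "p + q + 2 * density \<gamma> K \<Omega> \<phi> x = 0"
      unfolding \<xi>\<eta> potential_flow_def by blast
    \<comment> \<open>Density and pseudo-velocity are known to equal
      \<open>\<beta> powr \<alpha>\<close> and \<open>v\<close> in \<open>\<Omega>\<close>; since
      \<open>\<Omega>\<close> is open this suffices for the derivative at \<open>0\<close>.\<close>
    have local: "((\<lambda>s. \<beta> (x + s *\<^sub>R e) powr \<alpha> * (e \<bullet> v (x + s *\<^sub>R e))) has_real_derivative d) (at 0)"
      if "((\<lambda>s. density \<gamma> K \<Omega> \<phi> (x + s *\<^sub>R e) * (e \<bullet> pseudo_velocity \<Omega> \<phi> (x + s *\<^sub>R e))) has_real_derivative d) (at 0)" for e d
    proof (rule has_field_derivative_transform_within_open[OF that])
      show "open ((\<lambda>s. x + s *\<^sub>R e) -` \<Omega>)"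
        by (rule open_vimage[OF assms(2)]) (auto intro!: continuous_intros)
      show "0 \<in> (\<lambda>s. x + s *\<^sub>R e) -` \<Omega>" using x by simp
    qed (simp add: dens pv subsetD[OF assms(3)])
    have p': "p = (\<alpha> * \<beta> x powr (\<alpha> - 1) * (- ((1, 0) \<bullet> v x) - v x \<bullet> H x (1, 0))) * ((1, 0) \<bullet> v x) + ((1, 0) \<bullet> H x (1, 0)) * \<beta> x powr \<alpha>"
    proof (rule DERIV_unique[OF local part])
      from p have "((\<lambda>s. density \<gamma> K \<Omega> \<phi> (s + \<xi>, \<eta>) * fst (pseudo_velocity \<Omega> \<phi> (s + \<xi>, \<eta>))) has_real_derivative p) (at 0)"
        using DERIV_shift[of "\<lambda>s. density \<gamma> K \<Omega> \<phi> (s, \<eta>) * fst (pseudo_velocity \<Omega> \<phi> (s, \<eta>))" p 0 \<xi>] by simp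
      then show "((\<lambda>s. density \<gamma> K \<Omega> \<phi> (x + s *\<^sub>R (1, 0)) * ((1, 0) \<bullet> pseudo_velocity \<Omega> \<phi> (x + s *\<^sub>R (1, 0)))) has_real_derivative p) (at 0)"
        by (simp add: \<xi>\<eta> inner_prod_def add.commute)
    qed
    have q': "q = (\<alpha> * \<beta> x powr (\<alpha> - 1) * (- ((0, 1) \<bullet> v x) - v x \<bullet> H x (0, 1))) * ((0, 1) \<bullet> v x) + ((0, 1) \<bullet> H x (0, 1)) * \<beta> x powr \<alpha>"
    proof (rule DERIV_unique[OF local part])
      from q have "((\<lambda>s. density \<gamma> K \<Omega> \<phi> (\<xi>, s + \<eta>) * snd (pseudo_velocity \<Omega> \<phi> (\<xi>, s + \<eta>))) has_real_derivative q) (at 0)"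
        using DERIV_shift[of "\<lambda>s. density \<gamma> K \<Omega> \<phi> (\<xi>, s) * snd (pseudo_velocity \<Omega> \<phi> (\<xi>, s))" q 0 \<eta>] by simp
      then show "((\<lambda>s. density \<gamma> K \<Omega> \<phi> (x + s *\<^sub>R (0, 1)) * ((0, 1) \<bullet> pseudo_velocity \<Omega> \<phi> (x + s *\<^sub>R (0, 1)))) has_real_derivative q) (at 0)"
        by (simp add: \<xi>\<eta> inner_prod_def add.commute)
    qed
    have lin: "v x \<bullet> H x (v x) = ((1, 0) \<bullet> v x) * (v x \<bullet> H x (1, 0)) + ((0, 1) \<bullet> v x) * (v x \<bullet> H x (0, 1))"
    proof -
      have "H x (v x) = fst (v x) *\<^sub>R H x (1, 0) + snd (v x) *\<^sub>R H x (0, 1)"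
        using linear_plane[of "H x" "fst (v x)" "snd (v x)"] by (simp add: bounded_linear.linear[OF blinfun.bounded_linear_right])
      then show ?thesis by (simp add: inner_add_right inner_prod_def[of "(_, _)"])
    qed
    have nrm: "v x \<bullet> v x = ((1, 0) \<bullet> v x)\<^sup>2 + ((0, 1) \<bullet> v x)\<^sup>2"
      by (simp add: inner_prod_def power2_eq_square)
    have "\<beta> x powr \<alpha> = \<beta> x powr (\<alpha> - 1) * \<beta> x"
      using \<beta>_pos powr_add[of "\<beta> x" "\<alpha> - 1" 1] by simp
    then have "\<beta> x powr (\<alpha> - 1) * (\<beta> x * (trace2 (H x) + 2) - \<alpha> * (v x \<bullet> v x + v x \<bullet> H x (v x))) = 0"
      using pq unfolding p' q' dens[OF x] lin nrm trace2_def by (simp add: algebra_simps power2_eq_square)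
    then have "\<beta> x * (trace2 (H x) + 2) = \<alpha> * (v x \<bullet> v x + v x \<bullet> H x (v x))"
      using \<beta>_pos by simp
    then have "(\<gamma> - 1) * \<beta> x * (trace2 (H x) + 2) = ((\<gamma> - 1) * \<alpha>) * (v x \<bullet> v x + v x \<bullet> H x (v x))"
      by (simp add: mult.assoc)
    also have "(\<gamma> - 1) * \<alpha> = 1" using assms(1) by (simp add: \<alpha>_def)
    finally show ?thesis by (simp add: csq_def \<beta>_def)
  qed
  then have "flow_side \<gamma> K \<Omega> A \<phi> v H"
    by unfold_locales (use assms cont grad dv in auto)
  then show thesis using that pv by blast
qed

section \<open>Smooth curves bounding the flow region\<close>

text \<open>Graph coordinates at \<open>Q\<close>: \<open>a\<close> is measured along
  \<open>e\<close> and \<open>b\<close> along \<open>- perp e\<close>. The sign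
  \<open>\<sigma>\<close> tells on which side of the graph of \<open>F\<close> the region lies. The
  regularity of the curve enters as the quadratic bound \<open>F_bound\<close>, which also forces
  \<open>F 0 = 0\<close>.\<close>

locale flow_boundary = flow_side +
  fixes Q e :: plane and F :: "real \<Rightarrow> real" and k L r \<sigma> :: real
  assumes e_unit: "e \<bullet> e = 1" and r_pos: "0 < r" and L_nonneg: "0 \<le> L"
    and F_bound: "\<And>a. \<bar>a\<bar> < r \<Longrightarrow> \<bar>F a - k * a\<bar> \<le> L * a\<^sup>2"
    and sign: "\<bar>\<sigma>\<bar> = 1"
    and curve: "\<And>a. \<bar>a\<bar> < r \<Longrightarrow> Q + a *\<^sub>R e - F a *\<^sub>R perp e \<in> A"
    and side: "\<And>a b. \<bar>a\<bar> < r \<Longrightarrow> \<bar>b\<bar> < r \<Longrightarrow> 0 < \<sigma> * (b - F a) \<Longrightarrow> Q + a *\<^sub>R e - b *\<^sub>R perp e \<in> \<Omega>"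
begin

text \<open>In the coordinates \<open>(a, b)\<close> these vectors are \<open>(1, k)\<close> and
  \<open>\<sigma>\<close> times \<open>(- k, 1)\<close>, left unnormalised; the second one points
  into \<open>\<Omega>\<close>.\<close>

definition "tangent = e - k *\<^sub>R perp e"
definition "inner_normal = - \<sigma> *\<^sub>R (perp e + k *\<^sub>R e)"
definition "pt a = Q + a *\<^sub>R e - F a *\<^sub>R perp e"

lemma F_0 [simp]: "F 0 = 0"
  using F_bound[of 0] r_pos by simp

lemma pt_0 [simp]: "pt 0 = Q"
  by (simp add: pt_def)

lemma Q_A: "Q \<in> A"
  using curve[of 0] r_pos by simp

text \<open>The interior ball property: for positive \<open>L\<close> the first inequality describes
  a disk touching the curve at \<open>Q\<close>, and the quadratic bound on \<open>F\<close> keeps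
  the graph out of it.\<close>

lemma disk_subset:
  assumes "L * (norm (x - Q))\<^sup>2 < inner_normal \<bullet> (x - Q)" "norm (x - Q) < r"
  shows "x \<in> \<Omega>"
proof -
  define a b where "a = (x - Q) \<bullet> e" and "b = - ((x - Q) \<bullet> perp e)"
  have x: "x = Q + a *\<^sub>R e - b *\<^sub>R perp e"
    using perp_expansion[of e "x - Q"] by (simp add: e_unit a_def b_def algebra_simps)
  have nrm: "(norm (x - Q))\<^sup>2 = a\<^sup>2 + b\<^sup>2"
    using perp_parseval[of e "x - Q" "x - Q"]
    by (simp add: e_unit a_def b_def power2_norm_eq_inner) (simp add: power2_eq_square)
  have "\<bar>a\<bar> \<le> norm (x - Q)" "\<bar>b\<bar> \<le> norm (x - Q)"
    by (rule power2_le_imp_le; simp add: nrm)+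
  then have ab: "\<bar>a\<bar> < r" "\<bar>b\<bar> < r" using assms(2) by auto
  have "inner_normal \<bullet> (x - Q) = \<sigma> * (b - k * a)"
    by (simp add: inner_normal_def a_def b_def inner_commute inner_add_left inner_diff_right algebra_simps)
  moreover have "L * a\<^sup>2 \<le> L * (norm (x - Q))\<^sup>2"
    using L_nonneg by (intro mult_left_mono) (auto simp: nrm)
  moreover have "\<bar>\<sigma> * (F a - k * a)\<bar> \<le> L * a\<^sup>2"
    using F_bound[OF ab(1)] sign by (simp add: abs_mult)
  ultimately have "0 < \<sigma> * (b - F a)"
    using assms(1) by (simp add: algebra_simps)
  then show ?thesis unfolding x by (rule side[OF ab])
qed

text \<open>A ray with positive normal component starts inside the touching disk, so the mean value
  theorem gives the quotient as \<open>p z \<bullet> d\<close> with \<open>z\<close> tending to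
  \<open>Q\<close>.\<close>

lemma one_sided_derivative:
  fixes g :: "plane \<Rightarrow> real"
  assumes g: "continuous_on A g" "continuous_on A p" "\<And>z. z \<in> \<Omega> \<Longrightarrow> GDERIV g z :> p z"
    and d: "0 < inner_normal \<bullet> d"
  shows "((\<lambda>t. (g (Q + t *\<^sub>R d) - g Q) / t) \<longlongrightarrow> p Q \<bullet> d) (at_right 0)"
    and "\<forall>\<^sub>F t in at_right 0. Q + t *\<^sub>R d \<in> \<Omega>"
proof -
  \<comment> \<open>The first bound keeps the point within distance \<open>r\<close>; the second
    lets the linear term beat the quadratic one. The \<open>+ 1\<close> keeps the denominators
    positive.\<close>
  define \<delta> where "\<delta> = min (r / (norm d + 1)) (inner_normal \<bullet> d / (L * (norm d)\<^sup>2 + 1))"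
  have \<delta>: "\<delta> > 0"
    using r_pos d L_nonneg by (auto simp: \<delta>_def intro!: divide_pos_pos add_nonneg_pos)
  have in\<Omega>: "Q + t *\<^sub>R d \<in> \<Omega>" if t: "0 < t" "t < \<delta>" for t
  proof (rule disk_subset)
    have "t * (norm d + 1) < r"
      using t(2) by (simp add: \<delta>_def pos_less_divide_eq add_nonneg_pos)
    then show "norm (Q + t *\<^sub>R d - Q) < r" using t by (simp add: algebra_simps)
    have "t * (L * (norm d)\<^sup>2 + 1) < inner_normal \<bullet> d"
      using t(2) L_nonneg by (simp add: \<delta>_def pos_less_divide_eq add_nonneg_pos)
    then have "t * (L * (norm d)\<^sup>2) < inner_normal \<bullet> d" using t by (simp add: algebra_simps)
    from mult_strict_left_mono[OF this t(1)]
    show "L * (norm (Q + t *\<^sub>R d - Q))\<^sup>2 < inner_normal \<bullet> (Q + t *\<^sub>R d - Q)"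
      by (simp add: power2_eq_square algebra_simps)
  qed
  show "\<forall>\<^sub>F t in at_right 0. Q + t *\<^sub>R d \<in> \<Omega>"
    unfolding eventually_at_right_field using in\<Omega> \<delta> by auto
  have "\<exists>z. 0 < t \<longrightarrow> t < \<delta> \<longrightarrow> z \<in> \<Omega> \<and> dist z Q \<le> t * norm d \<and> (g (Q + t *\<^sub>R d) - g Q) / t = p z \<bullet> d" for t
  proof (cases "0 < t \<and> t < \<delta>")
    case True
    have "d \<noteq> 0" using d by auto
    have seg: "z \<in> \<Omega> \<and> dist z Q \<le> t * norm d" if z: "z \<in> open_segment Q (Q + t *\<^sub>R d)" for z
    proof -
      from z obtain u where u: "0 < u" "u < 1" "z = (1 - u) *\<^sub>R Q + u *\<^sub>R (Q + t *\<^sub>R d)" by (auto simp: in_segment)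
      then have z: "z = Q + (u * t) *\<^sub>R d" by (simp add: algebra_simps)
      have "u * t \<le> t" using u True by simp
      then have "0 < u * t" "u * t < \<delta>" using u(1) True by (simp, linarith)
      moreover have "dist z Q \<le> t * norm d"
        using mult_right_mono[OF \<open>u * t \<le> t\<close> norm_ge_zero[of d]] u(1) True by (simp add: z dist_norm abs_mult mult.assoc)
      ultimately show ?thesis using in\<Omega>[of "u * t"] unfolding z by blast
    qed
    have "open_segment Q (Q + t *\<^sub>R d) \<subseteq> \<Omega>" "Q + t *\<^sub>R d \<in> \<Omega>"
      using seg in\<Omega>[of t] True by auto
    then have "closed_segment Q (Q + t *\<^sub>R d) \<subseteq> A"
      using Q_A \<Omega>_A unfolding closed_segment_eq_open by auto
    then have cont: "continuous_on (closed_segment Q (Q + t *\<^sub>R d)) g"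
      by (rule continuous_on_subset[OF g(1)])
    obtain z where z: "z \<in> open_segment Q (Q + t *\<^sub>R d)" "g (Q + t *\<^sub>R d) - g Q = p z \<bullet> (Q + t *\<^sub>R d - Q)"
      by (rule gradient_mvt[OF _ cont, of p]) (use \<open>d \<noteq> 0\<close> True g(3) seg in auto)
    show ?thesis
      by (rule exI[of _ z]) (use z(2) seg[OF z(1)] True in simp)
  qed auto
  then have "\<forall>t. \<exists>z. 0 < t \<longrightarrow> t < \<delta> \<longrightarrow> z \<in> \<Omega> \<and> dist z Q \<le> t * norm d \<and> (g (Q + t *\<^sub>R d) - g Q) / t = p z \<bullet> d" ..
  from choice[OF this] obtain z where z: "\<And>t. 0 < t \<Longrightarrow> t < \<delta> \<Longrightarrow> z t \<in> \<Omega> \<and> dist (z t) Q \<le> t * norm d \<and> (g (Q + t *\<^sub>R d) - g Q) / t = p (z t) \<bullet> d"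
    by blast
  have ev: "\<forall>\<^sub>F t in at_right 0. 0 < t \<and> t < \<delta>"
    unfolding eventually_at_right_field using \<delta> by auto
  have lim0: "((\<lambda>t. t * norm d) \<longlongrightarrow> 0) (at_right 0)"
    by (rule tendsto_mult_left_zero[OF tendsto_ident_at])
  have "((\<lambda>t. dist (z t) Q) \<longlongrightarrow> 0) (at_right 0)"
    by (rule Lim_null_comparison[OF _ lim0], rule eventually_mono[OF ev]) (simp add: z)
  then have "(z \<longlongrightarrow> Q) (at_right 0)" by (rule tendsto_dist_iff[THEN iffD2])
  moreover have "\<forall>\<^sub>F t in at_right 0. z t \<in> A"
    by (rule eventually_mono[OF ev]) (rule subsetD[OF \<Omega>_A conjunct1[OF z]]; simp)
  ultimately have "((\<lambda>t. p (z t)) \<longlongrightarrow> p Q) (at_right 0)"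
    by (rule continuous_on_tendsto_compose[OF g(2) _ Q_A])
  then have "((\<lambda>t. p (z t) \<bullet> d) \<longlongrightarrow> p Q \<bullet> d) (at_right 0)" by (intro tendsto_intros)
  then show "((\<lambda>t. (g (Q + t *\<^sub>R d) - g Q) / t) \<longlongrightarrow> p Q \<bullet> d) (at_right 0)"
    by (rule Lim_transform_eventually) (rule eventually_mono[OF ev], simp add: z)
qed

text \<open>The curve need not be accessible from inside along chords, so \<open>pt a\<close> is reached by a detour
  through the point at height \<open>\<bar>a\<bar>\<close> above it.\<close>
lemma derivative_along_curve:
  fixes g :: "plane \<Rightarrow> real"
  assumes g: "continuous_on A g" "continuous_on A p" "\<And>z. z \<in> \<Omega> \<Longrightarrow> GDERIV g z :> p z"
  shows "((\<lambda>a. g (pt a)) has_real_derivative p Q \<bullet> tangent) (at 0)"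
proof -
  \<comment> \<open>The detour point, shifted from the curve into \<open>\<Omega>\<close> by
    \<open>\<bar>a\<bar>\<close>.\<close>
  define y where "y a = pt a - (\<sigma> * \<bar>a\<bar>) *\<^sub>R perp e" for a
  have e_norm: "norm e = 1" "norm (perp e) = 1" using e_unit by (simp_all add: norm_eq_sqrt_inner)
  have "\<sigma> * \<sigma> = 1" using sign by (metis abs_mult_self_eq mult_1)
  define M where "M = \<bar>k\<bar> + L * r + 1"
  have M: "M \<ge> 1" using L_nonneg r_pos by (simp add: M_def)
  \<comment> \<open>\<open>r / M\<close> keeps all points used inside the coordinate patch; the
    other bound makes \<open>2 * L * a\<^sup>2\<close> smaller than \<open>\<bar>a\<bar>\<close>, so
    that the chord from \<open>Q\<close> to \<open>y a\<close> clears the curve.\<close>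
  define \<delta> where "\<delta> = min (r / M) (1 / (2 * L + 1))"
  have \<delta>: "\<delta> > 0" "\<delta> \<le> r" "\<delta> \<le> r / M" "\<delta> \<le> 1 / (2 * L + 1)"
    using r_pos M L_nonneg divide_left_mono[of 1 M r] by (auto simp: \<delta>_def intro: min.coboundedI1)
  have F_le: "\<bar>F a\<bar> + \<bar>a\<bar> \<le> M * \<bar>a\<bar>" if "\<bar>a\<bar> < \<delta>" for a
  proof -
    have "L * a\<^sup>2 \<le> (L * r) * \<bar>a\<bar>"
    proof -
      have "a\<^sup>2 \<le> r * \<bar>a\<bar>"
        using that \<delta>(2) mult_right_mono[of "\<bar>a\<bar>" r "\<bar>a\<bar>"] by (simp add: power2_eq_square)
      from mult_left_mono[OF this L_nonneg] show ?thesis by (simp add: mult.assoc)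
    qed
    moreover have "\<bar>F a\<bar> \<le> \<bar>F a - k * a\<bar> + \<bar>k\<bar> * \<bar>a\<bar>" by (simp add: abs_mult[symmetric])
    ultimately show ?thesis using F_bound[of a] that \<delta> by (simp add: M_def algebra_simps)
  qed
  have small: "M * \<bar>a\<bar> < r" if "\<bar>a\<bar> < \<delta>" for a
  proof -
    have "\<bar>a\<bar> < r / M" using that \<delta>(3) by linarith
    then show ?thesis using M by (simp add: pos_less_divide_eq mult.commute)
  qed
  have seg1: "z \<in> \<Omega> \<and> dist z Q \<le> 2 * M * \<bar>a\<bar>" if a: "a \<noteq> 0" "\<bar>a\<bar> < \<delta>" and z: "z \<in> open_segment Q (y a) \<or> z = y a" for a z
  proof -
    from z have "\<exists>u. 0 < u \<and> u \<le> 1 \<and> z = (1 - u) *\<^sub>R Q + u *\<^sub>R y a"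
    proof
      assume "z \<in> open_segment Q (y a)"
      then show ?thesis unfolding in_segment using less_imp_le by blast
    next
      assume "z = y a"
      then show ?thesis by (intro exI[of _ 1]) simp
    qed
    then obtain u where u: "0 < u" "u \<le> 1" "z = (1 - u) *\<^sub>R Q + u *\<^sub>R y a" by blast
    then have z: "z = Q + (u * a) *\<^sub>R e - (u * (F a + \<sigma> * \<bar>a\<bar>)) *\<^sub>R perp e"
      by (simp add: y_def pt_def algebra_simps)
    have ua: "\<bar>u * a\<bar> \<le> \<bar>a\<bar>" using u by (simp add: abs_mult mult_left_le_one_le)
    have "\<bar>F a + \<sigma> * \<bar>a\<bar>\<bar> \<le> M * \<bar>a\<bar>"
      using F_le[OF a(2)] abs_triangle_ineq[of "F a" "\<sigma> * \<bar>a\<bar>"] sign by (simp add: abs_mult)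
    then have ub: "\<bar>u * (F a + \<sigma> * \<bar>a\<bar>)\<bar> \<le> M * \<bar>a\<bar>"
      using u mult_left_le_one_le[of "\<bar>F a + \<sigma> * \<bar>a\<bar>\<bar>" u] by (simp add: abs_mult)
    have "z \<in> \<Omega>" unfolding z
    proof (rule side)
      show "\<bar>u * a\<bar> < r" using ua a \<delta> by simp
      show "\<bar>u * (F a + \<sigma> * \<bar>a\<bar>)\<bar> < r" using ub small[OF a(2)] by simp
      \<comment> \<open>\<open>u * F a\<close> and \<open>F (u * a)\<close> are both compared with
        the linear value \<open>u * k * a\<close>; their distance is less than the height
        \<open>u * \<bar>a\<bar>\<close> of the chord point.\<close>
      have 1: "\<bar>u * F a - u * (k * a)\<bar> \<le> u * (L * a\<^sup>2)"
        using F_bound[of a] a \<delta> u by (simp add: abs_mult right_diff_distrib[symmetric])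
      have "\<bar>F (u * a) - u * (k * a)\<bar> \<le> L * (u * a)\<^sup>2"
        using F_bound[of "u * a"] ua a \<delta> by (simp add: ac_simps)
      also have "\<dots> \<le> u * (L * a\<^sup>2)"
        using u L_nonneg mult_right_mono[of "u * u" u "L * a\<^sup>2"] by (simp add: power2_eq_square ac_simps)
      finally have "\<bar>u * F a - F (u * a)\<bar> \<le> u * (2 * L * a\<^sup>2)" using 1 by linarith
      also have "\<dots> < u * \<bar>a\<bar>"
      proof -
        have "\<bar>a\<bar> * (2 * L + 1) < 1"
          using less_le_trans[OF a(2) \<delta>(4)] L_nonneg by (simp add: pos_less_divide_eq)
        then have "2 * L * \<bar>a\<bar> < 1" by (simp add: algebra_simps)
        then have "\<bar>a\<bar> * (2 * L * \<bar>a\<bar>) < \<bar>a\<bar> * 1"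
          using a(1) by (intro mult_strict_left_mono) auto
        then have "2 * L * (\<bar>a\<bar> * \<bar>a\<bar>) < \<bar>a\<bar>"
          by (simp only: mult_1_right mult.assoc mult.commute mult.left_commute)
        then have "2 * L * a\<^sup>2 < \<bar>a\<bar>" by (simp add: power2_eq_square)
        then show ?thesis using u by simp
      qed
      finally have "\<bar>\<sigma> * (u * F a - F (u * a))\<bar> < u * \<bar>a\<bar>" using sign by (simp add: abs_mult)
      moreover have "\<sigma> * (u * (F a + \<sigma> * \<bar>a\<bar>) - F (u * a)) = \<sigma> * (u * F a - F (u * a)) + (\<sigma> * \<sigma>) * (u * \<bar>a\<bar>)"
        by (simp add: algebra_simps)
      ultimately show "0 < \<sigma> * (u * (F a + \<sigma> * \<bar>a\<bar>) - F (u * a))"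
        using \<open>\<sigma> * \<sigma> = 1\<close> by simp
    qed
    moreover have "dist z Q \<le> 2 * M * \<bar>a\<bar>"
    proof -
      have "dist z Q = norm ((u * a) *\<^sub>R e - (u * (F a + \<sigma> * \<bar>a\<bar>)) *\<^sub>R perp e)"
        by (simp add: z dist_norm algebra_simps)
      also have "\<dots> \<le> \<bar>u * a\<bar> + \<bar>u * (F a + \<sigma> * \<bar>a\<bar>)\<bar>"
        using norm_triangle_ineq4[of "(u * a) *\<^sub>R e" "(u * (F a + \<sigma> * \<bar>a\<bar>)) *\<^sub>R perp e"] by (simp add: e_norm)
      also have "\<dots> \<le> 2 * M * \<bar>a\<bar>" using ua ub M mult_right_mono[of 1 M "\<bar>a\<bar>"] by simp
      finally show ?thesis .
    qed
    ultimately show ?thesis ..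
  qed
  have seg2: "z \<in> \<Omega> \<and> dist z Q \<le> 2 * M * \<bar>a\<bar>" if a: "a \<noteq> 0" "\<bar>a\<bar> < \<delta>" and z: "z \<in> open_segment (pt a) (y a)" for a z
  proof -
    from z obtain u where u: "0 < u" "u < 1" "z = (1 - u) *\<^sub>R pt a + u *\<^sub>R y a" by (auto simp: in_segment)
    then have z: "z = Q + a *\<^sub>R e - (F a + u * \<sigma> * \<bar>a\<bar>) *\<^sub>R perp e"
      by (simp add: y_def pt_def algebra_simps)
    have b: "\<bar>F a + u * \<sigma> * \<bar>a\<bar>\<bar> \<le> M * \<bar>a\<bar>"
    proof -
      have "\<bar>u * \<sigma> * \<bar>a\<bar>\<bar> \<le> \<bar>a\<bar>" using u sign by (simp add: abs_mult mult_left_le_one_le)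
      then show ?thesis using F_le[OF a(2)] by linarith
    qed
    have "z \<in> \<Omega>" unfolding z
    proof (rule side)
      show "\<bar>a\<bar> < r" using a \<delta> by simp
      show "\<bar>F a + u * \<sigma> * \<bar>a\<bar>\<bar> < r" using b small[OF a(2)] by simp
      have "\<sigma> * (F a + u * \<sigma> * \<bar>a\<bar> - F a) = (\<sigma> * \<sigma>) * (u * \<bar>a\<bar>)" by (simp add: algebra_simps)
      moreover have "0 < u * \<bar>a\<bar>" using u(1) a(1) by simp
      ultimately show "0 < \<sigma> * (F a + u * \<sigma> * \<bar>a\<bar> - F a)" unfolding \<open>\<sigma> * \<sigma> = 1\<close> by linarith
    qed
    moreover have "dist z Q \<le> 2 * M * \<bar>a\<bar>"
    proof -
      have "dist z Q = norm (a *\<^sub>R e - (F a + u * \<sigma> * \<bar>a\<bar>) *\<^sub>R perp e)"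
        by (simp add: z dist_norm algebra_simps)
      also have "\<dots> \<le> \<bar>a\<bar> + \<bar>F a + u * \<sigma> * \<bar>a\<bar>\<bar>"
        using norm_triangle_ineq4[of "a *\<^sub>R e" "(F a + u * \<sigma> * \<bar>a\<bar>) *\<^sub>R perp e"] by (simp add: e_norm)
      also have "\<dots> \<le> 2 * M * \<bar>a\<bar>" using b M mult_right_mono[of 1 M "\<bar>a\<bar>"] by simp
      finally show ?thesis .
    qed
    ultimately show ?thesis ..
  qed
  \<comment> \<open>The increment along the curve is the difference of the increments along the two
    legs of the detour, each given by the mean value theorem.\<close>
  define P where "P a z z' \<longleftrightarrow> z \<in> A \<and> dist z Q \<le> 2 * M * \<bar>a\<bar> \<and> z' \<in> A \<and> dist z' Q \<le> 2 * M * \<bar>a\<bar> \<and>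
      g (pt a) - g Q = p z \<bullet> (y a - Q) - p z' \<bullet> (y a - pt a)" for a z z'
  have "\<exists>w. a \<noteq> 0 \<longrightarrow> \<bar>a\<bar> < \<delta> \<longrightarrow> P a (fst w) (snd w)" for a
  proof (cases "a \<noteq> 0 \<and> \<bar>a\<bar> < \<delta>")
    case True
    have y: "y a \<in> \<Omega>" "y a \<noteq> pt a" "y a \<noteq> Q"
    proof -
      show "y a \<in> \<Omega>" using seg1 True by blast
      have "perp e \<noteq> 0" using e_norm by auto
      then show "y a \<noteq> pt a" using True sign by (auto simp: y_def)
      show "y a \<noteq> Q"
      proof
        assume "y a = Q"
        then have "(y a - Q) \<bullet> e = 0" by simp
        then show False using True by (simp add: y_def pt_def inner_diff_left inner_add_left e_unit)
      qed
    qed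
    have "pt a \<in> A" using curve[of a] True \<delta> by (simp add: pt_def)
    moreover have "open_segment Q (y a) \<subseteq> \<Omega>" "open_segment (pt a) (y a) \<subseteq> \<Omega>"
      using seg1[of a] seg2[of a] True by blast+
    ultimately have "closed_segment Q (y a) \<subseteq> A" "closed_segment (pt a) (y a) \<subseteq> A"
      using Q_A y(1) \<Omega>_A unfolding closed_segment_eq_open by auto
    then have cont: "continuous_on (closed_segment Q (y a)) g" "continuous_on (closed_segment (pt a) (y a)) g"
      using g(1) continuous_on_subset by blast+
    obtain z where z: "z \<in> open_segment Q (y a)" "g (y a) - g Q = p z \<bullet> (y a - Q)"
      by (rule gradient_mvt[OF _ cont(1), of p]) (use y(3) g(3) seg1[of a] True in auto)
    obtain z' where z': "z' \<in> open_segment (pt a) (y a)" "g (y a) - g (pt a) = p z' \<bullet> (y a - pt a)"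
      by (rule gradient_mvt[OF _ cont(2), of p]) (use y(2) g(3) seg2[of a] True in auto)
    show ?thesis
      by (rule exI[of _ "(z, z')"])
        (use z(2) z'(2) seg1[of a z] seg2[of a z'] z(1) z'(1) True in \<open>simp add: P_def subsetD[OF \<Omega>_A]\<close>)
  qed auto
  then have "\<forall>a. \<exists>w. a \<noteq> 0 \<longrightarrow> \<bar>a\<bar> < \<delta> \<longrightarrow> P a (fst w) (snd w)" ..
  from choice[OF this] obtain w where "\<And>a. a \<noteq> 0 \<Longrightarrow> \<bar>a\<bar> < \<delta> \<Longrightarrow> P a (fst (w a)) (snd (w a))" by blast
  moreover define z z' where "z a = fst (w a)" and "z' a = snd (w a)" for a
  ultimately have z: "\<And>a. a \<noteq> 0 \<Longrightarrow> \<bar>a\<bar> < \<delta> \<Longrightarrow>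
      z a \<in> A \<and> dist (z a) Q \<le> 2 * M * \<bar>a\<bar> \<and> z' a \<in> A \<and> dist (z' a) Q \<le> 2 * M * \<bar>a\<bar> \<and>
      g (pt a) - g Q = p (z a) \<bullet> (y a - Q) - p (z' a) \<bullet> (y a - pt a)"
    unfolding P_def by simp
  have ev: "\<forall>\<^sub>F a in at 0. a \<noteq> 0 \<and> \<bar>a\<bar> < \<delta>"
    unfolding eventually_at using \<delta> by (auto simp: dist_real_def)
  have to_Q: "(w \<longlongrightarrow> Q) (at 0)" if "\<And>a. a \<noteq> 0 \<Longrightarrow> \<bar>a\<bar> < \<delta> \<Longrightarrow> dist (w a) Q \<le> 2 * M * \<bar>a\<bar>" for w
  proof -
    have lim0: "((\<lambda>a. 2 * M * \<bar>a\<bar>) \<longlongrightarrow> 0) (at 0)"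
      by (rule tendsto_mult_right_zero[OF tendsto_rabs_zero[OF tendsto_ident_at]])
    have "((\<lambda>a. dist (w a) Q) \<longlongrightarrow> 0) (at 0)"
      by (rule Lim_null_comparison[OF _ lim0], rule eventually_mono[OF ev]) (simp add: that)
    then show ?thesis by (rule tendsto_dist_iff[THEN iffD2])
  qed
  have pz: "((\<lambda>a. p (z a)) \<longlongrightarrow> p Q) (at 0)" "((\<lambda>a. p (z' a)) \<longlongrightarrow> p Q) (at 0)"
    by (rule continuous_on_tendsto_compose[OF g(2) to_Q Q_A]; (rule eventually_mono[OF ev])?; simp add: z)+
  have quot: "((\<lambda>a. (F a - k * a) / a) \<longlongrightarrow> 0) (at 0)"
  proof (rule Lim_null_comparison)
    show "((\<lambda>a. L * \<bar>a\<bar>) \<longlongrightarrow> 0) (at 0)"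
      by (rule tendsto_mult_right_zero[OF tendsto_rabs_zero[OF tendsto_ident_at]])
    show "\<forall>\<^sub>F a in at 0. norm ((F a - k * a) / a) \<le> L * \<bar>a\<bar>"
      by (rule eventually_mono[OF ev])
        (use F_bound \<delta> in \<open>auto simp: abs_divide pos_divide_le_eq power2_eq_square abs_mult_self_eq mult.assoc\<close>)
  qed
  have chord: "((\<lambda>a. (1 / a) *\<^sub>R (pt a - Q)) \<longlongrightarrow> tangent) (at 0)"
  proof (rule Lim_transform_eventually)
    show "((\<lambda>a. tangent - ((F a - k * a) / a) *\<^sub>R perp e) \<longlongrightarrow> tangent) (at 0)"
      using tendsto_diff[OF tendsto_const tendsto_scaleR[OF quot tendsto_const], of tangent "perp e"] by simp
    show "\<forall>\<^sub>F a in at 0. tangent - ((F a - k * a) / a) *\<^sub>R perp e = (1 / a) *\<^sub>R (pt a - Q)"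
      by (rule eventually_mono[OF ev]) (simp add: tangent_def pt_def algebra_simps diff_divide_distrib)
  qed
  \<comment> \<open>The vertical leg has length \<open>\<bar>a\<bar>\<close>, so its quotient stays
    bounded. It is run through up and down, and only the difference of two values of
    \<open>p\<close>, which tends to \<open>0\<close>, remains.\<close>
  have "((\<lambda>a. (p (z a) - p (z' a)) \<bullet> ((1 / a) *\<^sub>R (y a - pt a))) \<longlongrightarrow> 0) (at 0)"
  proof (rule Lim_null_comparison)
    show "((\<lambda>a. norm (p (z a) - p (z' a))) \<longlongrightarrow> 0) (at 0)"
      using tendsto_norm_zero[OF tendsto_diff[OF pz, simplified]] .
    show "\<forall>\<^sub>F a in at 0. norm ((p (z a) - p (z' a)) \<bullet> ((1 / a) *\<^sub>R (y a - pt a))) \<le> norm (p (z a) - p (z' a))"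
    proof (rule eventually_mono[OF ev])
      fix a assume a: "a \<noteq> 0 \<and> \<bar>a\<bar> < \<delta>"
      have "norm ((1 / a) *\<^sub>R (y a - pt a)) = 1"
        using a sign by (simp add: y_def e_norm abs_mult)
      then show "norm ((p (z a) - p (z' a)) \<bullet> ((1 / a) *\<^sub>R (y a - pt a))) \<le> norm (p (z a) - p (z' a))"
        using Cauchy_Schwarz_ineq2[of "p (z a) - p (z' a)" "(1 / a) *\<^sub>R (y a - pt a)"]
        by (simp only: real_norm_def mult_1_right)
    qed
  qed
  from tendsto_add[OF tendsto_inner[OF pz(1) chord] this]
  have "((\<lambda>a. p (z a) \<bullet> ((1 / a) *\<^sub>R (pt a - Q)) + (p (z a) - p (z' a)) \<bullet> ((1 / a) *\<^sub>R (y a - pt a)))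
      \<longlongrightarrow> p Q \<bullet> tangent) (at 0)" by simp
  then have "((\<lambda>a. (g (pt a) - g (pt 0)) / (a - 0)) \<longlongrightarrow> p Q \<bullet> tangent) (at 0)"
  proof (rule Lim_transform_eventually, intro eventually_mono[OF ev])
    fix a assume "a \<noteq> 0 \<and> \<bar>a\<bar> < \<delta>"
    then have "g (pt a) - g Q = p (z a) \<bullet> (y a - Q) - p (z' a) \<bullet> (y a - pt a)" using z by blast
    then show "p (z a) \<bullet> ((1 / a) *\<^sub>R (pt a - Q)) + (p (z a) - p (z' a)) \<bullet> ((1 / a) *\<^sub>R (y a - pt a))
        = (g (pt a) - g (pt 0)) / (a - 0)"
      by (simp add: inner_diff_left inner_diff_right inner_add_right diff_divide_distrib add_divide_distrib)
  qed
  then show ?thesis unfolding has_field_derivative_iff .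
qed

end

lemma inner_perp_swap: "perp a \<bullet> b = - (a \<bullet> perp b)"
  by (simp add: perp_def inner_prod_def)

lemma perp_perp [simp]: "perp a \<bullet> perp b = a \<bullet> b"
  by (simp add: perp_def inner_prod_def)

section \<open>Second derivatives at a sonic point that is not exceptional\<close>

context flow_boundary
begin

text \<open>At a point that is not exceptional, \<open>perp (v Q)\<close> is therefore transversal
  to the curve, and one of the two rays along it enters \<open>\<Omega>\<close>.\<close>

lemma inner_normal_perp: "inner_normal \<bullet> perp w = - \<sigma> * (w \<bullet> tangent)"
proof -
  have "e \<bullet> perp w = - (w \<bullet> perp e)" using inner_perp_swap[of e w] by (simp add: inner_commute)
  then show ?thesis
    by (simp add: inner_normal_def tangent_def inner_add_left inner_diff_right inner_commute algebra_simps)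
qed

lemma inner_normal_squared: "inner_normal \<bullet> inner_normal = 1 + k\<^sup>2"
proof -
  have "\<sigma> * \<sigma> = 1" using sign by (metis abs_mult_self_eq mult_1)
  then show ?thesis
    using arg_cong[where f = "\<lambda>x. x * (1 + k\<^sup>2)", of "\<sigma> * \<sigma>" 1]
    by (simp add: inner_normal_def inner_add_left inner_add_right e_unit power2_eq_square algebra_simps)
qed

lemma deriv_inner_v_along_curve:
  "((\<lambda>a. w \<bullet> v (pt a)) has_real_derivative H Q w \<bullet> tangent) (at 0)"
  by (rule derivative_along_curve) (auto intro!: continuous_intros cont_v cont_H grad_inner_v)

text \<open>\<open>c2 - v \<bullet> v\<close> vanishes along the curve, hence so does its tangential
  derivative; its gradient is \<open>- (\<gamma> - 1)\<close> times \<open>v\<close> minus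
  \<open>\<gamma> + 1\<close> times \<open>H v\<close>.\<close>

lemma sonic_tangential:
  assumes sonic: "\<And>a. \<bar>a\<bar> < r \<Longrightarrow> v (pt a) \<bullet> v (pt a) = c2 (pt a)"
  shows "(\<gamma> + 1) * (H Q (v Q) \<bullet> tangent) = - (\<gamma> - 1) * (v Q \<bullet> tangent)"
proof -
  have "((\<lambda>a. c2 (pt a) - v (pt a) \<bullet> v (pt a)) has_real_derivative
      (c2_grad Q - 2 *\<^sub>R H Q (v Q)) \<bullet> tangent) (at 0)"
    by (rule derivative_along_curve[where g = "\<lambda>x. c2 x - v x \<bullet> v x"])
      (auto intro!: continuous_intros cont_c2 cont_v cont_H GDERIV_diff grad_c2 grad_v_squared)
  then have "((\<lambda>a. 0) has_real_derivative (c2_grad Q - 2 *\<^sub>R H Q (v Q)) \<bullet> tangent) (at 0)"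
    by (rule has_field_derivative_transform_within_open[of _ _ _ "{-r<..<r}"]) (use r_pos sonic in auto)
  then have "(c2_grad Q - 2 *\<^sub>R H Q (v Q)) \<bullet> tangent = 0"
    by (rule DERIV_unique) simp
  then show ?thesis by (simp add: inner_diff_left inner_add_left algebra_simps)
qed

text \<open>Along the ray in direction \<open>perp (v Q)\<close> that enters
  \<open>\<Omega>\<close>, the derivative of \<open>c\<close> is \<open>0\<close>, hence so is that
  of its square. The latter is also given by \<open>c2_grad\<close>, which leaves the mixed second
  derivative.\<close>

lemma perp_derivative_zero:
  assumes "has_perp_derivative_c \<gamma> K \<Omega> \<phi> Q 0"
    and pv: "\<And>x. x \<in> A \<Longrightarrow> pseudo_velocity \<Omega> \<phi> x = v x"
    and c2_nonneg: "\<And>x. x \<in> insert Q \<Omega> \<Longrightarrow> 0 \<le> c2 x"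
    and nonexc: "v Q \<bullet> tangent \<noteq> 0"
  shows "perp (v Q) \<bullet> H Q (v Q) = 0"
proof -
  let ?c = "sonic_speed \<gamma> K \<Omega> \<phi>"
  from assms(1) obtain D where D: "(?c has_derivative D) (at Q within \<Omega>)" and "D (perp (v Q)) = 0"
    unfolding has_perp_derivative_c_def perp_def pv[OF Q_A] by blast
  have c: "(?c x)\<^sup>2 = c2 x" if "x \<in> insert Q \<Omega>" for x
  proof -
    have "x \<in> A" using that Q_A \<Omega>_A by blast
    then have "?c x = sqrt (c2 x)"
      by (simp add: sonic_speed_def bernoulli_def csq_def pv power2_norm_eq_inner)
    then show ?thesis using c2_nonneg[OF that] by simp
  qed
  obtain s where s: "\<bar>s\<bar> = 1" "0 < inner_normal \<bullet> (s *\<^sub>R perp (v Q))"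
  proof (cases "0 < inner_normal \<bullet> perp (v Q)")
    case True
    then show thesis using that[of 1] by simp
  next
    case False
    moreover have "inner_normal \<bullet> perp (v Q) \<noteq> 0"
      using nonexc sign by (auto simp: inner_normal_perp)
    ultimately show thesis using that[of "-1"] by simp
  qed
  define d where "d = s *\<^sub>R perp (v Q)"
  have "D d = 0"
    using linear_scale[OF has_derivative_linear[OF D]] \<open>D (perp (v Q)) = 0\<close> by (simp add: d_def)
  \<comment> \<open>Restricting the parameters to those with image in \<open>\<Omega>\<close> allows
    composition with a derivative taken only within \<open>\<Omega>\<close>.\<close>
  define T where "T = {t. 0 < t \<and> Q + t *\<^sub>R d \<in> \<Omega>}"
  have lim: "((\<lambda>t. (c2 (Q + t *\<^sub>R d) - c2 Q) / t) \<longlongrightarrow> c2_grad Q \<bullet> d) (at_right 0)"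
    and ev: "\<forall>\<^sub>F t in at_right 0. Q + t *\<^sub>R d \<in> \<Omega>"
    by (rule one_sided_derivative[OF cont_c2 cont_c2_grad grad_c2]; use s in \<open>simp add: d_def\<close>)+
  have nontriv: "at 0 within T \<noteq> bot"
  proof
    assume "at 0 within T = bot"
    then have "eventually (\<lambda>t. False) (at 0 within T)" by simp
    then have "eventually (\<lambda>t. t \<notin> T) (at_right 0)"
      by (auto simp: eventually_at_filter T_def elim!: eventually_mono)
    moreover have "eventually (\<lambda>t. t \<in> T) (at_right 0)"
      using ev eventually_at_right_less[of 0] by eventually_elim (simp add: T_def)
    ultimately have "eventually (\<lambda>t::real. False) (at_right 0)" by eventually_elim simp
    then show False by simp
  qed
  have ray: "((\<lambda>t. Q + t *\<^sub>R d) has_derivative (\<lambda>h. h *\<^sub>R d)) (at 0 within T)"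
    by (auto intro!: derivative_eq_intros)
  have "(?c has_derivative D) (at (Q + 0 *\<^sub>R d) within (\<lambda>t. Q + t *\<^sub>R d) ` T)"
    using has_derivative_subset[OF D, of "(\<lambda>t. Q + t *\<^sub>R d) ` T"] by (auto simp: T_def)
  from has_derivative_in_compose[OF ray this]
  have "((\<lambda>t. ?c (Q + t *\<^sub>R d)) has_derivative (\<lambda>h. D (h *\<^sub>R d))) (at 0 within T)" .
  moreover have "D (h *\<^sub>R d) = 0" for h
    using linear_scale[OF has_derivative_linear[OF D]] \<open>D d = 0\<close> by simp
  ultimately have "((\<lambda>t. ?c (Q + t *\<^sub>R d)) has_real_derivative 0) (at 0 within T)"
    by (simp add: has_field_derivative_def flip: lambda_zero)
  from DERIV_power[OF this, of 2]
  have "((\<lambda>t. ((?c (Q + t *\<^sub>R d))\<^sup>2 - (?c Q)\<^sup>2) / t) \<longlongrightarrow> 0) (at 0 within T)"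
    by (simp add: has_field_derivative_iff)
  then have "((\<lambda>t. (c2 (Q + t *\<^sub>R d) - c2 Q) / t) \<longlongrightarrow> 0) (at 0 within T)"
    by (rule Lim_transform_eventually) (simp add: eventually_at_filter T_def c)
  moreover have "((\<lambda>t. (c2 (Q + t *\<^sub>R d) - c2 Q) / t) \<longlongrightarrow> c2_grad Q \<bullet> d) (at 0 within T)"
    by (rule tendsto_within_subset[OF lim]) (auto simp: T_def)
  ultimately have "c2_grad Q \<bullet> d = 0"
    using tendsto_unique[OF nontriv] by blast
  then show ?thesis
    using gamma s(1) by (auto simp: d_def inner_add_left inner_add_right inner_commute)
qed

text \<open>In the basis \<open>v Q\<close>, \<open>perp (v Q)\<close> the symmetric Hessian has
  three entries: the equation gives the one across, \<open>perp0\<close> the mixed one, and the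
  sonic condition along the curve the remaining one.\<close>

lemma second_derivative_at_sonic_point:
  assumes q: "v Q \<bullet> v Q = c2 Q" "0 < c2 Q"
    and sonic: "\<And>a. \<bar>a\<bar> < r \<Longrightarrow> v (pt a) \<bullet> v (pt a) = c2 (pt a)"
    and perp0: "perp (v Q) \<bullet> H Q (v Q) = 0"
    and nonexc: "v Q \<bullet> tangent \<noteq> 0"
  shows "H Q (v Q) = - ((\<gamma> - 1) / (\<gamma> + 1)) *\<^sub>R v Q" and "H Q (perp (v Q)) = - perp (v Q)"
proof -
  let ?W = "v Q" and ?q = "c2 Q"
  have scale: "x = y" if "?q *\<^sub>R x = ?q *\<^sub>R y" for x y :: plane
    using that q(2) by simp
  have exp: "?q *\<^sub>R x = (x \<bullet> ?W) *\<^sub>R ?W + (x \<bullet> perp ?W) *\<^sub>R perp ?W" for x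
    using perp_expansion[of ?W x] q(1) by simp
  have perp_perp: "H Q (perp ?W) \<bullet> perp ?W = - ?q"
    using sonic_perp[OF Q_A q(2,1)] by (simp add: inner_commute)
  have perp_W: "H Q (perp ?W) \<bullet> ?W = 0"
    using perp0 H_sym[OF Q_A, of "?W" "perp ?W"] by (simp add: inner_commute)
  show "H Q (perp ?W) = - perp ?W"
    by (rule scale) (simp add: exp[of "H Q (perp ?W)"] perp_perp perp_W)
  have W_perp: "H Q ?W \<bullet> perp ?W = 0" using perp0 by (simp add: inner_commute)
  then have "?q * (H Q ?W \<bullet> tangent) = (H Q ?W \<bullet> ?W) * (?W \<bullet> tangent)"
    using perp_parseval[of ?W "H Q ?W" tangent] q(1) by (simp add: inner_commute)
  then have "(\<gamma> + 1) * (H Q ?W \<bullet> ?W) * (?W \<bullet> tangent) = ?q * ((\<gamma> + 1) * (H Q ?W \<bullet> tangent))"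
    by (simp add: ac_simps)
  also have "\<dots> = ?q * (- (\<gamma> - 1) * (?W \<bullet> tangent))"
    by (simp only: sonic_tangential[OF sonic])
  also have "\<dots> = (- (\<gamma> - 1) * ?q) * (?W \<bullet> tangent)" by simp
  \<comment> \<open>Cancelling the tangential component of \<open>v Q\<close> is possible because
    \<open>Q\<close> is not exceptional.\<close>
  finally have "(\<gamma> + 1) * (H Q ?W \<bullet> ?W) = - (\<gamma> - 1) * ?q"
    by (rule mult_right_cancel[OF nonexc, THEN iffD1])
  then have "H Q ?W \<bullet> ?W = - ((\<gamma> - 1) / (\<gamma> + 1)) * ?q"
    using gamma by (simp add: field_simps)
  then have "?q *\<^sub>R H Q ?W = (- ((\<gamma> - 1) / (\<gamma> + 1)) * ?q) *\<^sub>R ?W"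
    by (simp only: exp[of "H Q ?W"] W_perp scaleR_zero_left add_0_right)
  also have "\<dots> = ?q *\<^sub>R (- ((\<gamma> - 1) / (\<gamma> + 1)) *\<^sub>R ?W)"
    by (simp only: scaleR_scaleR mult.commute)
  finally show "H Q ?W = - ((\<gamma> - 1) / (\<gamma> + 1)) *\<^sub>R ?W" by (rule scale)
qed

end

section \<open>The strict supersolution near a degenerate sonic point\<close>

text \<open>Differencing the flow equation this way keeps an average of the two principal parts, which is
  again elliptic.\<close>
lemma averaged_equation:
  fixes H1 H2 :: "plane \<Rightarrow>\<^sub>L plane" and w1 w2 :: plane
  assumes "h \<noteq> 0"
    and 1: "c1 * (trace2 H1 + 2) = w1 \<bullet> w1 + w1 \<bullet> H1 w1"
    and 2: "c2 * (trace2 H2 + 2) = w2 \<bullet> w2 + w2 \<bullet> H2 w2"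
    and \<delta>: "\<delta>c = (c1 - c2) / (2 * h)" "\<delta>w = (1 / (2 * h)) *\<^sub>R (w1 - w2)"
    and Hd: "Hd = (1/2) *\<^sub>R (H1 + H2)"
  shows "(1 / (2 * h)) * ((c1 + c2) * (trace2 H1 - trace2 H2)
      - w1 \<bullet> (H1 w1 - H2 w1) - w2 \<bullet> (H1 w2 - H2 w2))
    = - 2 * (2 * \<delta>c - (w1 + w2) \<bullet> \<delta>w + \<delta>c * trace2 Hd - (1/2) * ((w1 + w2) \<bullet> Hd \<delta>w + \<delta>w \<bullet> Hd (w1 + w2)))"
proof -
  define s where "s = 1 / (2 * h)"
  have tr: "trace2 Hd = (1/2) * (trace2 H1 + trace2 H2)"
    by (simp add: Hd trace2_def blinfun.add_left blinfun.scaleR_left inner_add_right field_simps)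
  have dw: "\<delta>w = s *\<^sub>R (w1 - w2)" and dc: "\<delta>c = s * (c1 - c2)" by (simp_all add: \<delta> s_def)
  have a: "(w1 + w2) \<bullet> \<delta>w = s * (w1 \<bullet> w1 - w2 \<bullet> w2)"
    unfolding dw inner_scaleR_right inner_add_left inner_diff_right by (simp add: inner_commute)
  have Hd_apply: "Hd u = (1/2) *\<^sub>R (H1 u + H2 u)" for u
    by (simp add: Hd blinfun.add_left blinfun.scaleR_left)
  have b: "(w1 + w2) \<bullet> Hd \<delta>w + \<delta>w \<bullet> Hd (w1 + w2)
      = s * (w1 \<bullet> H1 w1 + w1 \<bullet> H2 w1 - w2 \<bullet> H1 w2 - w2 \<bullet> H2 w2)"
    unfolding Hd_apply dw blinfun.scaleR_right blinfun.add_right blinfun.diff_right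
      inner_scaleR_left inner_scaleR_right inner_add_left inner_add_right inner_diff_left inner_diff_right
    by (simp add: algebra_simps)
  \<comment> \<open>For the traces, \<open>(c1 + c2) (t1 - t2) + (c1 - c2) (t1 + t2)\<close> is
    twice \<open>c1 t1 - c2 t2\<close>, and the quadratic forms split likewise. Twice the difference
    of the two equations then leaves the differences of Hessians on the left.\<close>
  have key: "(c1 + c2) * (trace2 H1 - trace2 H2) - w1 \<bullet> (H1 w1 - H2 w1) - w2 \<bullet> (H1 w2 - H2 w2)
    = - (4 * (c1 - c2) - 2 * (w1 \<bullet> w1 - w2 \<bullet> w2) + (c1 - c2) * (trace2 H1 + trace2 H2)
       - (w1 \<bullet> H1 w1 + w1 \<bullet> H2 w1 - w2 \<bullet> H1 w2 - w2 \<bullet> H2 w2))"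
    using 1 2 by (simp add: inner_diff_right algebra_simps)
  show ?thesis
    unfolding tr a b dc s_def[symmetric] key by (simp add: field_simps)
qed

text \<open>Of the factor \<open>\<kappa>\<close> only \<open>\<kappa> - 1\<close> is kept; the rest absorbs the errors.\<close>
lemma square_perturbation:
  fixes a b \<kappa> \<mu> x y :: real
  assumes "2 < \<kappa>" "x\<^sup>2 \<le> \<eta> * (a\<^sup>2 + b\<^sup>2)" "y\<^sup>2 \<le> \<eta> * (a\<^sup>2 + b\<^sup>2)"
    and "2 * \<kappa>\<^sup>2 * \<eta> \<le> 1 / 2" "2 * \<kappa>\<^sup>2 * \<eta> \<le> \<kappa> * \<mu>\<^sup>2 / 2"
  shows "(\<kappa> - 1) * a\<^sup>2 \<le> \<kappa> * ((- a + x)\<^sup>2 + (- \<mu> * b + y)\<^sup>2)"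
proof -
  \<comment> \<open>This square bounds the cross term at the price of \<open>a\<^sup>2 / 2\<close>,
    so that another \<open>a\<^sup>2 / 2\<close> is left for the errors.\<close>
  have "0 \<le> (a - 2 * \<kappa> * x)\<^sup>2" by simp
  then have 1: "\<kappa> * (- a + x)\<^sup>2 \<ge> (\<kappa> - 1/2) * a\<^sup>2 - \<kappa> * (2 * \<kappa> - 1) * x\<^sup>2"
    using assms(1) by (simp add: power2_eq_square algebra_simps)
  have "0 \<le> (\<mu> * b - 2 * y)\<^sup>2" by simp
  then have "(- \<mu> * b + y)\<^sup>2 \<ge> \<mu>\<^sup>2 * b\<^sup>2 / 2 - y\<^sup>2"
    by (simp add: power2_eq_square algebra_simps)
  then have 2: "\<kappa> * (- \<mu> * b + y)\<^sup>2 \<ge> \<kappa> * (\<mu>\<^sup>2 * b\<^sup>2 / 2 - y\<^sup>2)"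
    using assms(1) by (intro mult_left_mono) auto
  have 3: "\<kappa> * (2 * \<kappa> - 1) * x\<^sup>2 \<le> \<kappa> * (2 * \<kappa> - 1) * (\<eta> * (a\<^sup>2 + b\<^sup>2))"
    using assms(1,2) by (intro mult_left_mono mult_nonneg_nonneg) auto
  have 4: "\<kappa> * y\<^sup>2 \<le> \<kappa> * (\<eta> * (a\<^sup>2 + b\<^sup>2))"
    using assms(1,3) by (intro mult_left_mono) auto
  have "2 * \<kappa>\<^sup>2 * \<eta> * a\<^sup>2 \<le> 1 / 2 * a\<^sup>2" "2 * \<kappa>\<^sup>2 * \<eta> * b\<^sup>2 \<le> \<kappa> * \<mu>\<^sup>2 / 2 * b\<^sup>2"
    using assms(4,5) by (intro mult_right_mono; simp)+
  then have "\<kappa> * (2 * \<kappa> - 1) * (\<eta> * (a\<^sup>2 + b\<^sup>2)) + \<kappa> * (\<eta> * (a\<^sup>2 + b\<^sup>2)) \<le> a\<^sup>2 / 2 + \<kappa> * (\<mu>\<^sup>2 * b\<^sup>2 / 2)"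
    by (simp add: power2_eq_square algebra_simps)
  with 1 2 3 4 have "\<kappa> * (- a + x)\<^sup>2 + \<kappa> * (- \<mu> * b + y)\<^sup>2 \<ge> (\<kappa> - 1) * a\<^sup>2"
    by (simp add: algebra_simps)
  then show ?thesis by (simp add: distrib_left)
qed

text \<open>By \<open>trace2_perp\<close>, the expression is \<open>c - w \<bullet> w\<close> times
  the trace plus the value of the quadratic form at \<open>perp w\<close>.\<close>

lemma elliptic_nonneg:
  assumes "linear B" "w \<bullet> w \<le> c" and psd: "\<And>d. 0 \<le> d \<bullet> B d"
  shows "0 \<le> c * trace2 B - w \<bullet> B w"
proof -
  have "0 \<le> trace2 B" using psd unfolding trace2_def by (intro add_nonneg_nonneg)
  then have "w \<bullet> w * trace2 B \<le> c * trace2 B" using assms(2) by (rule mult_right_mono[rotated])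
  then show ?thesis
    using trace2_perp[OF assms(1), of w] psd[of "perp w"] by simp
qed

lemma GDERIV_shift: "GDERIV f (x + a) :> p \<Longrightarrow> GDERIV (\<lambda>y. f (y + a)) x :> (p :: 'a::real_inner)"
  unfolding gderiv_def
  by (rule has_derivative_compose[of "\<lambda>y. y + a" "\<lambda>h. h" x UNIV f, simplified])
    (auto intro!: derivative_eq_intros)

text \<open>The situation to be refuted: \<open>H_W\<close> makes the gradient of
  \<open>c2 - v \<bullet> v\<close> vanish at \<open>Q\<close>, although this function is positive
  in \<open>\<Omega>\<close>.\<close>

locale degenerate_sonic_point = flow_boundary +
  assumes subsonic: "\<And>x. x \<in> \<Omega> \<Longrightarrow> v x \<bullet> v x < c2 x"
    and sonic_Q: "v Q \<bullet> v Q = c2 Q" and c2_Q_pos: "0 < c2 Q"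
    and H_W: "H Q (v Q) = - ((\<gamma> - 1) / (\<gamma> + 1)) *\<^sub>R v Q"
    and H_perp_W: "H Q (perp (v Q)) = - perp (v Q)"
begin

abbreviation "W \<equiv> v Q"
abbreviation "q \<equiv> c2 Q"
abbreviation "\<mu> \<equiv> (\<gamma> - 1) / (\<gamma> + 1)"

text \<open>Linearising the nonlinear term of \<open>c2 x - v x \<bullet> v x\<close> at \<open>Q\<close> makes the function affine in
  \<open>\<phi>\<close> and its gradient, so that its difference quotients are \<open>C\<^sup>2\<close>; the quadratic term
  turns it into a strict supersolution, and is small enough to keep it positive.\<close>
definition "Z x = (\<gamma> - 1) * (K - \<phi> x) - (\<gamma> + 1) * (W \<bullet> v x) + (\<gamma> + 1) / 2 * q
    - \<gamma> / (2 * q) * (perp W \<bullet> (x - Q))\<^sup>2"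

definition "Z_grad x = - (\<gamma> - 1) *\<^sub>R v x - (\<gamma> + 1) *\<^sub>R H x W - (\<gamma> / q * (perp W \<bullet> (x - Q))) *\<^sub>R perp W"

lemma cont_Z: "continuous_on A Z" and cont_Z_grad: "continuous_on A Z_grad"
  unfolding Z_def Z_grad_def by (intro continuous_intros cont_\<phi> cont_v cont_H)+

lemma grad_Z:
  assumes "x \<in> \<Omega>"
  shows "GDERIV Z x :> Z_grad x"
  unfolding gderiv_def Z_def
  by (rule derivative_eq_intros grad_\<phi>[OF assms, unfolded gderiv_def] grad_inner_v[OF assms, unfolded gderiv_def] refl)+
    (simp add: Z_grad_def fun_eq_iff inner_diff_right inner_add_right algebra_simps inner_commute)

text \<open>This is where the degeneracy enters: \<open>(\<gamma> + 1) * \<mu>\<close> is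
  \<open>\<gamma> - 1\<close>, so the first two terms cancel.\<close>

lemma Z_grad_Q: "Z_grad Q = 0"
  using gamma by (simp add: Z_grad_def H_W) (simp add: algebra_simps)

lemma Z_Q: "Z Q = 0"
proof -
  have "q = (\<gamma> - 1) * (K - \<phi> Q - q / 2)"
    using csq_def[of \<gamma> K \<phi> v Q] sonic_Q by simp
  then have "(\<gamma> - 1) * (K - \<phi> Q) = q + (\<gamma> - 1) * (q / 2)"
    by (simp only: right_diff_distrib)
  then show ?thesis by (simp add: Z_def sonic_Q field_simps)
qed

text \<open>The disk is star-shaped about \<open>Q\<close>: scaling by \<open>u\<close> multiplies
  the linear side by \<open>u\<close> and the quadratic one by the smaller factor
  \<open>u * u\<close>.\<close>

lemma disk_segment:
  assumes x: "C * (norm (x - Q))\<^sup>2 < inner_normal \<bullet> (x - Q)" "norm (x - Q) < r" and "L \<le> C"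
    and z: "z \<in> open_segment Q x"
  shows "z \<in> \<Omega>" and "dist z Q \<le> norm (x - Q)"
proof -
  from z obtain u where u: "0 < u" "u < 1" "z = (1 - u) *\<^sub>R Q + u *\<^sub>R x" by (auto simp: in_segment)
  then have z: "z - Q = u *\<^sub>R (x - Q)" by (simp add: algebra_simps)
  have n: "norm (z - Q) \<le> norm (x - Q)"
    using u(1,2) by (simp add: z mult_left_le_one_le)
  then show "dist z Q \<le> norm (x - Q)" by (simp add: dist_norm)
  have "L * (norm (z - Q))\<^sup>2 = (u * u) * (L * (norm (x - Q))\<^sup>2)"
    using u(1,2) by (simp add: z power2_eq_square)
  also have "\<dots> \<le> (u * 1) * (L * (norm (x - Q))\<^sup>2)"
    using u L_nonneg by (intro mult_right_mono mult_left_mono) auto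
  also have "\<dots> \<le> u * (C * (norm (x - Q))\<^sup>2)"
    using u assms(3) by (simp add: mult_right_mono)
  also have "\<dots> < u * (inner_normal \<bullet> (x - Q))" using x(1) u by simp
  also have "\<dots> = inner_normal \<bullet> (z - Q)" by (simp add: z)
  finally show "z \<in> \<Omega>" using n x(2) by (intro disk_subset) auto
qed

text \<open>Completing the square writes \<open>Z\<close> as \<open>c2 - v \<bullet> v\<close>,
  which is positive, plus \<open>(\<gamma> + 1) / 2\<close> times the square of
  \<open>v - W\<close>, minus the quadratic term. To first order \<open>v - W\<close> is
  \<open>H Q (x - Q)\<close>, whose component across \<open>W\<close> outweighs the quadratic term
  because \<open>\<gamma> < \<gamma> + 1\<close>.\<close>

lemma Z_pos:
  obtains \<rho> where "0 < \<rho>" "\<rho> \<le> r"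
    "\<And>x. L * (norm (x - Q))\<^sup>2 < inner_normal \<bullet> (x - Q) \<Longrightarrow> norm (x - Q) < \<rho> \<Longrightarrow> 0 < Z x"
proof -
  \<comment> \<open>The relative error that \<open>square_perturbation\<close> tolerates for
    \<open>\<kappa> = \<gamma> + 1\<close>.\<close>
  define \<eta> where "\<eta> = min (1 / 2) ((\<gamma> + 1) * \<mu>\<^sup>2 / 2) / (2 * (\<gamma> + 1)\<^sup>2)"
  have "\<mu> > 0" using gamma by simp
  then have \<eta>: "0 < \<eta>" "2 * (\<gamma> + 1)\<^sup>2 * \<eta> \<le> 1 / 2" "2 * (\<gamma> + 1)\<^sup>2 * \<eta> \<le> (\<gamma> + 1) * \<mu>\<^sup>2 / 2"
    using gamma by (auto simp: \<eta>_def intro!: divide_pos_pos)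
  \<comment> \<open>If \<open>H\<close> applied to \<open>W\<close> and to \<open>perp W\<close>
    varies by less than \<open>\<omega>\<close>, the squared errors stay below
    \<open>\<eta> * q\<close> times the squared distance to \<open>Q\<close>.\<close>
  define \<omega> where "\<omega> = sqrt (\<eta> * q)"
  have \<omega>: "0 < \<omega>" "\<omega>\<^sup>2 = \<eta> * q" using \<eta>(1) c2_Q_pos by (auto simp: \<omega>_def)
  have near: "\<exists>\<rho>>0. \<forall>z\<in>A. dist z Q < \<rho> \<longrightarrow> dist (H z w) (H Q w) < \<omega>" for w
  proof -
    have "continuous_on A (\<lambda>z. H z w)" by (intro continuous_intros cont_H)
    then show ?thesis using Q_A \<omega>(1) unfolding continuous_on_iff by blast
  qed
  from near[of W] near[of "perp W"] obtain \<rho>1 \<rho>2 where \<rho>: "0 < \<rho>1" "0 < \<rho>2"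
    "\<And>z. z \<in> A \<Longrightarrow> dist z Q < \<rho>1 \<Longrightarrow> dist (H z W) (H Q W) < \<omega>"
    "\<And>z. z \<in> A \<Longrightarrow> dist z Q < \<rho>2 \<Longrightarrow> dist (H z (perp W)) (H Q (perp W)) < \<omega>"
    by blast
  show thesis
  proof (rule that[of "min r (min \<rho>1 \<rho>2)"])
    show "0 < min r (min \<rho>1 \<rho>2)" using r_pos \<rho> by simp
    fix x assume x: "L * (norm (x - Q))\<^sup>2 < inner_normal \<bullet> (x - Q)" "norm (x - Q) < min r (min \<rho>1 \<rho>2)"
    then have xr: "norm (x - Q) < r" by simp
    have "x \<noteq> Q" using x(1) by auto
    have "x \<in> \<Omega>" using disk_subset x(1) xr by blast
    note seg = disk_segment[OF x(1) xr order_refl]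
    have "open_segment Q x \<subseteq> \<Omega>" using seg(1) by blast
    then have "closed_segment Q x \<subseteq> A"
      using Q_A \<Omega>_A \<open>x \<in> \<Omega>\<close> unfolding closed_segment_eq_open by auto
    then have cont: "continuous_on (closed_segment Q x) (\<lambda>x. w \<bullet> v x)" for w
      by (intro continuous_on_subset[OF _ \<open>closed_segment Q x \<subseteq> A\<close>] continuous_intros cont_v)
    have increment: "\<exists>z\<in>open_segment Q x. w \<bullet> v x - w \<bullet> W = H z w \<bullet> (x - Q)" for w
      by (rule gradient_mvt[OF _ cont, where p = "\<lambda>z. H z w"]) (use \<open>x \<noteq> Q\<close> grad_inner_v seg(1) in blast)+
    obtain z1 where z1: "z1 \<in> open_segment Q x" "W \<bullet> v x - W \<bullet> W = H z1 W \<bullet> (x - Q)"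
      using increment by blast
    obtain z2 where z2: "z2 \<in> open_segment Q x" "perp W \<bullet> v x - perp W \<bullet> W = H z2 (perp W) \<bullet> (x - Q)"
      using increment by blast
    define a b where "a = perp W \<bullet> (x - Q)" and "b = W \<bullet> (x - Q)"
    define e1 e2 where "e1 = (H z1 W - H Q W) \<bullet> (x - Q)" and "e2 = (H z2 (perp W) - H Q (perp W)) \<bullet> (x - Q)"
    have ab: "q * (norm (x - Q))\<^sup>2 = a\<^sup>2 + b\<^sup>2"
      using perp_parseval[of W "x - Q" "x - Q"]
      by (simp add: a_def b_def sonic_Q power2_norm_eq_inner inner_commute) (simp add: power2_eq_square)
    have err: "((y - y') \<bullet> (x - Q))\<^sup>2 \<le> \<eta> * (a\<^sup>2 + b\<^sup>2)" if "dist y y' < \<omega>" for y y'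
    proof -
      have "\<bar>(y - y') \<bullet> (x - Q)\<bar> \<le> norm (y - y') * norm (x - Q)" by (rule Cauchy_Schwarz_ineq2)
      also have "\<dots> \<le> \<omega> * norm (x - Q)" using that by (intro mult_right_mono) (auto simp: dist_norm)
      finally have "((y - y') \<bullet> (x - Q))\<^sup>2 \<le> (\<omega> * norm (x - Q))\<^sup>2"
        using \<omega>(1) by (intro power2_le_iff_abs_le[THEN iffD2]) auto
      also have "\<dots> = \<eta> * (a\<^sup>2 + b\<^sup>2)" by (simp add: power_mult_distrib \<omega>(2) ab[symmetric])
      finally show ?thesis .
    qed
    have "e1\<^sup>2 \<le> \<eta> * (a\<^sup>2 + b\<^sup>2)" "e2\<^sup>2 \<le> \<eta> * (a\<^sup>2 + b\<^sup>2)"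
      unfolding e1_def e2_def
      using \<rho>(3)[of z1] \<rho>(4)[of z2] seg[OF z1(1)] seg[OF z2(1)] x(2) \<Omega>_A
      by (intro err; force)+
    then have est: "\<gamma> * a\<^sup>2 \<le> (\<gamma> + 1) * ((- a + e2)\<^sup>2 + (- \<mu> * b + e1)\<^sup>2)"
      using square_perturbation[of "\<gamma> + 1" e2 \<eta> a b e1 \<mu>] \<eta> gamma by simp
    have "e2 = H z2 (perp W) \<bullet> (x - Q) + a"
      by (simp only: e2_def inner_diff_left[of "H z2 _"] H_perp_W inner_minus_left a_def; simp)
    then have f2: "perp W \<bullet> (v x - W) = - a + e2"
      using z2(2) by (simp only: inner_diff_right[of "perp W" "v x"]; simp)
    have "e1 = H z1 W \<bullet> (x - Q) + \<mu> * b"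
      by (simp only: e1_def inner_diff_left[of "H z1 _"] H_W inner_minus_left inner_scaleR_left b_def; simp)
    then have f1: "W \<bullet> (v x - W) = - \<mu> * b + e1"
      using z1(2) by (simp only: inner_diff_right[of W "v x"]; simp)
    have nrm: "q * ((v x - W) \<bullet> (v x - W)) = (- a + e2)\<^sup>2 + (- \<mu> * b + e1)\<^sup>2"
      using perp_parseval[of W "v x - W" "v x - W"]
      unfolding sonic_Q inner_commute[of "v x - W" W] inner_commute[of "v x - W" "perp W"] f1 f2
      by (simp only: power2_eq_square add.commute)
    have "\<gamma> / q * a\<^sup>2 \<le> (\<gamma> + 1) * ((v x - W) \<bullet> (v x - W))"
      using est c2_Q_pos unfolding nrm[symmetric] by (simp add: field_simps)
    moreover have "Z x = c2 x - v x \<bullet> v x + (\<gamma> + 1) / 2 * ((v x - W) \<bullet> (v x - W)) - \<gamma> / (2 * q) * a\<^sup>2"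
    proof -
      have e: "(v x - W) \<bullet> (v x - W) = v x \<bullet> v x - 2 * (W \<bullet> v x) + q"
        by (simp add: inner_diff_left inner_diff_right sonic_Q inner_commute)
      show ?thesis
        unfolding Z_def a_def csq_def[of _ _ _ _ x] e by (simp add: field_simps)
    qed
    ultimately show "0 < Z x"
      using subsonic[OF \<open>x \<in> \<Omega>\<close>] by simp
  qed simp
qed

end

section \<open>The averaged linearised operator\<close>

lemma trace2_linear_combination:
  "trace2 (\<lambda>d. a *\<^sub>R B1 d + b *\<^sub>R B2 d) = a * trace2 B1 + b * trace2 B2"
  by (simp add: trace2_def inner_add_right algebra_simps)

lemma trace2_rank_one: "trace2 (\<lambda>d. (w \<bullet> d) *\<^sub>R w) = w \<bullet> w"
  by (simp add: trace2_def inner_prod_def)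

lemma trace2_id: "trace2 (\<lambda>d. d) = 2"
  by (simp add: trace2_def)

text \<open>The principal part of the flow equation with frozen coefficients; \<open>c\<close>
  stands for the squared sonic speed.\<close>

definition ell :: "real \<Rightarrow> plane \<Rightarrow> (plane \<Rightarrow> plane) \<Rightarrow> real" where
  "ell c w B = c * trace2 B - w \<bullet> B w"

lemma ell_linear_combination:
  "ell c w (\<lambda>d. a *\<^sub>R B1 d + b *\<^sub>R B2 d) = a * ell c w B1 + b * ell c w B2"
  by (simp add: ell_def trace2_linear_combination inner_add_right algebra_simps)

context degenerate_sonic_point
begin

text \<open>The Hessian at \<open>x\<close> of the difference-quotient version of \<open>Z\<close> minus the barrier
  \<open>(1 / (4 * C)) * (inner_normal \<bullet> (x - Q) - C * (norm (x - Q))\<^sup>2)\<close>.\<close>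
definition hess :: "plane \<Rightarrow> real \<Rightarrow> plane \<Rightarrow> plane" where
  "hess x h d = - (\<gamma> - 1) *\<^sub>R H x d - ((\<gamma> + 1) / (2 * h)) *\<^sub>R (H (x + h *\<^sub>R W) d - H (x - h *\<^sub>R W) d)
     - (\<gamma> / q * (perp W \<bullet> d)) *\<^sub>R perp W + (1 / 2) *\<^sub>R d"

lemma ell_hess:
  "ell c w (hess x h) = - (\<gamma> - 1) * ell c w (H x)
    - (\<gamma> + 1) * ((1 / (2 * h)) * (ell c w (H (x + h *\<^sub>R W)) - ell c w (H (x - h *\<^sub>R W))))
    - \<gamma> / q * (c * q - (perp W \<bullet> w)\<^sup>2) + (1 / 2) * (2 * c - w \<bullet> w)"
proof -
  let ?H1 = "blinfun_apply (H (x + h *\<^sub>R W))" and ?H2 = "blinfun_apply (H (x - h *\<^sub>R W))"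
  \<comment> \<open>The factors \<open>1\<close> and \<open>-1\<close> bring the map into nested
    two-term combinations, the form that \<open>ell_linear_combination\<close> rewrites.\<close>
  have "hess x h = (\<lambda>d. (- (\<gamma> - 1)) *\<^sub>R H x d + 1 *\<^sub>R ((- ((\<gamma> + 1) / (2 * h))) *\<^sub>R (1 *\<^sub>R ?H1 d + (-1) *\<^sub>R ?H2 d)
      + 1 *\<^sub>R ((- (\<gamma> / q)) *\<^sub>R ((perp W \<bullet> d) *\<^sub>R perp W) + (1 / 2) *\<^sub>R d)))"
    by (simp add: hess_def fun_eq_iff)
  then have "ell c w (hess x h) = (- (\<gamma> - 1)) * ell c w (H x) + 1 * ((- ((\<gamma> + 1) / (2 * h))) * (1 * ell c w ?H1 + (-1) * ell c w ?H2)
      + 1 * ((- (\<gamma> / q)) * ell c w (\<lambda>d. (perp W \<bullet> d) *\<^sub>R perp W) + (1 / 2) * ell c w (\<lambda>d. d)))"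
    by (simp only: ell_linear_combination)
  moreover have "ell c w (\<lambda>d. (perp W \<bullet> d) *\<^sub>R perp W) = c * q - (perp W \<bullet> w)\<^sup>2"
    by (simp add: ell_def trace2_rank_one sonic_Q inner_commute[of w "perp W"] power2_eq_square)
  moreover have "ell c w (\<lambda>d. d) = 2 * c - w \<bullet> w"
    by (simp add: ell_def trace2_id)
  ultimately show ?thesis by simp
qed

lemma c2_pos: "x \<in> \<Omega> \<Longrightarrow> 0 < c2 x"
  using subsonic[of x] inner_ge_zero[of "v x"] by linarith

lemma tendsto_at_Q:
  assumes "continuous_on A g" "\<And>n. y n \<in> \<Omega>" "y \<longlonglongrightarrow> Q"
  shows "(\<lambda>n. g (y n)) \<longlonglongrightarrow> g Q"
  by (rule continuous_on_tendsto_compose[OF assms(1,3) Q_A]) (use assms(2) \<Omega>_A in \<open>auto intro: always_eventually\<close>)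

text \<open>By continuity it suffices to evaluate at \<open>Q\<close>, where the sum is \<open>- q\<close>.\<close>
lemma hess_neg:
  obtains \<rho> where "0 < \<rho>"
    "\<And>x h. 0 < h \<Longrightarrow> closed_segment (x - h *\<^sub>R W) (x + h *\<^sub>R W) \<subseteq> \<Omega> \<inter> ball Q \<rho> \<Longrightarrow>
      ell (c2 (x + h *\<^sub>R W)) (v (x + h *\<^sub>R W)) (hess x h) + ell (c2 (x - h *\<^sub>R W)) (v (x - h *\<^sub>R W)) (hess x h) < 0"
proof (rule ccontr)
  note found = that
  define N where "N x h = ell (c2 (x + h *\<^sub>R W)) (v (x + h *\<^sub>R W)) (hess x h) +
    ell (c2 (x - h *\<^sub>R W)) (v (x - h *\<^sub>R W)) (hess x h)" for x h
  assume "\<not> thesis"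
  then have neg: "\<exists>x h. 0 < h \<and> closed_segment (x - h *\<^sub>R W) (x + h *\<^sub>R W) \<subseteq> \<Omega> \<inter> ball Q \<rho> \<and> 0 \<le> N x h"
    if "0 < \<rho>" for \<rho>
    using found[OF that] \<open>\<not> thesis\<close> unfolding N_def by (meson not_le)
  \<comment> \<open>Counterexamples for the radii \<open>1 / (n + 1)\<close> give segments shrinking
    to \<open>Q\<close>.\<close>
  have "\<forall>n. \<exists>y. 0 < snd y \<and> closed_segment (fst y - snd y *\<^sub>R W) (fst y + snd y *\<^sub>R W) \<subseteq> \<Omega> \<inter> ball Q (inverse (real (Suc n)))
      \<and> 0 \<le> N (fst y) (snd y)"
  proof
    fix n show "\<exists>y. 0 < snd y \<and> closed_segment (fst y - snd y *\<^sub>R W) (fst y + snd y *\<^sub>R W) \<subseteq> \<Omega> \<inter> ball Q (inverse (real (Suc n)))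
      \<and> 0 \<le> N (fst y) (snd y)"
      using neg[of "inverse (real (Suc n))"] by simp
  qed
  from choice[OF this] obtain y where y: "\<And>n. 0 < snd (y n)"
    "\<And>n. closed_segment (fst (y n) - snd (y n) *\<^sub>R W) (fst (y n) + snd (y n) *\<^sub>R W) \<subseteq> \<Omega> \<inter> ball Q (inverse (real (Suc n)))"
    "\<And>n. 0 \<le> N (fst (y n)) (snd (y n))"
    by blast
  define x h where "x n = fst (y n)" and "h n = snd (y n)" for n
  define a b where "a n = x n + h n *\<^sub>R W" and "b n = x n - h n *\<^sub>R W" for n
  have h: "0 < h n" and N: "0 \<le> N (x n) (h n)" for n
    using y(1,3) by (simp_all add: x_def h_def)
  have seg: "closed_segment (b n) (a n) \<subseteq> \<Omega> \<inter> ball Q (inverse (real (Suc n)))" for n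
    using y(2)[of n] by (simp add: x_def h_def a_def b_def)
  have to_Q: "z \<longlonglongrightarrow> Q" if "\<And>n. z n \<in> closed_segment (b n) (a n)" for z
  proof (rule tendsto_dist_iff[THEN iffD2], rule Lim_null_comparison[OF always_eventually LIMSEQ_inverse_real_of_nat], rule allI)
    fix n
    have "z n \<in> ball Q (inverse (real (Suc n)))" using that seg by blast
    then show "norm (dist (z n) Q) \<le> inverse (real (Suc n))" by (simp add: dist_commute)
  qed
  have lim: "(\<lambda>n. g (z n)) \<longlonglongrightarrow> g Q" if "continuous_on A g" "\<And>n. z n \<in> closed_segment (b n) (a n)" for g :: "plane \<Rightarrow> 'c::topological_space" and z
  proof (rule tendsto_at_Q[OF that(1) _ to_Q[OF that(2)]])
    fix n show "z n \<in> \<Omega>" using that(2)[of n] seg[of n] by blast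
  qed
  have x_seg: "x n \<in> closed_segment (b n) (a n)" for n
    unfolding closed_segment_def a_def b_def
    by (auto intro!: exI[of _ "1/2"] simp: algebra_simps simp flip: scaleR_add_left)
  have "W \<noteq> 0" using c2_Q_pos sonic_Q by auto
  have ab: "a n - b n = (2 * h n) *\<^sub>R W" for n
    unfolding a_def b_def mult_2 scaleR_add_left by simp
  have "b n \<noteq> a n" for n using ab[of n] h[of n] \<open>W \<noteq> 0\<close> by auto
  \<comment> \<open>The quotients converge although their centres move and the limit point is on the
    boundary, because \<open>p\<close> is continuous up to \<open>Q\<close>.\<close>
  have quotient: "(\<lambda>n. (g (a n) - g (b n)) / (2 * h n)) \<longlonglongrightarrow> p Q \<bullet> W"
    if g: "continuous_on A g" "continuous_on A p" "\<And>z. z \<in> \<Omega> \<Longrightarrow> GDERIV g z :> p z" for g :: "plane \<Rightarrow> real" and p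
  proof -
    have "\<forall>n. \<exists>z. z \<in> closed_segment (b n) (a n) \<and> (g (a n) - g (b n)) / (2 * h n) = p z \<bullet> W"
    proof
      fix n
      have sub: "closed_segment (b n) (a n) \<subseteq> \<Omega>" using seg by blast
      then have cont: "continuous_on (closed_segment (b n) (a n)) g"
        using continuous_on_subset[OF g(1)] \<Omega>_A by blast
      obtain z where "z \<in> open_segment (b n) (a n)" "g (a n) - g (b n) = p z \<bullet> (a n - b n)"
        by (rule gradient_mvt[OF \<open>b n \<noteq> a n\<close> cont, where p = p]) (use g(3) sub segment_open_subset_closed in blast)+
      then have "z \<in> closed_segment (b n) (a n)" "(g (a n) - g (b n)) / (2 * h n) = p z \<bullet> W"
        using h[of n] segment_open_subset_closed by (auto simp: ab)
      then show "\<exists>z. z \<in> closed_segment (b n) (a n) \<and> (g (a n) - g (b n)) / (2 * h n) = p z \<bullet> W" by blast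
    qed
    from choice[OF this] obtain z where z: "\<And>n. z n \<in> closed_segment (b n) (a n)"
      "\<And>n. (g (a n) - g (b n)) / (2 * h n) = p (z n) \<bullet> W" by blast
    have "(\<lambda>n. p (z n) \<bullet> W) \<longlonglongrightarrow> p Q \<bullet> W"
      by (intro tendsto_inner tendsto_const lim[OF g(2) z(1)])
    then show ?thesis by (simp add: z(2))
  qed
  define \<delta>c \<delta>w Hd where "\<delta>c n = (c2 (a n) - c2 (b n)) / (2 * h n)"
    and "\<delta>w n = (1 / (2 * h n)) *\<^sub>R (v (a n) - v (b n))"
    and "Hd n = (1 / 2) *\<^sub>R (H (a n) + H (b n))" for n
  have \<delta>c: "\<delta>c \<longlonglongrightarrow> c2_grad Q \<bullet> W"
    unfolding \<delta>c_def by (rule quotient[OF cont_c2 cont_c2_grad grad_c2])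
  have dw: "(\<lambda>n. w \<bullet> \<delta>w n) \<longlonglongrightarrow> H Q w \<bullet> W" for w
  proof -
    have "(\<lambda>n. (w \<bullet> v (a n) - w \<bullet> v (b n)) / (2 * h n)) \<longlonglongrightarrow> H Q w \<bullet> W"
      by (rule quotient) (auto intro!: continuous_intros cont_v cont_H grad_inner_v)
    then show ?thesis by (simp add: \<delta>w_def inner_diff_right)
  qed
  \<comment> \<open>The mean value theorem is scalar, so the limit is taken in the components along
    \<open>W\<close> and \<open>perp W\<close>.\<close>
  have \<delta>w: "\<delta>w \<longlonglongrightarrow> - \<mu> *\<^sub>R W"
  proof -
    have e: "\<delta>w n = (1 / q) *\<^sub>R ((W \<bullet> \<delta>w n) *\<^sub>R W + (perp W \<bullet> \<delta>w n) *\<^sub>R perp W)" for n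
    proof -
      have "(W \<bullet> \<delta>w n) *\<^sub>R W + (perp W \<bullet> \<delta>w n) *\<^sub>R perp W = q *\<^sub>R \<delta>w n"
        using perp_expansion[of W "\<delta>w n"] by (simp only: sonic_Q inner_commute[of "\<delta>w n"])
      then show ?thesis using c2_Q_pos by simp
    qed
    have "(\<lambda>n. (1 / q) *\<^sub>R ((W \<bullet> \<delta>w n) *\<^sub>R W + (perp W \<bullet> \<delta>w n) *\<^sub>R perp W)) \<longlonglongrightarrow>
        (1 / q) *\<^sub>R ((H Q W \<bullet> W) *\<^sub>R W + (H Q (perp W) \<bullet> W) *\<^sub>R perp W)"
      by (intro tendsto_intros dw)
    also have "(1 / q) *\<^sub>R ((H Q W \<bullet> W) *\<^sub>R W + (H Q (perp W) \<bullet> W) *\<^sub>R perp W) = - \<mu> *\<^sub>R W"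
      using c2_Q_pos by (simp add: H_W H_perp_W sonic_Q)
    finally show ?thesis using e by simp
  qed
  have ends: "a n \<in> closed_segment (b n) (a n)" "b n \<in> closed_segment (b n) (a n)" for n by auto
  have vc: "(\<lambda>n. v (a n)) \<longlonglongrightarrow> W" "(\<lambda>n. v (b n)) \<longlonglongrightarrow> W"
    "(\<lambda>n. c2 (a n)) \<longlonglongrightarrow> q" "(\<lambda>n. c2 (b n)) \<longlonglongrightarrow> q"
    "(\<lambda>n. H (a n)) \<longlonglongrightarrow> H Q" "(\<lambda>n. H (b n)) \<longlonglongrightarrow> H Q" "(\<lambda>n. H (x n)) \<longlonglongrightarrow> H Q"
    using lim[OF cont_v] lim[OF cont_c2] lim[OF cont_H] ends x_seg by blast+
  have Hd: "Hd \<longlonglongrightarrow> H Q"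
  proof -
    have "Hd \<longlonglongrightarrow> (1 / 2) *\<^sub>R (H Q + H Q)"
      unfolding Hd_def by (intro tendsto_intros vc)
    then show ?thesis by (simp flip: scaleR_2)
  qed
  \<comment> \<open>The difference quotient of \<open>H\<close> need not converge.
    \<open>averaged_equation\<close> trades it for first difference quotients, after which every
    term has a limit at \<open>Q\<close>.\<close>
  have N_eq: "N (x n) (h n) =
      - (\<gamma> - 1) * (ell (c2 (a n)) (v (a n)) (H (x n)) + ell (c2 (b n)) (v (b n)) (H (x n)))
      + 2 * (\<gamma> + 1) * (2 * \<delta>c n - (v (a n) + v (b n)) \<bullet> \<delta>w n + \<delta>c n * trace2 (Hd n)
          - (1/2) * ((v (a n) + v (b n)) \<bullet> Hd n (\<delta>w n) + \<delta>w n \<bullet> Hd n (v (a n) + v (b n))))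
      - \<gamma> / q * (c2 (a n) * q - (perp W \<bullet> v (a n))\<^sup>2 + (c2 (b n) * q - (perp W \<bullet> v (b n))\<^sup>2))
      + (1 / 2) * (2 * c2 (a n) - v (a n) \<bullet> v (a n) + (2 * c2 (b n) - v (b n) \<bullet> v (b n)))" for n
  proof -
    have ab\<Omega>: "a n \<in> \<Omega>" "b n \<in> \<Omega>" using seg ends by blast+
    have "(1 / (2 * h n)) * ((c2 (a n) + c2 (b n)) * (trace2 (H (a n)) - trace2 (H (b n)))
        - v (a n) \<bullet> (H (a n) (v (a n)) - H (b n) (v (a n))) - v (b n) \<bullet> (H (a n) (v (b n)) - H (b n) (v (b n))))
      = - 2 * (2 * \<delta>c n - (v (a n) + v (b n)) \<bullet> \<delta>w n + \<delta>c n * trace2 (Hd n)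
          - (1/2) * ((v (a n) + v (b n)) \<bullet> Hd n (\<delta>w n) + \<delta>w n \<bullet> Hd n (v (a n) + v (b n))))"
      by (rule averaged_equation[OF _ flow[OF ab\<Omega>(1) c2_pos[OF ab\<Omega>(1)]] flow[OF ab\<Omega>(2) c2_pos[OF ab\<Omega>(2)]]])
        (use h[of n] in \<open>simp_all add: \<delta>c_def \<delta>w_def Hd_def\<close>)
    moreover have "(c2 (a n) + c2 (b n)) * (trace2 (H (a n)) - trace2 (H (b n)))
        - v (a n) \<bullet> (H (a n) (v (a n)) - H (b n) (v (a n))) - v (b n) \<bullet> (H (a n) (v (b n)) - H (b n) (v (b n)))
      = ell (c2 (a n)) (v (a n)) (H (a n)) - ell (c2 (a n)) (v (a n)) (H (b n))
        + (ell (c2 (b n)) (v (b n)) (H (a n)) - ell (c2 (b n)) (v (b n)) (H (b n)))"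
      by (simp add: ell_def inner_diff_right algebra_simps)
    ultimately have key: "(1 / (2 * h n)) * (ell (c2 (a n)) (v (a n)) (H (a n)) - ell (c2 (a n)) (v (a n)) (H (b n))) +
        (1 / (2 * h n)) * (ell (c2 (b n)) (v (b n)) (H (a n)) - ell (c2 (b n)) (v (b n)) (H (b n)))
      = - 2 * (2 * \<delta>c n - (v (a n) + v (b n)) \<bullet> \<delta>w n + \<delta>c n * trace2 (Hd n)
          - (1/2) * ((v (a n) + v (b n)) \<bullet> Hd n (\<delta>w n) + \<delta>w n \<bullet> Hd n (v (a n) + v (b n))))"
      by (simp only: distrib_left)
    have "N (x n) (h n) =
      - (\<gamma> - 1) * (ell (c2 (a n)) (v (a n)) (H (x n)) + ell (c2 (b n)) (v (b n)) (H (x n)))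
      - (\<gamma> + 1) * ((1 / (2 * h n)) * (ell (c2 (a n)) (v (a n)) (H (a n)) - ell (c2 (a n)) (v (a n)) (H (b n))) +
        (1 / (2 * h n)) * (ell (c2 (b n)) (v (b n)) (H (a n)) - ell (c2 (b n)) (v (b n)) (H (b n))))
      - \<gamma> / q * (c2 (a n) * q - (perp W \<bullet> v (a n))\<^sup>2 + (c2 (b n) * q - (perp W \<bullet> v (b n))\<^sup>2))
      + (1 / 2) * (2 * c2 (a n) - v (a n) \<bullet> v (a n) + (2 * c2 (b n) - v (b n) \<bullet> v (b n)))"
      unfolding N_def ell_hess a_def[symmetric] b_def[symmetric] distrib_left by simp
    moreover have "A - k * (- 2 * B) - C + D = A + 2 * k * B - C + D" for A B C D k :: real by simp
    ultimately show ?thesis unfolding key by (simp only:)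
  qed
  define m where "m = \<mu>"
  note H_m = H_W[folded m_def]
  have WHW: "W \<bullet> H Q W = - m * q" by (simp add: H_m sonic_Q)
  have tr: "trace2 (H Q) = - m - 1"
  proof -
    have "q * trace2 (H Q) = - m * q - q"
      using trace2_perp[OF bounded_linear.linear[OF blinfun.bounded_linear_right], of W "H Q"]
      by (simp only: WHW H_perp_W sonic_Q inner_minus_right inner_perp; simp)
    then have "q * trace2 (H Q) = q * (- m - 1)" by (simp only: right_diff_distrib; simp)
    then show ?thesis by (rule mult_left_cancel[THEN iffD1, rotated]) (use c2_Q_pos in simp)
  qed
  let ?lim = "- (\<gamma> - 1) * (ell q W (H Q) + ell q W (H Q))
      + 2 * (\<gamma> + 1) * (2 * (c2_grad Q \<bullet> W) - (W + W) \<bullet> (- m *\<^sub>R W) + (c2_grad Q \<bullet> W) * trace2 (H Q)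
          - (1/2) * ((W + W) \<bullet> H Q (- m *\<^sub>R W) + (- m *\<^sub>R W) \<bullet> H Q (W + W)))
      - \<gamma> / q * (q * q - (perp W \<bullet> W)\<^sup>2 + (q * q - (perp W \<bullet> W)\<^sup>2))
      + (1 / 2) * (2 * q - W \<bullet> W + (2 * q - W \<bullet> W))"
  have "(\<lambda>n. N (x n) (h n)) \<longlonglongrightarrow> ?lim"
    unfolding N_eq ell_def trace2_def
    by (intro tendsto_intros blinfun.tendsto vc \<delta>c \<delta>w[folded m_def] Hd)
  \<comment> \<open>The four lines contribute \<open>2 * (\<gamma> - 1) * q\<close>,
    \<open>0\<close>, \<open>- 2 * \<gamma> * q\<close> and \<open>q\<close>.\<close>
  moreover have "?lim = - q"
  proof -
    have e1: "ell q W (H Q) = - q" by (simp add: ell_def tr WHW algebra_simps)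
    have e2: "c2_grad Q \<bullet> W = - 2 * m * q"
    proof -
      have "c2_grad Q \<bullet> W = - ((\<gamma> - 1) * (q + - m * q))"
        by (simp only: inner_minus_left inner_scaleR_left inner_add_left sonic_Q inner_commute[of "H Q W"] WHW)
      also have "\<dots> = - 2 * m * q" using gamma by (simp add: m_def field_simps)
      finally show ?thesis .
    qed
    have e3: "(W + W) \<bullet> (- m *\<^sub>R W) = - 2 * m * q" by (simp add: inner_add_left sonic_Q)
    have e4: "(W + W) \<bullet> H Q (- m *\<^sub>R W) = 2 * m * m * q"
      by (simp only: inner_add_left blinfun.scaleR_right inner_scaleR_right WHW; simp)
    have e5: "(- m *\<^sub>R W) \<bullet> H Q (W + W) = 2 * m * m * q"
      by (simp only: inner_scaleR_left blinfun.add_right inner_add_right WHW; simp)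
    have e6: "\<gamma> / q * (q * q - (perp W \<bullet> W)\<^sup>2 + (q * q - (perp W \<bullet> W)\<^sup>2)) = 2 * \<gamma> * q"
      using c2_Q_pos by simp
    have big: "2 * (- 2 * m * q) - - 2 * m * q + (- 2 * m * q) * (- m - 1) - (1/2) * (2 * m * m * q + 2 * m * m * q) = 0" 
      by (simp add: algebra_simps)
    show ?thesis
      unfolding e1 e2 e3 e4 e5 e6 tr big by (simp add: sonic_Q algebra_simps)
  qed
  ultimately have "(\<lambda>n. N (x n) (h n)) \<longlonglongrightarrow> - q" by (simp only:)
  then have "0 \<le> - q" by (rule LIMSEQ_le_const) (use N in auto)
  then show False using c2_Q_pos by simp
qed

end

section \<open>The barrier argument\<close>

context degenerate_sonic_point
begin

text \<open>For positive \<open>C\<close> this is positive exactly in the disk with centre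
  \<open>Q + inner_normal / (2 C)\<close> whose boundary circle passes through \<open>Q\<close>.
  After division by \<open>4 * C\<close> its Hessian is minus half the identity, whatever
  \<open>C\<close> is.\<close>

definition "barrier C x = inner_normal \<bullet> (x - Q) - C * (norm (x - Q))\<^sup>2"

text \<open>\<open>Z\<close> with its only first-derivative term replaced by a difference quotient,
  so that second derivatives exist. Writing \<open>(- h)\<close> makes both points translates of
  \<open>x\<close>, as the shift rule expects.\<close>

definition "Zh h x = (\<gamma> - 1) * (K - \<phi> x)
    - (\<gamma> + 1) / (2 * h) * (\<phi> (x + h *\<^sub>R W) - \<phi> (x + (- h) *\<^sub>R W)) + (\<gamma> + 1) / 2 * q
    - \<gamma> / (2 * q) * (perp W \<bullet> (x - Q))\<^sup>2"

lemma cont_barrier: "continuous_on S (barrier C)"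
  unfolding barrier_def by (intro continuous_intros)

lemma grad_barrier: "GDERIV (barrier C) x :> inner_normal - (2 * C) *\<^sub>R (x - Q)"
proof -
  have "barrier C = (\<lambda>x. inner_normal \<bullet> (x - Q) - C * ((x - Q) \<bullet> (x - Q)))"
    by (simp add: barrier_def fun_eq_iff power2_norm_eq_inner)
  moreover have "GDERIV (\<lambda>x. inner_normal \<bullet> (x - Q) - C * ((x - Q) \<bullet> (x - Q))) x :> inner_normal - (2 * C) *\<^sub>R (x - Q)"
    unfolding gderiv_def
    by (auto intro!: derivative_eq_intros simp: fun_eq_iff inner_diff_right inner_commute algebra_simps)
  ultimately show ?thesis by simp
qed

lemma grad_Zh:
  assumes "x \<in> \<Omega>" "x + h *\<^sub>R W \<in> \<Omega>" "x + (- h) *\<^sub>R W \<in> \<Omega>"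
  shows "GDERIV (Zh h) x :> - (\<gamma> - 1) *\<^sub>R v x - ((\<gamma> + 1) / (2 * h)) *\<^sub>R (v (x + h *\<^sub>R W) - v (x + (- h) *\<^sub>R W))
    - (\<gamma> / q * (perp W \<bullet> (x - Q))) *\<^sub>R perp W"
proof -
  have sh: "((\<lambda>x. \<phi> (x + a)) has_derivative (\<lambda>u. u \<bullet> v (x + a))) (at x)" if "x + a \<in> \<Omega>" for a
    using GDERIV_shift[OF grad_\<phi>[OF that]] by (simp add: gderiv_def)
  show ?thesis
    unfolding gderiv_def Zh_def
    by (rule derivative_eq_intros grad_\<phi>[OF assms(1), unfolded gderiv_def] sh[OF assms(2)] sh[OF assms(3)] refl)+
      (simp add: fun_eq_iff inner_diff_right inner_add_right inner_commute algebra_simps)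
qed

text \<open>The difference quotient equals \<open>W \<bullet> v z\<close> at an intermediate point,
  so \<open>Zh\<close> differs from \<open>Z\<close> by no more than the oscillation of
  \<open>W \<bullet> v\<close> along the segment.\<close>

lemma Zh_increment:
  assumes "0 < h" "closed_segment (x - h *\<^sub>R W) (x + h *\<^sub>R W) \<subseteq> \<Omega>"
  obtains z where "z \<in> closed_segment (x - h *\<^sub>R W) (x + h *\<^sub>R W)"
    "Zh h x = Z x + (\<gamma> + 1) * (W \<bullet> v x - W \<bullet> v z)"
proof -
  have "W \<noteq> 0" using c2_Q_pos sonic_Q by auto
  have d: "x + h *\<^sub>R W - (x - h *\<^sub>R W) = (2 * h) *\<^sub>R W"
    unfolding mult_2 scaleR_add_left by simp
  have ne: "x - h *\<^sub>R W \<noteq> x + h *\<^sub>R W"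
  proof
    assume "x - h *\<^sub>R W = x + h *\<^sub>R W"
    then have "(2 * h) *\<^sub>R W = 0" unfolding d[symmetric] by (simp only: diff_self)
    then show False using assms(1) \<open>W \<noteq> 0\<close> by simp
  qed
  have cont: "continuous_on (closed_segment (x - h *\<^sub>R W) (x + h *\<^sub>R W)) \<phi>"
    using continuous_on_subset[OF cont_\<phi>] assms(2) \<Omega>_A by blast
  obtain z where z: "z \<in> open_segment (x - h *\<^sub>R W) (x + h *\<^sub>R W)"
    "\<phi> (x + h *\<^sub>R W) - \<phi> (x - h *\<^sub>R W) = v z \<bullet> (x + h *\<^sub>R W - (x - h *\<^sub>R W))"
    by (rule gradient_mvt[OF ne cont, where p = v]) (use assms(2) grad_\<phi> segment_open_subset_closed in blast)+
  have "(\<gamma> + 1) / (2 * h) * (\<phi> (x + h *\<^sub>R W) - \<phi> (x + (- h) *\<^sub>R W)) = (\<gamma> + 1) * (W \<bullet> v z)"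
    using z(2) assms(1) by (simp add: d inner_commute[of W])
  then have "Zh h x = Z x + (\<gamma> + 1) * (W \<bullet> v x - W \<bullet> v z)"
    unfolding Zh_def Z_def by (simp add: right_diff_distrib)
  then show thesis using that z(1) segment_open_subset_closed by blast
qed

text \<open>At a minimum \<open>hess x h\<close> is positive semidefinite. At both shifted points
  the flow is subsonic, so each of the two frozen operators is elliptic and yields a nonnegative
  value.\<close>

lemma no_interior_minimum:
  assumes "0 < h" and C: "0 < C" and S: "open S" "x \<in> S"
    and seg: "\<And>y. y \<in> S \<Longrightarrow> y \<in> \<Omega> \<and> y + h *\<^sub>R W \<in> \<Omega> \<and> y - h *\<^sub>R W \<in> \<Omega>"
    and min: "\<And>y. y \<in> S \<Longrightarrow> Zh h x - 1 / (4 * C) * barrier C x \<le> Zh h y - 1 / (4 * C) * barrier C y"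
  shows "0 \<le> ell (c2 (x + h *\<^sub>R W)) (v (x + h *\<^sub>R W)) (hess x h) + ell (c2 (x - h *\<^sub>R W)) (v (x - h *\<^sub>R W)) (hess x h)"
proof -
  define P where "P y = - (\<gamma> - 1) *\<^sub>R v y - ((\<gamma> + 1) / (2 * h)) *\<^sub>R (v (y + h *\<^sub>R W) - v (y + (- h) *\<^sub>R W))
    - (\<gamma> / q * (perp W \<bullet> (y - Q))) *\<^sub>R perp W - (1 / (4 * C)) *\<^sub>R (inner_normal - (2 * C) *\<^sub>R (y - Q))" for y
  have P: "GDERIV (\<lambda>y. Zh h y - 1 / (4 * C) * barrier C y) y :> P y" if "y \<in> S" for y
    unfolding P_def
    by (rule GDERIV_subst[OF GDERIV_diff[OF grad_Zh GDERIV_mult[OF GDERIV_const grad_barrier]]])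
      (use seg[OF that] in simp_all)
  have shift: "((\<lambda>y. v (y + a)) has_derivative H (x + a)) (at x)" if "x + a \<in> \<Omega>" for a
    by (rule has_derivative_compose[of "\<lambda>y. y + a" "\<lambda>h. h" x UNIV v, simplified])
      (auto intro!: derivative_eq_intros deriv_v that)
  have x: "x \<in> \<Omega>" "x + h *\<^sub>R W \<in> \<Omega>" "x + (- h) *\<^sub>R W \<in> \<Omega>"
    using seg[OF S(2)] by simp_all
  have B: "(P has_derivative hess x h) (at x)"
    unfolding P_def
    by (rule derivative_eq_intros deriv_v[OF x(1)] shift[OF x(2)] shift[OF x(3)] refl)+
      (use C in \<open>simp add: hess_def fun_eq_iff\<close>)
  have "linear (hess x h)" by (rule has_derivative_linear[OF B])
  moreover have "0 \<le> d \<bullet> hess x h d" for d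
    by (rule gradient_second_derivative_nonneg_at_min[OF S min P B])
  ultimately have "0 \<le> ell (c2 y) (v y) (hess x h)" if "y \<in> \<Omega>" for y
    unfolding ell_def using elliptic_nonneg subsonic[OF that] by (simp add: less_imp_le)
  then show ?thesis using seg[OF S(2)] by (simp add: add_nonneg_nonneg)
qed

text \<open>A comparison argument in the disk where the barrier is positive: a negative minimum of
  the difference would be interior, contrary to \<open>hess_neg\<close>. It is run on compact
  superlevel sets, where \<open>Zh\<close> approximates \<open>Z\<close> uniformly.\<close>

lemma Z_ge_barrier:
  obtains C where "0 < C" "\<And>x. 0 < barrier C x \<Longrightarrow> 1 / (4 * C) * barrier C x \<le> Z x"
proof -
  obtain \<rho>1 where \<rho>1: "0 < \<rho>1" "\<rho>1 \<le> r"
    "\<And>x. L * (norm (x - Q))\<^sup>2 < inner_normal \<bullet> (x - Q) \<Longrightarrow> norm (x - Q) < \<rho>1 \<Longrightarrow> 0 < Z x"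
    by (rule Z_pos) blast
  obtain \<rho>2 where \<rho>2: "0 < \<rho>2"
    "\<And>x h. 0 < h \<Longrightarrow> closed_segment (x - h *\<^sub>R W) (x + h *\<^sub>R W) \<subseteq> \<Omega> \<inter> ball Q \<rho>2 \<Longrightarrow>
      ell (c2 (x + h *\<^sub>R W)) (v (x + h *\<^sub>R W)) (hess x h) + ell (c2 (x - h *\<^sub>R W)) (v (x - h *\<^sub>R W)) (hess x h) < 0"
    by (rule hess_neg) blast
  define \<rho> where "\<rho> = min \<rho>1 \<rho>2"
  \<comment> \<open>Large enough that the disk lies within \<open>\<rho>\<close> of \<open>Q\<close>
    and inside the disk belonging to \<open>L\<close>.\<close>
  define C where "C = L + 2 * (norm inner_normal + 1) / \<rho>"
  have \<rho>: "0 < \<rho>" "\<rho> \<le> \<rho>1" "\<rho> \<le> \<rho>2" using \<rho>1 \<rho>2 by (auto simp: \<rho>_def)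
  have C: "0 < C" "L \<le> C" "norm inner_normal < C * \<rho>"
  proof -
    have pos: "0 < 2 * (norm inner_normal + 1) / \<rho>" using \<rho>(1) by (intro divide_pos_pos) (auto intro: add_nonneg_pos)
    then show "0 < C" "L \<le> C" using L_nonneg by (simp_all add: C_def)
    have "C * \<rho> = L * \<rho> + 2 * (norm inner_normal + 1)" using \<rho>(1) by (simp add: C_def field_simps)
    moreover have "0 \<le> L * \<rho>" using L_nonneg \<rho>(1) by simp
    moreover have "0 < norm inner_normal + 2" by (rule add_nonneg_pos) auto
    ultimately show "norm inner_normal < C * \<rho>" by simp
  qed
  define D where "D = {x. 0 < barrier C x}"
  have "open D"
    unfolding D_def using cont_barrier[of UNIV C] by (intro open_Collect_less) auto
  have D_norm: "norm (x - Q) < \<rho>" if "x \<in> D" for x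
  proof (rule ccontr)
    assume "\<not> norm (x - Q) < \<rho>"
    then have "C * \<rho> * norm (x - Q) \<le> C * norm (x - Q) * norm (x - Q)"
      using C(1) by (intro mult_right_mono mult_left_mono) auto
    moreover have "inner_normal \<bullet> (x - Q) \<le> norm inner_normal * norm (x - Q)" by (rule norm_cauchy_schwarz)
    moreover have "norm inner_normal * norm (x - Q) \<le> C * \<rho> * norm (x - Q)"
      using C(3) by (intro mult_right_mono) auto
    ultimately show False using that by (simp add: D_def barrier_def power2_eq_square mult.assoc)
  qed
  have D_L: "L * (norm (x - Q))\<^sup>2 < inner_normal \<bullet> (x - Q)" if "x \<in> D" for x
  proof -
    have "L * (norm (x - Q))\<^sup>2 \<le> C * (norm (x - Q))\<^sup>2" using C(2) by (rule mult_right_mono) simp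
    then show ?thesis using that by (simp add: D_def barrier_def)
  qed
  have D_\<Omega>: "D \<subseteq> \<Omega>"
  proof
    fix x assume "x \<in> D"
    then show "x \<in> \<Omega>" using D_L D_norm[of x] \<rho>(2) \<rho>1(2) by (intro disk_subset) auto
  qed
  have Z_D: "0 < Z x" if "x \<in> D" for x
    using \<rho>1(3)[OF D_L[OF that]] D_norm[OF that] \<rho>(2) by simp
  \<comment> \<open>Here \<open>\<sigma>\<close> is a positive level of the barrier and hides the
    sign of the locale. The set where the barrier is at least \<open>\<sigma>\<close> avoids
    \<open>Q\<close>, leaving room for the shifts by \<open>h\<close>.\<close>
  have shifted: "1 / (4 * C) * (barrier C x0 - \<sigma>) \<le> Z x0" if \<sigma>: "0 < \<sigma>" "\<sigma> \<le> barrier C x0" for \<sigma> x0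
  proof (rule ccontr)
    assume "\<not> 1 / (4 * C) * (barrier C x0 - \<sigma>) \<le> Z x0"
    define M where "M = {x. \<sigma> \<le> barrier C x}"
    have "M \<subseteq> D" using \<sigma> by (auto simp: M_def D_def)
    have "x0 \<in> M" using \<sigma> by (simp add: M_def)
    have "M \<subseteq> ball Q \<rho>"
      using D_norm \<open>M \<subseteq> D\<close> by (auto simp: dist_norm norm_minus_commute subset_iff)
    then have "bounded M" using bounded_subset bounded_ball by blast
    moreover have "closed M"
      unfolding M_def using cont_barrier[of UNIV C] by (intro closed_Collect_le) auto
    ultimately have "compact M" by (simp add: compact_eq_bounded_closed)
    obtain \<epsilon> where \<epsilon>: "0 < \<epsilon>" "(\<Union>x\<in>M. cball x \<epsilon>) \<subseteq> D"
      by (rule compact_subset_open_imp_cball_epsilon_subset[OF \<open>compact M\<close> \<open>open D\<close> \<open>M \<subseteq> D\<close>])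
    define M' where "M' = {x + y |x y. x \<in> M \<and> y \<in> cball 0 \<epsilon>}"
    have "compact M'" unfolding M'_def by (rule compact_sums[OF \<open>compact M\<close> compact_cball])
    have near_M': "z \<in> M'" if "x \<in> M" "dist z x \<le> \<epsilon>" for x z
    proof -
      have "z = x + (z - x)" "z - x \<in> cball 0 \<epsilon>" using that(2) by (simp_all add: dist_norm norm_minus_commute)
      then show ?thesis using that(1) unfolding M'_def by blast
    qed
    have "M' \<subseteq> D"
    proof
      fix w assume "w \<in> M'"
      then obtain x y where "x \<in> M" "w = x + y" "norm y \<le> \<epsilon>" by (auto simp: M'_def)
      then have "w \<in> cball x \<epsilon>" by (simp add: dist_norm)
      then show "w \<in> D" using \<epsilon>(2) \<open>x \<in> M\<close> by blast
    qed
    have M'_A: "M' \<subseteq> A" using \<open>M' \<subseteq> D\<close> D_\<Omega> \<Omega>_A by blast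
    have cont_M: "continuous_on M Z"
      using continuous_on_subset[OF cont_Z] \<open>M \<subseteq> D\<close> D_\<Omega> \<Omega>_A by blast
    obtain xm where xm: "xm \<in> M" "\<And>y. y \<in> M \<Longrightarrow> Z xm \<le> Z y"
      using continuous_attains_inf[OF \<open>compact M\<close> _ cont_M] \<open>x0 \<in> M\<close> by blast
    \<comment> \<open>If \<open>Zh\<close> is within \<open>\<zeta>\<close> of \<open>Z\<close>, it
      stays positive on \<open>M\<close>, as \<open>Z xm\<close> is the minimum of \<open>Z\<close>
      there, and the violation assumed at \<open>x0\<close> persists for \<open>Zh\<close>.\<close>
    define \<zeta> where "\<zeta> = min (Z xm) (1 / (4 * C) * (barrier C x0 - \<sigma>) - Z x0)"
    have "0 < \<zeta>"
      using Z_D[OF subsetD[OF \<open>M \<subseteq> D\<close> xm(1)]] \<open>\<not> 1 / (4 * C) * (barrier C x0 - \<sigma>) \<le> Z x0\<close> by (auto simp: \<zeta>_def not_le)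
    have "uniformly_continuous_on M' (\<lambda>x. W \<bullet> v x)"
      by (rule compact_uniformly_continuous[OF _ \<open>compact M'\<close>])
        (intro continuous_intros continuous_on_subset[OF cont_v M'_A])
    moreover have "0 < \<zeta> / (\<gamma> + 1)" using \<open>0 < \<zeta>\<close> gamma by simp
    ultimately obtain \<delta> where \<delta>: "0 < \<delta>"
      "\<And>x z. x \<in> M' \<Longrightarrow> z \<in> M' \<Longrightarrow> dist z x < \<delta> \<Longrightarrow> dist (W \<bullet> v z) (W \<bullet> v x) < \<zeta> / (\<gamma> + 1)"
      unfolding uniformly_continuous_on_def by blast
    \<comment> \<open>Shifts by at most \<open>\<epsilon>\<close> keep the segments in
      \<open>M'\<close>; shifts below \<open>\<delta>\<close> make the uniform continuity
      applicable.\<close>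
    define h where "h = min \<epsilon> (\<delta> / 2) / (norm W + 1)"
    have W1: "0 < norm W + 1" by (rule add_nonneg_pos) auto
    have "0 < h" using \<epsilon>(1) \<delta>(1) W1 by (simp add: h_def)
    have "h * norm W \<le> h * (norm W + 1)" using \<open>0 < h\<close> by (intro mult_left_mono) auto
    also have "\<dots> = min \<epsilon> (\<delta> / 2)" using W1 by (simp add: h_def)
    finally have hW: "h * norm W \<le> \<epsilon>" "h * norm W < \<delta>" using \<delta>(1) by auto
    have seg: "z \<in> M' \<and> dist z x < \<delta>"
      if "x \<in> M" "z \<in> closed_segment (x - h *\<^sub>R W) (x + h *\<^sub>R W)" for x z
    proof -
      have "closed_segment (x - h *\<^sub>R W) (x + h *\<^sub>R W) \<subseteq> cball x (h * norm W)"
        using \<open>0 < h\<close> by (intro closed_segment_subset) (auto simp: dist_norm)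
      then have "dist z x \<le> h * norm W" using that(2) by (auto simp: dist_commute)
      then show ?thesis using near_M'[OF that(1)] hW by auto
    qed
    have seg_\<Omega>: "closed_segment (x - h *\<^sub>R W) (x + h *\<^sub>R W) \<subseteq> \<Omega> \<inter> ball Q \<rho>2" if "x \<in> M" for x
    proof
      fix z assume "z \<in> closed_segment (x - h *\<^sub>R W) (x + h *\<^sub>R W)"
      then have "z \<in> D" using seg[OF that] \<open>M' \<subseteq> D\<close> by blast
      then show "z \<in> \<Omega> \<inter> ball Q \<rho>2"
        using D_\<Omega> D_norm[of z] \<rho>(3) by (auto simp: dist_norm norm_minus_commute)
    qed
    have close: "\<bar>Zh h x - Z x\<bar> < \<zeta>" if xM: "x \<in> M" for x
    proof -
      obtain z where z: "z \<in> closed_segment (x - h *\<^sub>R W) (x + h *\<^sub>R W)"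
        "Zh h x = Z x + (\<gamma> + 1) * (W \<bullet> v x - W \<bullet> v z)"
        using Zh_increment[OF \<open>0 < h\<close>] seg_\<Omega>[OF xM] by blast
      have "x \<in> M'" using near_M'[OF xM, of x] \<epsilon>(1) by simp
      then have "\<bar>W \<bullet> v x - W \<bullet> v z\<bar> < \<zeta> / (\<gamma> + 1)"
        using \<delta>(2)[of x z] seg[OF xM z(1)] by (simp add: dist_real_def abs_minus_commute)
      then show ?thesis using z(2) gamma by (simp add: abs_mult pos_less_divide_eq mult.commute)
    qed
    define G where "G x = Zh h x - 1 / (4 * C) * barrier C x" for x
    have ends: "x + h *\<^sub>R W \<in> \<Omega>" "x - h *\<^sub>R W \<in> \<Omega>" if "x \<in> M" for x
      using seg_\<Omega>[OF that] by auto
    have "continuous_on M (Zh h)"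
      unfolding Zh_def
      by (intro continuous_intros continuous_on_compose2[OF cont_\<phi>]) (use ends \<open>M \<subseteq> D\<close> D_\<Omega> \<Omega>_A in auto)
    then have "continuous_on M G"
      unfolding G_def by (intro continuous_intros cont_barrier)
    then obtain x1 where x1: "x1 \<in> M" "\<And>y. y \<in> M \<Longrightarrow> G x1 \<le> G y"
      using continuous_attains_inf[OF \<open>compact M\<close>] \<open>x0 \<in> M\<close> by blast
    have "G x0 + 1 / (4 * C) * \<sigma> < 0"
    proof -
      have "\<bar>Zh h x0 - Z x0\<bar> < 1 / (4 * C) * (barrier C x0 - \<sigma>) - Z x0"
        using close[OF \<open>x0 \<in> M\<close>] unfolding \<zeta>_def by linarith
      then show ?thesis
        using abs_ge_self[of "Zh h x0 - Z x0"] unfolding G_def right_diff_distrib by linarith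
    qed
    then have "G x1 + 1 / (4 * C) * \<sigma> < 0" using x1(2)[OF \<open>x0 \<in> M\<close>] by linarith
    moreover have "0 < Zh h x1"
      using close[OF x1(1)] xm(2)[OF x1(1)] abs_ge_minus_self[of "Zh h x1 - Z x1"] unfolding \<zeta>_def by linarith
    \<comment> \<open>Where the barrier equals \<open>\<sigma>\<close>, positivity of
      \<open>Zh\<close> would put \<open>G\<close> above \<open>- \<sigma> / (4 C)\<close>. The
      minimum is lower, hence attained in the open set.\<close>
    ultimately have "1 / (4 * C) * \<sigma> < 1 / (4 * C) * barrier C x1" unfolding G_def by linarith
    then have "\<sigma> < barrier C x1"
      by (rule mult_less_cancel_left_pos[THEN iffD1, rotated]) (use C(1) in simp)
    define S where "S = {x. \<sigma> < barrier C x}"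
    have "S \<subseteq> M" by (auto simp: S_def M_def)
    have "0 \<le> ell (c2 (x1 + h *\<^sub>R W)) (v (x1 + h *\<^sub>R W)) (hess x1 h) + ell (c2 (x1 - h *\<^sub>R W)) (v (x1 - h *\<^sub>R W)) (hess x1 h)"
    proof (rule no_interior_minimum[OF \<open>0 < h\<close> C(1)])
      show "open S"
        unfolding S_def using cont_barrier[of UNIV C] by (intro open_Collect_less) auto
      show "x1 \<in> S" using \<open>\<sigma> < barrier C x1\<close> by (simp add: S_def)
      fix y assume "y \<in> S"
      then have "y \<in> M" using \<open>S \<subseteq> M\<close> by blast
      then show "y \<in> \<Omega> \<and> y + h *\<^sub>R W \<in> \<Omega> \<and> y - h *\<^sub>R W \<in> \<Omega>"
        using ends \<open>M \<subseteq> D\<close> D_\<Omega> by blast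
      show "Zh h x1 - 1 / (4 * C) * barrier C x1 \<le> Zh h y - 1 / (4 * C) * barrier C y"
        using x1(2)[OF \<open>y \<in> M\<close>] by (simp add: G_def)
    qed
    moreover have "ell (c2 (x1 + h *\<^sub>R W)) (v (x1 + h *\<^sub>R W)) (hess x1 h) + ell (c2 (x1 - h *\<^sub>R W)) (v (x1 - h *\<^sub>R W)) (hess x1 h) < 0"
      by (rule \<rho>2(2)[OF \<open>0 < h\<close> seg_\<Omega>[OF x1(1)]])
    ultimately show False by linarith
  qed
  have "1 / (4 * C) * barrier C x \<le> Z x" if "0 < barrier C x" for x
  proof (rule ccontr)
    define T where "T = 4 * C * Z x"
    assume "\<not> 1 / (4 * C) * barrier C x \<le> Z x"
    then have T: "T < barrier C x" using C(1) by (simp add: T_def field_simps)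
    have "0 < T" using Z_D that C(1) by (simp add: T_def D_def)
    \<comment> \<open>The shift is half the gap between \<open>barrier C x\<close> and
      \<open>4 * C * Z x\<close>, small enough to preserve the violation.\<close>
    have "1 / (4 * C) * (barrier C x - (barrier C x - T) / 2) \<le> Z x"
      by (rule shifted) (use T \<open>0 < T\<close> in auto)
    then have "barrier C x - (barrier C x - T) / 2 \<le> T" using C(1) by (simp add: T_def field_simps)
    then show False using T by (simp add: field_simps)
  qed
  then show thesis using that C(1) by blast
qed

text \<open>The barrier grows linearly along \<open>inner_normal\<close>, so \<open>Z\<close> has a
  positive derivative at \<open>Q\<close> in that direction, whereas its gradient there is
  zero.\<close>

lemma no_degenerate_sonic_point: False
proof -
  obtain C where C: "0 < C" "\<And>x. 0 < barrier C x \<Longrightarrow> 1 / (4 * C) * barrier C x \<le> Z x"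
    by (rule Z_ge_barrier) blast
  define N where "N = inner_normal \<bullet> inner_normal"
  have N: "0 < N" unfolding N_def inner_normal_squared by (simp add: add_pos_nonneg)
  have lim: "((\<lambda>t. (Z (Q + t *\<^sub>R inner_normal) - Z Q) / t) \<longlongrightarrow> Z_grad Q \<bullet> inner_normal) (at_right 0)"
    by (rule one_sided_derivative[OF cont_Z cont_Z_grad grad_Z]) (use N in \<open>simp_all add: N_def\<close>)
  have lim': "((\<lambda>t. 1 / (4 * C) * (N * (1 - C * t))) \<longlongrightarrow> 1 / (4 * C) * (N * (1 - C * 0))) (at_right 0)"
    by (intro tendsto_intros)
  have ev: "\<forall>\<^sub>F t in at_right 0. 0 < t \<and> t < 1 / C"
    unfolding eventually_at_right_field using C(1) by (intro exI[of _ "1 / C"]) auto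
  have "1 / (4 * C) * (N * (1 - C * 0)) \<le> Z_grad Q \<bullet> inner_normal"
  proof (rule tendsto_le[OF _ lim lim'])
    show "\<forall>\<^sub>F t in at_right 0. 1 / (4 * C) * (N * (1 - C * t)) \<le> (Z (Q + t *\<^sub>R inner_normal) - Z Q) / t"
    proof (rule eventually_mono[OF ev])
      fix t assume t: "0 < t \<and> t < 1 / C"
      have b: "barrier C (Q + t *\<^sub>R inner_normal) = t * (N * (1 - C * t))"
        by (simp add: barrier_def N_def power_mult_distrib power2_norm_eq_inner) (simp add: power2_eq_square algebra_simps)
      have "0 < 1 - C * t" using t C(1) by (simp add: pos_less_divide_eq mult.commute)
      then have "0 < t * (N * (1 - C * t))" using t N by simp
      then have "1 / (4 * C) * (t * (N * (1 - C * t))) \<le> Z (Q + t *\<^sub>R inner_normal)"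
        using C(2)[of "Q + t *\<^sub>R inner_normal"] unfolding b by simp
      then show "1 / (4 * C) * (N * (1 - C * t)) \<le> (Z (Q + t *\<^sub>R inner_normal) - Z Q) / t"
        using t by (simp add: Z_Q pos_le_divide_eq ac_simps)
    qed
  qed simp
  then show False using N C(1) by (simp add: Z_grad_Q divide_le_0_iff)
qed

end

section \<open>Graph coordinates and the theorem\<close>

lemma rot_eq: "rot \<theta> x = fst x *\<^sub>R rot \<theta> (1, 0) - snd x *\<^sub>R perp (rot \<theta> (1, 0))"
  by (simp add: rot_def perp_def prod_eq_iff)

lemma rot_unit: "rot \<theta> (1, 0) \<bullet> rot \<theta> (1, 0) = 1"
  by (simp add: rot_def flip: power2_eq_square)

lemma rot_offset:
  "rot \<theta> (\<xi> + a, \<eta> + b) = rot \<theta> (\<xi>, \<eta>) + a *\<^sub>R rot \<theta> (1, 0) - b *\<^sub>R perp (rot \<theta> (1, 0))"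
  by (simp add: rot_eq[of \<theta> "(\<xi> + a, \<eta> + b)"] rot_eq[of \<theta> "(\<xi>, \<eta>)"] algebra_simps)

lemma rot_neg_components:
  "fst (rot (- \<theta>) w) = w \<bullet> rot \<theta> (1, 0)" "snd (rot (- \<theta>) w) = - (w \<bullet> perp (rot \<theta> (1, 0)))"
  by (simp_all add: rot_def perp_def inner_prod_def)

text \<open>The mean value inequality for \<open>f\<close> minus its linear part, whose derivative
  is at most \<open>L * \<bar>a\<bar>\<close> between the two points.\<close>

lemma C11_taylor:
  assumes "C11 l1 l2 f" "l1 < x" "x < l2"
  obtains L where "0 \<le> L"
    "\<And>a. l1 < x + a \<Longrightarrow> x + a < l2 \<Longrightarrow> \<bar>f (x + a) - f x - deriv f x * a\<bar> \<le> L * a\<^sup>2"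
proof -
  from assms(1) obtain L where diff: "\<And>y. y \<in> {l1<..<l2} \<Longrightarrow> f field_differentiable (at y)"
    and L: "L-lipschitz_on {l1<..<l2} (deriv f)"
    unfolding C11_def by blast
  have "\<bar>f (x + a) - f x - deriv f x * a\<bar> \<le> L * a\<^sup>2" if a: "l1 < x + a" "x + a < l2" for a
  proof -
    define g where "g y = f y - deriv f x * y" for y
    have g: "(g has_derivative (\<lambda>h. (deriv f y - deriv f x) * h)) (at y within {min x (x+a)..max x (x+a)})"
      if "y \<in> {min x (x+a)..max x (x+a)}" for y
    proof -
      have "y \<in> {l1<..<l2}" using that a assms(2,3) by auto
      then have "(f has_real_derivative deriv f y) (at y)"
        using diff field_differentiable_derivI by blast
      then have "(g has_real_derivative deriv f y - deriv f x) (at y)"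
        unfolding g_def by (auto intro!: derivative_eq_intros)
      then show ?thesis
        unfolding has_field_derivative_def by (rule has_derivative_at_withinI)
    qed
    have bd: "onorm (\<lambda>h. (deriv f y - deriv f x) * h) \<le> L * \<bar>a\<bar>"
      if y: "y \<in> {min x (x+a)..max x (x+a)}" for y
    proof (rule onorm_bound)
      show "0 \<le> L * \<bar>a\<bar>" using lipschitz_on_nonneg[OF L] by simp
      fix h
      have "y \<in> {l1<..<l2}" using y a assms(2,3) by auto
      then have "dist (deriv f y) (deriv f x) \<le> L * dist y x"
        using assms(2,3) by (intro lipschitz_onD[OF L]) auto
      also have "\<dots> \<le> L * \<bar>a\<bar>"
        using y lipschitz_on_nonneg[OF L] by (intro mult_left_mono) (auto simp: dist_real_def)
      finally have "\<bar>deriv f y - deriv f x\<bar> \<le> L * \<bar>a\<bar>" by (simp add: dist_real_def)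
      then show "norm ((deriv f y - deriv f x) * h) \<le> L * \<bar>a\<bar> * norm h"
        by (simp add: abs_mult mult_right_mono)
    qed
    have "norm (g (x + a) - g x) \<le> L * \<bar>a\<bar> * norm (x + a - x)"
      by (rule differentiable_bound[OF _ g bd]) auto
    moreover have "L * \<bar>a\<bar> * \<bar>a\<bar> = L * a\<^sup>2" by (simp add: power2_eq_square)
    ultimately show ?thesis by (simp add: g_def algebra_simps power2_eq_square)
  qed
  then show thesis using that lipschitz_on_nonneg[OF L] by blast
qed

text \<open>The two possible orders of the regions above and below the graph are encoded in the sign
  \<open>\<sigma>\<close>, so that the later arguments need no case distinction.\<close>

lemma graph_at_local:
  assumes G: "graph_at \<Omega>m \<Omega>p \<Gamma> Q \<theta> f l1 l2 r" and \<xi>: "l1 < \<xi>" "\<xi> < l2" "Q = rot \<theta> (\<xi>, f \<xi>)"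
  defines "e \<equiv> rot \<theta> (1, 0)" and "F \<equiv> \<lambda>a. f (\<xi> + a) - f \<xi>"
  obtains R L \<sigma> where "0 < R" "0 \<le> L" "\<bar>\<sigma>\<bar> = 1"
    "\<And>a. \<bar>a\<bar> < R \<Longrightarrow> \<bar>F a - deriv f \<xi> * a\<bar> \<le> L * a\<^sup>2"
    "\<And>a. \<bar>a\<bar> < R \<Longrightarrow> Q + a *\<^sub>R e - F a *\<^sub>R perp e \<in> \<Gamma>"
    "\<And>a b. \<bar>a\<bar> < R \<Longrightarrow> \<bar>b\<bar> < R \<Longrightarrow> 0 < \<sigma> * (b - F a) \<Longrightarrow> Q + a *\<^sub>R e - b *\<^sub>R perp e \<in> \<Omega>p"
    "\<And>a b. \<bar>a\<bar> < R \<Longrightarrow> \<bar>b\<bar> < R \<Longrightarrow> 0 < - \<sigma> * (b - F a) \<Longrightarrow> Q + a *\<^sub>R e - b *\<^sub>R perp e \<in> \<Omega>m"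
proof -
  define k where "k = deriv f \<xi>"
  note G' = G[unfolded graph_at_def]
  have r: "0 < r" using G' by (elim conjE)
  have C11: "C11 l1 l2 f" using G' by (elim conjE)
  have \<Gamma>: "\<Gamma> \<inter> ball Q r = rot \<theta> ` {(\<xi>, f \<xi>) |\<xi>. l1 < \<xi> \<and> \<xi> < l2} \<inter> ball Q r"
    using G' by (elim conjE)
  obtain L where L: "0 \<le> L"
    "\<And>a. l1 < \<xi> + a \<Longrightarrow> \<xi> + a < l2 \<Longrightarrow> \<bar>F a - k * a\<bar> \<le> L * a\<^sup>2"
    unfolding F_def k_def using C11_taylor[OF C11 \<xi>(1,2)] by blast
  define M where "M = 2 + \<bar>k\<bar> + L"
  have M: "2 \<le> M" using L(1) by (simp add: M_def)
  \<comment> \<open>The first bounds keep \<open>\<xi> + a\<close> in the interval, \<open>1\<close>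
    gives \<open>a\<^sup>2 \<le> \<bar>a\<bar>\<close>, and \<open>r / M\<close> keeps both the
    curve points and the coordinate square in the ball; for the square, \<open>M\<close> is at least
    \<open>2\<close>.\<close>
  define R where "R = min (min (\<xi> - l1) (l2 - \<xi>)) (min 1 (r / M))"
  have R: "0 < R" "R \<le> 1" "R \<le> r / M" using \<xi> r M by (auto simp: R_def)
  have in_l: "l1 < \<xi> + a" "\<xi> + a < l2" if "\<bar>a\<bar> < R" for a using that by (auto simp: R_def)
  have point: "Q + a *\<^sub>R e - b *\<^sub>R perp e = rot \<theta> (\<xi> + a, f \<xi> + b)" for a b
    unfolding \<xi>(3) e_def rot_offset ..
  have e_norm: "norm e = 1" "norm (perp e) = 1"
    using rot_unit[of \<theta>] by (simp_all add: e_def norm_eq_sqrt_inner)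
  have ball: "Q + a *\<^sub>R e - b *\<^sub>R perp e \<in> ball Q r" if "\<bar>a\<bar> + \<bar>b\<bar> < r" for a b
  proof -
    have "dist Q (Q + a *\<^sub>R e - b *\<^sub>R perp e) = norm (b *\<^sub>R perp e - a *\<^sub>R e)"
      by (simp add: dist_norm algebra_simps)
    also have "\<dots> \<le> \<bar>b\<bar> + \<bar>a\<bar>"
      using norm_triangle_ineq4[of "b *\<^sub>R perp e" "a *\<^sub>R e"] by (simp add: e_norm)
    finally show ?thesis using that by simp
  qed
  have R_M: "x * M < r" if "x < R" for x
    using less_le_trans[OF that R(3)] M by (simp add: pos_less_divide_eq)
  have F_k: "\<bar>F a - k * a\<bar> \<le> L * a\<^sup>2" if "\<bar>a\<bar> < R" for a using L(2) in_l[OF that] by blast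
  have curve: "Q + a *\<^sub>R e - F a *\<^sub>R perp e \<in> \<Gamma>" if a: "\<bar>a\<bar> < R" for a
  proof -
    have "L * a\<^sup>2 \<le> L * \<bar>a\<bar>"
      using a R(2) L(1) mult_left_le_one_le[of "\<bar>a\<bar>" "\<bar>a\<bar>"] by (intro mult_left_mono) (simp_all add: power2_eq_square)
    moreover have "\<bar>F a\<bar> \<le> \<bar>F a - k * a\<bar> + \<bar>k\<bar> * \<bar>a\<bar>" by (simp add: abs_mult[symmetric])
    moreover have "\<bar>a\<bar> * M = \<bar>a\<bar> + \<bar>a\<bar> + \<bar>k\<bar> * \<bar>a\<bar> + L * \<bar>a\<bar>"
      by (simp add: M_def algebra_simps)
    ultimately have "\<bar>a\<bar> + \<bar>F a\<bar> \<le> \<bar>a\<bar> * M"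
      using F_k[OF a] abs_ge_zero[of a] by linarith
    then have "Q + a *\<^sub>R e - F a *\<^sub>R perp e \<in> ball Q r" using R_M[OF a] by (intro ball) simp
    moreover have "Q + a *\<^sub>R e - F a *\<^sub>R perp e \<in> rot \<theta> ` {(\<xi>, f \<xi>) |\<xi>. l1 < \<xi> \<and> \<xi> < l2}"
      unfolding point using in_l[OF a] by (auto simp: F_def)
    ultimately show ?thesis using \<Gamma> by blast
  qed
  have near: "Q + a *\<^sub>R e - b *\<^sub>R perp e \<in> ball Q r" if "\<bar>a\<bar> < R" "\<bar>b\<bar> < R" for a b
  proof (rule ball)
    have "\<bar>a\<bar> * 2 \<le> \<bar>a\<bar> * M" "\<bar>b\<bar> * 2 \<le> \<bar>b\<bar> * M" using M by (auto intro!: mult_left_mono)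
    then show "\<bar>a\<bar> + \<bar>b\<bar> < r" using R_M[OF that(1)] R_M[OF that(2)] by simp
  qed
  from G' obtain \<Omega>1 \<Omega>2 where \<Omega>12: "(\<Omega>1, \<Omega>2) \<in> {(\<Omega>m, \<Omega>p), (\<Omega>p, \<Omega>m)}"
    and below: "rot \<theta> ` {(\<xi>, \<eta>) |\<xi> \<eta>. l1 < \<xi> \<and> \<xi> < l2 \<and> \<eta> < f \<xi>} \<inter> ball Q r \<subseteq> \<Omega>1"
    and above: "rot \<theta> ` {(\<xi>, \<eta>) |\<xi> \<eta>. l1 < \<xi> \<and> \<xi> < l2 \<and> \<eta> > f \<xi>} \<inter> ball Q r \<subseteq> \<Omega>2"
    by (elim conjE exE)
  have b: "Q + a *\<^sub>R e - b *\<^sub>R perp e \<in> \<Omega>1" if "\<bar>a\<bar> < R" "\<bar>b\<bar> < R" "b < F a" for a b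
  proof -
    have "(\<xi> + a, f \<xi> + b) \<in> {(\<xi>, \<eta>) |\<xi> \<eta>. l1 < \<xi> \<and> \<xi> < l2 \<and> \<eta> < f \<xi>}"
      using in_l[OF that(1)] that(3) by (simp add: F_def)
    then show ?thesis using below near[OF that(1,2)] unfolding point by blast
  qed
  have a: "Q + a *\<^sub>R e - b *\<^sub>R perp e \<in> \<Omega>2" if "\<bar>a\<bar> < R" "\<bar>b\<bar> < R" "F a < b" for a b
  proof -
    have "(\<xi> + a, f \<xi> + b) \<in> {(\<xi>, \<eta>) |\<xi> \<eta>. l1 < \<xi> \<and> \<xi> < l2 \<and> \<eta> > f \<xi>}"
      using in_l[OF that(1)] that(3) by (simp add: F_def)
    then show ?thesis using above near[OF that(1,2)] unfolding point by blast
  qed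
  consider "\<Omega>1 = \<Omega>m" "\<Omega>2 = \<Omega>p" | "\<Omega>1 = \<Omega>p" "\<Omega>2 = \<Omega>m" using \<Omega>12 by blast
  then show thesis
  proof cases
    case 1
    show thesis
    proof (rule that[OF R(1) L(1), of "1"])
      fix a assume "\<bar>a\<bar> < R"
      then show "\<bar>F a - deriv f \<xi> * a\<bar> \<le> L * a\<^sup>2" unfolding k_def[symmetric] by (rule F_k)
    next
      fix a assume "\<bar>a\<bar> < R"
      then show "Q + a *\<^sub>R e - F a *\<^sub>R perp e \<in> \<Gamma>" by (rule curve)
    next
      fix x y assume "\<bar>x\<bar> < R" "\<bar>y\<bar> < R" "0 < 1 * (y - F x)"
      then show "Q + x *\<^sub>R e - y *\<^sub>R perp e \<in> \<Omega>p" using a[of x y] unfolding 1 by simp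
    next
      fix x y assume "\<bar>x\<bar> < R" "\<bar>y\<bar> < R" "0 < - (1) * (y - F x)"
      then show "Q + x *\<^sub>R e - y *\<^sub>R perp e \<in> \<Omega>m" using b[of x y] unfolding 1 by simp
    qed simp
  next
    case 2
    show thesis
    proof (rule that[OF R(1) L(1), of "- 1"])
      fix a assume "\<bar>a\<bar> < R"
      then show "\<bar>F a - deriv f \<xi> * a\<bar> \<le> L * a\<^sup>2" unfolding k_def[symmetric] by (rule F_k)
    next
      fix a assume "\<bar>a\<bar> < R"
      then show "Q + a *\<^sub>R e - F a *\<^sub>R perp e \<in> \<Gamma>" by (rule curve)
    next
      fix x y assume "\<bar>x\<bar> < R" "\<bar>y\<bar> < R" "0 < - 1 * (y - F x)"
      then show "Q + x *\<^sub>R e - y *\<^sub>R perp e \<in> \<Omega>p" using b[of x y] unfolding 2 by simp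
    next
      fix x y assume "\<bar>x\<bar> < R" "\<bar>y\<bar> < R" "0 < - (- 1) * (y - F x)"
      then show "Q + x *\<^sub>R e - y *\<^sub>R perp e \<in> \<Omega>m" using a[of x y] unfolding 2 by simp
    qed simp
  qed
qed

theorem theorem2p5:
  fixes \<gamma> K \<theta> l1 l2 r \<xi>\<^sub>s a1 \<epsilon> :: real
    and \<Omega>m \<Omega>p \<Gamma> :: "(real \<times> real) set"
    and \<phi>m \<phi>p :: "real \<times> real \<Rightarrow> real"
    and f :: "real \<Rightarrow> real"
    and Q W n \<tau> :: "real \<times> real"
    and c :: real
    and \<psi> :: "real \<times> real \<Rightarrow> real"
  assumes "\<gamma> > 1"
    and "sonic_configuration \<gamma> K \<Omega>m \<Omega>p \<phi>m \<phi>p \<Gamma>"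
    and "Q \<in> \<Gamma>"
    and "graph_at \<Omega>m \<Omega>p \<Gamma> Q \<theta> f l1 l2 r"
    and "l1 < \<xi>\<^sub>s" and "\<xi>\<^sub>s < l2" and "Q = rot \<theta> (\<xi>\<^sub>s, f \<xi>\<^sub>s)"
    and "W = pseudo_velocity \<Omega>m \<phi>m Q"
    and "c = sonic_speed \<gamma> K \<Omega>m \<phi>m Q"
    and "\<psi> = psi (two_sided \<Omega>p \<phi>m \<phi>p) W Q"
    and "n = unit_normal \<theta> f \<xi>\<^sub>s"
    and "\<tau> = unit_tangent \<theta> f \<xi>\<^sub>s"
    and "has_perp_derivative_c \<gamma> K \<Omega>m \<phi>m Q 0 \<or> has_perp_derivative_c \<gamma> K \<Omega>p \<phi>p Q 0"
    and "0 < a1" and "a1 < 1 / (\<gamma> + 1)" and "0 < \<epsilon>"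
    and "((\<forall>t\<in>{0<..<\<epsilon>}. \<psi> (Q + t *\<^sub>R n) < a1 * ((n \<bullet> W) / c)\<^sup>2 * t\<^sup>2) \<or>
          (\<forall>t\<in>{-\<epsilon><..<0}. \<psi> (Q + t *\<^sub>R n) < a1 * ((n \<bullet> W) / c)\<^sup>2 * t\<^sup>2)) \<or>
         ((\<forall>s\<in>{0<..<\<epsilon>}. \<psi> (Q + s *\<^sub>R \<tau>) < a1 * ((\<tau> \<bullet> W) / c)\<^sup>2 * s\<^sup>2) \<or>
          (\<forall>s\<in>{-\<epsilon><..<0}. \<psi> (Q + s *\<^sub>R \<tau>) < a1 * ((\<tau> \<bullet> W) / c)\<^sup>2 * s\<^sup>2))"
  shows "exceptional \<theta> f \<xi>\<^sub>s W"
proof (rule ccontr)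
  assume not_exc: "\<not> exceptional \<theta> f \<xi>\<^sub>s W"
  note SC = assms(2)[unfolded sonic_configuration_def]
  note open_m = SC[THEN conjunct1] and SC2 = SC[THEN conjunct2]
  note open_p = SC2[THEN conjunct1] and SC5 = SC2[THEN conjunct2, THEN conjunct2, THEN conjunct2]
  note \<Gamma>_eq = SC5[THEN conjunct1] and SC6 = SC5[THEN conjunct2]
  note C2m = SC6[THEN conjunct1] and SC7 = SC6[THEN conjunct2]
  note flow_m = SC7[THEN conjunct1] and SC9 = SC7[THEN conjunct2, THEN conjunct2]
  note C2p = SC9[THEN conjunct1] and SC10 = SC9[THEN conjunct2]
  note flow_p = SC10[THEN conjunct1] and SC11 = SC10[THEN conjunct2]
  note sub = SC11[THEN conjunct1] and match = SC11[THEN conjunct2, THEN conjunct1]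
  have \<Gamma>_sonic: "\<Gamma> \<subseteq> sonic_points \<gamma> K \<Omega>m \<Omega>p \<phi>m"
    unfolding \<Gamma>_eq curve_interior_def by blast
  then have \<Gamma>_cl: "\<Gamma> \<subseteq> closure \<Omega>m" "\<Gamma> \<subseteq> closure \<Omega>p"
    unfolding sonic_points_def by blast+
  obtain vm Hm where side_m: "flow_side \<gamma> K \<Omega>m (closure \<Omega>m) \<phi>m vm Hm"
    and pv_m: "\<And>x. x \<in> closure \<Omega>m \<Longrightarrow> pseudo_velocity \<Omega>m \<phi>m x = vm x"
    using flow_side_exists[OF assms(1) open_m closure_subset subset_refl C2m flow_m] by blast
  have "\<Omega>p \<union> \<Gamma> \<subseteq> closure \<Omega>p" using \<Gamma>_cl(2) closure_subset by blast
  then obtain vp Hp where side_p: "flow_side \<gamma> K \<Omega>p (\<Omega>p \<union> \<Gamma>) \<phi>p vp Hp"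
    and pv_p: "\<And>x. x \<in> \<Omega>p \<union> \<Gamma> \<Longrightarrow> pseudo_velocity \<Omega>p \<phi>p x = vp x"
    using flow_side_exists[OF assms(1) open_p Un_upper1 _ C2p flow_p] by blast
  have speed_m: "sonic_speed \<gamma> K \<Omega>m \<phi>m x = sqrt (csq \<gamma> K \<phi>m vm x)" if "x \<in> closure \<Omega>m" for x
    by (simp add: sonic_speed_def bernoulli_def csq_def pv_m[OF that] power2_norm_eq_inner)
  have speed_p: "sonic_speed \<gamma> K \<Omega>p \<phi>p x = sqrt (csq \<gamma> K \<phi>p vp x)" if "x \<in> \<Omega>p \<union> \<Gamma>" for x
    by (simp add: sonic_speed_def bernoulli_def csq_def pv_p[OF that] power2_norm_eq_inner)
  have v_eq: "vp x = vm x" and c_eq: "csq \<gamma> K \<phi>p vp x = csq \<gamma> K \<phi>m vm x"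
    and sonic: "vm x \<bullet> vm x = csq \<gamma> K \<phi>m vm x" if "x \<in> \<Gamma>" for x
  proof -
    have cl: "x \<in> closure \<Omega>m" using that \<Gamma>_cl(1) by blast
    show 1: "vp x = vm x"
      using bspec[OF match that] pv_m[OF cl] pv_p[of x] that by simp
    show "csq \<gamma> K \<phi>p vp x = csq \<gamma> K \<phi>m vm x"
      using bspec[OF match that] by (simp add: csq_def 1)
    have "norm (vm x) = sqrt (csq \<gamma> K \<phi>m vm x)"
      using subsetD[OF \<Gamma>_sonic that] unfolding sonic_points_def pv_m[OF cl, symmetric] speed_m[OF cl, symmetric] by simp
    then show "vm x \<bullet> vm x = csq \<gamma> K \<phi>m vm x"
      by (metis norm_eq_sqrt_inner real_sqrt_eq_iff)
  qed
  have Q_cl: "Q \<in> closure \<Omega>m" using assms(3) \<Gamma>_cl(1) by blast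
  have W: "vm Q = W" "vp Q = W" using v_eq[OF assms(3)] by (simp_all add: assms(8) pv_m[OF Q_cl])
  define e k where "e = rot \<theta> (1, 0)" and "k = deriv f \<xi>\<^sub>s"
  define F where "F a = f (\<xi>\<^sub>s + a) - f \<xi>\<^sub>s" for a
  obtain R L \<sigma> where local: "0 < R" "0 \<le> L" "\<bar>\<sigma>\<bar> = 1"
    "\<And>a. \<bar>a\<bar> < R \<Longrightarrow> \<bar>F a - k * a\<bar> \<le> L * a\<^sup>2"
    "\<And>a. \<bar>a\<bar> < R \<Longrightarrow> Q + a *\<^sub>R e - F a *\<^sub>R perp e \<in> \<Gamma>"
    "\<And>a b. \<bar>a\<bar> < R \<Longrightarrow> \<bar>b\<bar> < R \<Longrightarrow> 0 < \<sigma> * (b - F a) \<Longrightarrow> Q + a *\<^sub>R e - b *\<^sub>R perp e \<in> \<Omega>p"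
    "\<And>a b. \<bar>a\<bar> < R \<Longrightarrow> \<bar>b\<bar> < R \<Longrightarrow> 0 < - \<sigma> * (b - F a) \<Longrightarrow> Q + a *\<^sub>R e - b *\<^sub>R perp e \<in> \<Omega>m"
    unfolding e_def k_def F_def by (rule graph_at_local[OF assms(4-7)]) blast
  \<comment> \<open>Both sides share the curve and the coordinates and differ only in the
    sign.\<close>
  interpret m: flow_boundary \<gamma> K \<Omega>m "closure \<Omega>m" \<phi>m vm Hm Q e F k L R "- \<sigma>"
    by (rule flow_boundary.intro[OF side_m], unfold_locales)
      (use local rot_unit \<Gamma>_cl(1) in \<open>auto simp: e_def\<close>)
  interpret p: flow_boundary \<gamma> K \<Omega>p "\<Omega>p \<union> \<Gamma>" \<phi>p vp Hp Q e F k L R \<sigma>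
    by (rule flow_boundary.intro[OF side_p], unfold_locales)
      (use local rot_unit in \<open>auto simp: e_def\<close>)
  have pt_\<Gamma>: "p.pt a \<in> \<Gamma>" if "\<bar>a\<bar> < R" for a
    using local(5)[OF that] by (simp add: p.pt_def)
  have nonexc: "W \<bullet> p.tangent \<noteq> 0"
    using not_exc unfolding p.tangent_def
    by (simp add: exceptional_def rot_neg_components inner_diff_right e_def k_def)
  then have "W \<noteq> 0" by auto
  have q: "csq \<gamma> K \<phi>p vp Q = W \<bullet> W" "csq \<gamma> K \<phi>m vm Q = W \<bullet> W"
    using c_eq[OF assms(3)] sonic[OF assms(3)] by (simp_all add: W)
  have W_pos: "0 < W \<bullet> W" using \<open>W \<noteq> 0\<close> by simp
  have subsonic: "vp x \<bullet> vp x < csq \<gamma> K \<phi>p vp x" if "x \<in> \<Omega>p" for x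
    using bspec[OF sub that] pv_p[of x] speed_p[of x] that
    by (simp add: norm_eq_sqrt_inner)
  \<comment> \<open>The condition on \<open>\<partial>\<^sup>\<bottom> c\<close> may be given from
    either side. From the supersonic side it first yields the mixed entry of \<open>Hm\<close>,
    which is then carried over.\<close>
  have perp_H: "perp W \<bullet> Hp Q W = 0"
    using assms(13)
  proof
    assume "has_perp_derivative_c \<gamma> K \<Omega>p \<phi>p Q 0"
    moreover have "0 \<le> csq \<gamma> K \<phi>p vp x" if "x \<in> insert Q \<Omega>p" for x
    proof (cases "x = Q")
      case True
      then show ?thesis using q W_pos by simp
    next
      case False
      then have "vp x \<bullet> vp x < csq \<gamma> K \<phi>p vp x" using that subsonic by simp
      then show ?thesis using inner_ge_zero[of "vp x"] by linarith
    qed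
    ultimately show ?thesis
      using p.perp_derivative_zero[OF _ pv_p] nonexc unfolding W(2) by blast
  next
    assume perp_m: "has_perp_derivative_c \<gamma> K \<Omega>m \<phi>m Q 0"
    have "0 \<le> csq \<gamma> K \<phi>m vm x" if "x \<in> insert Q \<Omega>m" for x
    proof (cases "x = Q")
      case True
      then show ?thesis using q W_pos by simp
    next
      case False
      then have x: "x \<in> \<Omega>m" using that by simp
      then have "0 \<le> bernoulli K \<Omega>m \<phi>m x" using flow_m unfolding potential_flow_def by (metis surj_pair)
      then show ?thesis
        using assms(1) pv_m[of x] x closure_subset[of \<Omega>m]
        by (auto simp: bernoulli_def csq_def power2_norm_eq_inner)
    qed
    then have "perp W \<bullet> Hm Q W = 0"
      using m.perp_derivative_zero[OF perp_m pv_m] nonexc W(1) by simp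
    then have m0: "Hm Q (perp W) \<bullet> W = 0"
      using m.H_sym[OF m.Q_A, of W "perp W"] by (simp add: inner_commute)
    \<comment> \<open>The velocities agree on the curve, so both Hessians give the same tangential
      derivative of \<open>perp W \<bullet> v\<close>. Their entries across \<open>W\<close> agree
      by the equation; as \<open>W\<close> has a tangential component, the mixed entries agree
      too.\<close>
    have "((\<lambda>a. perp W \<bullet> vm (p.pt a)) has_real_derivative Hp Q (perp W) \<bullet> p.tangent) (at 0)"
      by (rule has_field_derivative_transform_within_open[OF p.deriv_inner_v_along_curve, where S = "{-R<..<R}"])
        (use local(1) v_eq[OF pt_\<Gamma>] in auto)
    then have eq: "Hp Q (perp W) \<bullet> p.tangent = Hm Q (perp W) \<bullet> p.tangent"
      using m.deriv_inner_v_along_curve[of "perp W"] by (rule DERIV_unique)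
    have "Hp Q (perp W) \<bullet> perp W = - (W \<bullet> W)" "Hm Q (perp W) \<bullet> perp W = - (W \<bullet> W)"
      using p.sonic_perp[OF p.Q_A] m.sonic_perp[OF m.Q_A] q W_pos by (simp_all add: W inner_commute)
    then have "(Hp Q (perp W) \<bullet> W) * (W \<bullet> p.tangent) = 0"
      using perp_parseval[of W "Hp Q (perp W)" p.tangent] perp_parseval[of W "Hm Q (perp W)" p.tangent] eq m0
      by (simp add: inner_commute[of p.tangent])
    then have "Hp Q (perp W) \<bullet> W = 0" using nonexc by simp
    then show ?thesis
      using p.H_sym[OF p.Q_A, of W "perp W"] by (simp add: inner_commute)
  qed
  have sonic_p: "vp (p.pt a) \<bullet> vp (p.pt a) = csq \<gamma> K \<phi>p vp (p.pt a)" if "\<bar>a\<bar> < R" for a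
    using v_eq c_eq sonic pt_\<Gamma>[OF that] by simp
  have q': "vp Q \<bullet> vp Q = csq \<gamma> K \<phi>p vp Q" "0 < csq \<gamma> K \<phi>p vp Q" using q W_pos by (simp_all add: W)
  interpret degenerate_sonic_point \<gamma> K \<Omega>p "\<Omega>p \<union> \<Gamma>" \<phi>p vp Hp Q e F k L R \<sigma>
    using p.second_derivative_at_sonic_point[OF q' sonic_p] perp_H nonexc q' subsonic
    by unfold_locales (simp_all add: W)
  show False by (rule no_degenerate_sonic_point)
qed

end
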